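(* Let $(\mathcal G,\mathcal O(I))$ be a PBDTP plabic graph in the disc with $k=|I|$ boundary sources, and let $\epsilon$ be a geometric signature on it. For a face $\Omega$ let $\epsilon(\Omega)=\sum_{e\in\partial\Omega}\epsilon_e$ and let $n_{\mathrm{white}}(\Omega)$ be the number of white vertices on $\partial\Omega$. Then $\epsilon(\Omega)\equiv n_{\mathrm{white}}(\Omega)+1\pmod 2$ if $\Omega$ is a finite face, and $\epsilon(\Omega)\equiv n_{\mathrm{white}}(\Omega)+k\pmod 2$ if $\Omega$ is the infinite face.
   Context: A plabic graph is a finite planar directed graph in a closed disc, no component disjoint from the boundary, with $n$ degree-one boundary vertices $b_1,\dots,b_n$ labelled clockwise on a common arc of the boundary circle, internal vertices of degree $2$ or $3$ in the open disc, edges straight segments, and a perfect orientation: each internal vertex has exactly one incoming edge (white) or exactly one outgoing edge (black), bivalent vertices being assigned a colour. Sources/sinks: boundary vertices with outgoing/incoming edge; $I$ = set of source indices. PBDTP: every edge lies on a directed path starting and ending at boundary vertices. Faces: components of the complement of the graph in the disc; the infinite face is the face containing the boundary arc from $b_n$ to $b_1$ clockwise; all other faces are finite. Geometric signature: a gauge ray direction is a direction $\mathfrak l$ such that rays from boundary vertices in direction $\mathfrak l$ enter the disc, no edge is parallel to $\mathfrak l$, and no such ray passes through an internal vertex; $s(f,g)=1,0,-1$ according as $\det(f,g)>0,=0,<0$; $\mathrm{wind}(e,f)=1$ if $s(e,f)=s(e,\mathfrak l)=s(\mathfrak l,f)=1$, $-1$ if all are $-1$, else $0$; $\mathrm{int}(e)$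 = number of intersections of $e$ with the rays from the sources in direction $\mathfrak l$, times $s(\mathfrak l,e)$. The basic geometric signature is (mod 2): for $e$ from internal $V$ to a sink: $\mathrm{int}(e)$ if $V$ black, $1+\mathrm{int}(e)+\mathrm{wind}(e_1,e)$ if $V$ white with incoming $e_1$; for $e$ from a source to internal $V$: $1+\mathrm{int}(e)+\mathrm{wind}(e,e')$ if $V$ black with outgoing $e'$, $1+\mathrm{int}(e)$ if $V$ white; for internal $e=(U,V)$: $\mathrm{int}(e)$ ($U$ black, $V$ white); $1+\mathrm{int}(e)+\mathrm{wind}(e_1,e)$ ($U,V$ white, $e_1$ incoming at $U$); $1+\mathrm{int}(e)+\mathrm{wind}(e_1,e)+\mathrm{wind}(e,e_5)$ ($U$ white, $V$ black, $e_1$ incoming at $U$, $e_5$ outgoing at $V$); $\mathrm{int}(e)+\mathrm{wind}(e,e_5)$ ($U,V$ black, $e_5$ outgoing at $V$). A geometric signature is any signature equivalent to it, where $\epsilon,\hat\epsilon$ are equivalent if there is $\eta:\{\text{internal vertices}\}\to\{0,1\}$ with $\hat\epsilon_{U,V}\equiv\epsilon_{U,V}+\eta(U)+\eta(V)$ on edges between internal vertices and $\hat\epsilon_{U,V}\equiv\epsilon_{U,V}+\eta(U)$ on edges from internal $U$ to a boundary vertex (mod 2). *)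

theory Defs
  imports "HOL-Analysis.Analysis" "HOL-Number_Theory.Cong"
begin

(* The plane is the type complex, vertices are points, and the edge (u, v) is drawn as the
   straight segment from u to v.  Two vertices span at most one segment, so a set of ordered
   pairs loses no multiple edges.  The boundary vertices are bvert G 1, ..., bvert G (bnum G);
   internal vertices outside white G are black. *)

record plabic =
  centre :: complex
  radius :: real
  bnum :: nat
  bvert :: "nat \<Rightarrow> complex"
  internal :: "complex set"
  white :: "complex set"
  edges :: "(complex \<times> complex) set"

definition boundary :: "plabic \<Rightarrow> complex set" where
  "boundary G = bvert G ` {1..bnum G}"

definition vertices :: "plabic \<Rightarrow> complex set" where
  "vertices G = boundary G \<union> internal G"

definition in_degree :: "plabic \<Rightarrow> complex \<Rightarrow> nat" where
  "in_degree G v = card {u. (u, v) \<in> edges G}"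

definition out_degree :: "plabic \<Rightarrow> complex \<Rightarrow> nat" where
  "out_degree G v = card {w. (v, w) \<in> edges G}"

definition degree :: "plabic \<Rightarrow> complex \<Rightarrow> nat" where
  "degree G v = in_degree G v + out_degree G v"

(* Clockwise means decreasing angle.  All rays in a common direction can enter the disc only
   from within an open half circle, so the common arc is taken shorter than a half circle;
   otherwise a cyclic shift of the labels would be allowed, which changes the infinite face. *)

definition boundary_on_common_arc :: "plabic \<Rightarrow> bool" where
  "boundary_on_common_arc G \<longleftrightarrow>
     (\<exists>\<theta> :: nat \<Rightarrow> real.
        (\<forall>i\<in>{1..bnum G}. bvert G i = centre G + of_real (radius G) * cis (\<theta> i)) \<and>
        (\<forall>i\<in>{1..bnum G}. \<forall>j\<in>{1..bnum G}. i < j \<longrightarrow> \<theta> j < \<theta> i) \<and>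
        \<theta> 1 - \<theta> (bnum G) < pi)"

definition planar_embedding :: "plabic \<Rightarrow> bool" where
  "planar_embedding G \<longleftrightarrow>
     (\<forall>(u, v)\<in>edges G. u \<noteq> v \<and> open_segment u v \<inter> vertices G = {}) \<and>
     (\<forall>(u, v)\<in>edges G. \<forall>(u', v')\<in>edges G.
        (u, v) \<noteq> (u', v') \<longrightarrow> open_segment u v \<inter> open_segment u' v' = {})"

definition perfect_orientation :: "plabic \<Rightarrow> bool" where
  "perfect_orientation G \<longleftrightarrow>
     (\<forall>v\<in>internal G. (v \<in> white G \<longrightarrow> in_degree G v = 1) \<and>
                     (v \<notin> white G \<longrightarrow> out_degree G v = 1))"

definition no_component_off_boundary :: "plabic \<Rightarrow> bool" where
  "no_component_off_boundary G \<longleftrightarrow>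
     (\<forall>v\<in>vertices G. \<exists>b\<in>boundary G. (v, b) \<in> (edges G \<union> (edges G)\<inverse>)\<^sup>*)"

(* Edges joining two boundary vertices are excluded: no clause of the basic geometric signature
   covers them (one may always insert a bivalent vertex). *)

definition plabic_graph :: "plabic \<Rightarrow> bool" where
  "plabic_graph G \<longleftrightarrow>
     0 < radius G \<and> 0 < bnum G \<and> boundary_on_common_arc G \<and>
     finite (internal G) \<and> internal G \<subseteq> ball (centre G) (radius G) \<and> white G \<subseteq> internal G \<and>
     edges G \<subseteq> vertices G \<times> vertices G \<and> edges G \<inter> boundary G \<times> boundary G = {} \<and>
     (\<forall>b\<in>boundary G. degree G b = 1) \<and> (\<forall>v\<in>internal G. degree G v \<in> {2, 3}) \<and>
     planar_embedding G \<and> perfect_orientation G \<and> no_component_off_boundary G"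

definition source_indices :: "plabic \<Rightarrow> nat set" where
  "source_indices G = {i \<in> {1..bnum G}. \<exists>v. (bvert G i, v) \<in> edges G}"

(* Directed paths may revisit vertices and edges. *)

definition path_edges :: "complex list \<Rightarrow> (complex \<times> complex) set" where
  "path_edges p = set (zip p (tl p))"

definition PBDTP :: "plabic \<Rightarrow> bool" where
  "PBDTP G \<longleftrightarrow>
     (\<forall>e\<in>edges G. \<exists>p. p \<noteq> [] \<and> path_edges p \<subseteq> edges G \<and>
        hd p \<in> boundary G \<and> last p \<in> boundary G \<and> e \<in> path_edges p)"


definition drawing :: "plabic \<Rightarrow> complex set" where
  "drawing G = vertices G \<union> (\<Union>(u, v)\<in>edges G. closed_segment u v)"

definition faces :: "plabic \<Rightarrow> complex set set" where
  "faces G = components (cball (centre G) (radius G) - drawing G)"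

(* The open arc of the circle of centre c and radius r running clockwise from p to q. *)

definition clockwise_arc :: "complex \<Rightarrow> real \<Rightarrow> complex \<Rightarrow> complex \<Rightarrow> complex set" where
  "clockwise_arc c r p q =
     {c + of_real r * cis t | t. \<exists>\<alpha> \<beta>. p = c + of_real r * cis \<alpha> \<and> q = c + of_real r * cis \<beta> \<and>
        \<beta> < t \<and> t < \<alpha> \<and> \<alpha> \<le> \<beta> + 2 * pi}"

definition infinite_face :: "plabic \<Rightarrow> complex set \<Rightarrow> bool" where
  "infinite_face G \<Omega> \<longleftrightarrow> \<Omega> \<in> faces G \<and>
     clockwise_arc (centre G) (radius G) (bvert G (bnum G)) (bvert G 1) \<subseteq> \<Omega>"

definition finite_face :: "plabic \<Rightarrow> complex set \<Rightarrow> bool" where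
  "finite_face G \<Omega> \<longleftrightarrow> \<Omega> \<in> faces G \<and> \<not> infinite_face G \<Omega>"

definition face_edges :: "plabic \<Rightarrow> complex set \<Rightarrow> (complex \<times> complex) set" where
  "face_edges G \<Omega> = {(u, v) \<in> edges G. closed_segment u v \<subseteq> frontier \<Omega>}"

definition n_white :: "plabic \<Rightarrow> complex set \<Rightarrow> nat" where
  "n_white G \<Omega> = card (white G \<inter> frontier \<Omega>)"


definition det2 :: "complex \<Rightarrow> complex \<Rightarrow> real" where
  "det2 f g = Re f * Im g - Im f * Re g"

definition orient :: "complex \<Rightarrow> complex \<Rightarrow> int" where
  "orient f g = (if det2 f g > 0 then 1 else if det2 f g = 0 then 0 else - 1)"

(* The origin is left out of the ray: the edge starting at a source does not count as meeting
   the ray of that source there. *)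

definition ray :: "complex \<Rightarrow> complex \<Rightarrow> complex set" where
  "ray b l = {b + of_real t * l | t. 0 < t}"

definition gauge_direction :: "plabic \<Rightarrow> complex \<Rightarrow> bool" where
  "gauge_direction G l \<longleftrightarrow> l \<noteq> 0 \<and>
     (\<forall>b\<in>boundary G. ray b l \<inter> ball (centre G) (radius G) \<noteq> {}) \<and>
     (\<forall>(u, v)\<in>edges G. det2 (v - u) l \<noteq> 0) \<and>
     (\<forall>b\<in>boundary G. ray b l \<inter> internal G = {})"

definition wind :: "complex \<Rightarrow> complex \<Rightarrow> complex \<Rightarrow> int" where
  "wind l e f =
     (if orient e f = 1 \<and> orient e l = 1 \<and> orient l f = 1 then 1
      else if orient e f = - 1 \<and> orient e l = - 1 \<and> orient l f = - 1 then - 1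
      else 0)"

definition intersection_number :: "plabic \<Rightarrow> complex \<Rightarrow> complex \<times> complex \<Rightarrow> int" where
  "intersection_number G l e = (case e of (u, v) \<Rightarrow>
     int (card (closed_segment u v \<inter> (\<Union>i\<in>source_indices G. ray (bvert G i) l)))
       * orient l (v - u))"

definition incoming :: "plabic \<Rightarrow> complex \<Rightarrow> complex" where
  "incoming G v = v - (THE u. (u, v) \<in> edges G)"

definition outgoing :: "plabic \<Rightarrow> complex \<Rightarrow> complex" where
  "outgoing G v = (THE w. (v, w) \<in> edges G) - v"

(* Signatures are represented by integers, which only matter modulo 2. *)

definition basic_signature :: "plabic \<Rightarrow> complex \<Rightarrow> complex \<times> complex \<Rightarrow> int" where
  "basic_signature G l e = (case e of (u, v) \<Rightarrow>
     (let N = intersection_number G l (u, v);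
          wU = wind l (incoming G u) (v - u);
          wV = wind l (v - u) (outgoing G v)
      in if v \<in> boundary G then (if u \<in> white G then 1 + N + wU else N)
         else if u \<in> boundary G then (if v \<in> white G then 1 + N else 1 + N + wV)
         else if u \<in> white G then (if v \<in> white G then 1 + N + wU else 1 + N + wU + wV)
         else (if v \<in> white G then N else N + wV)))"

(* On an edge at the boundary only the internal endpoint acts, whichever way the edge points. *)

definition equivalent_signatures ::
  "plabic \<Rightarrow> (complex \<times> complex \<Rightarrow> int) \<Rightarrow> (complex \<times> complex \<Rightarrow> int) \<Rightarrow> bool" where
  "equivalent_signatures G \<epsilon> \<epsilon>' \<longleftrightarrow>
     (\<exists>\<eta> :: complex \<Rightarrow> int. (\<forall>v\<in>internal G. \<eta> v \<in> {0, 1}) \<and>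
        (\<forall>(u, v)\<in>edges G.
           (u \<in> internal G \<and> v \<in> internal G \<longrightarrow> [\<epsilon>' (u, v) = \<epsilon> (u, v) + \<eta> u + \<eta> v] (mod 2)) \<and>
           (u \<in> internal G \<and> v \<in> boundary G \<longrightarrow> [\<epsilon>' (u, v) = \<epsilon> (u, v) + \<eta> u] (mod 2)) \<and>
           (u \<in> boundary G \<and> v \<in> internal G \<longrightarrow> [\<epsilon>' (u, v) = \<epsilon> (u, v) + \<eta> v] (mod 2))))"

definition geometric_signature :: "plabic \<Rightarrow> (complex \<times> complex \<Rightarrow> int) \<Rightarrow> bool" where
  "geometric_signature G \<epsilon> \<longleftrightarrow>
     (\<exists>l. gauge_direction G l \<and> equivalent_signatures G (basic_signature G l) \<epsilon>)"

definition face_signature :: "plabic \<Rightarrow> (complex \<times> complex \<Rightarrow> int) \<Rightarrow> complex set \<Rightarrow> int" where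
  "face_signature G \<epsilon> \<Omega> = (\<Sum>e\<in>face_edges G \<Omega>. \<epsilon> e)"

end

(* Let the gauge direction point down.  No edge is vertical, so every edge e has a face above(e) and a
   face below(e); they differ because PBDTP excludes bridges of the graph together with the circle.

   Fix a face C.  Cutting C along the vertical chords rising from those internal vertices that have C
   directly above them raises the number of pieces by one per chord, as C is simply connected, and leaves
   one piece above each edge e with above(e) = C, plus the piece above the lower arc of the circle if C is
   the infinite face.  Hence
     #{e. above(e) = C} + [C infinite] = #{v internal. C is directly above v} + 1.

   The sum of the basic signature over the boundary of C, plus the number of its white vertices, is local
   mod 2: at an internal vertex v the terms add up to [C directly above v] + sum over the outgoing edges e
   of [above(e) = C], and following the ray of a source down through the faces contributes
   [C infinite] + [above(e) = C] for the edge e at the source.  In total every edge contributes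
   [above(e) = C] exactly once, so the displayed relation gives k [C infinite] + 1 + [C infinite].  A change
   of signature by eta does not matter since C has two boundary edges at each vertex on its boundary. *)

theory Submission
  imports Defs
begin

subsection \<open>Crosscuts of plane domains\<close>

text \<open>The boundary of a face is never traced as a closed walk. A face enters only through
  germs, the points just above or below an edge or a vertex. Simple connectivity is used solely in
  the form \<open>connected (- C)\<close>: it survives crosscuts, and the Janiszewski theorem turns
  it into the statement that a crosscut has two different sides. The local cancellations come from
  differences. Climbing through the edges on one side of a vertex, or descending a ray through the
  edges it crosses, the face after one edge is the face before the next, so the differences of the
  indicators of \<open>above\<close> and \<open>below\<close> telescope to the two end faces. Mod 2
  the sign is irrelevant, and the sum of the two indicators marks the edges on the boundary of the
  face. The \<open>wind\<close> terms fit in because mod 2 they mark whether the outgoing edge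
  leaves the vertex on the same side as the incoming one and below it. The degree bound 3 matters at
  one point: it allows a face only one corner at a vertex, so that counting white vertices is the
  same as counting corners.\<close>

lemma det2_add_right: "det2 a (x + y) = det2 a x + det2 a y"
  and det2_diff_right: "det2 a (x - y) = det2 a x - det2 a y"
  and det2_scale_right: "det2 a (of_real t * x) = t * det2 a x"
  and det2_self: "det2 a a = 0"
  and det2_minus_right: "det2 a (- x) = - det2 a x"
  by (simp_all add: det2_def algebra_simps)

lemma det2_commute: "det2 x y = - det2 y x"
  by (simp add: det2_def)

lemma convex_det2_halfplane: "convex {z. 0 < det2 a (z - p) * k}"
proof -
  have "linear (\<lambda>z. det2 a z * k)"
    by (rule linearI) (simp_all add: det2_add_right det2_scale_right distrib_right scaleR_conv_of_real)
  then have "convex ((\<lambda>z. det2 a z * k) -` {det2 a p * k<..})"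
    by (intro convex_linear_vimage) simp_all
  then show ?thesis by (simp add: vimage_def det2_diff_right left_diff_distrib)
qed

text \<open>Germs along \<open>at_right 0\<close> are the language for what lies just beside an edge
  or a vertex; this is their source.\<close>

lemma eventually_translate_ball:
  fixes z n :: complex
  assumes "open U" "z \<in> U"
  shows "\<forall>\<^sub>F t in at_right (0::real). z + of_real t * n \<in> U"
proof -
  have "((\<lambda>t. z + of_real t * n) \<longlongrightarrow> z + of_real 0 * n) (at_right (0::real))"
    by (intro tendsto_intros tendsto_of_real)
  then show ?thesis using assms by (simp add: topological_tendstoD)
qed

lemma det2_on_open_segment:
  assumes "w \<in> open_segment p q"
  shows "det2 (q - p) (w - p) = 0"
proof -
  obtain u where "w = (1 - u) *\<^sub>R p + u *\<^sub>R q" using assms by (auto simp: in_segment)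
  then have "w - p = of_real u * (q - p)" by (simp add: scaleR_conv_of_real algebra_simps)
  then show ?thesis by (simp add: det2_scale_right det2_self)
qed

text \<open>Small half discs on the \<open>n\<close> side avoid the segment, so each lies in one
  component; neighbouring ones overlap, hence this component is locally constant along the segment
  and thus constant. The product of two determinants selects the side of \<open>n\<close> whatever
  the order of \<open>p\<close> and \<open>q\<close>.\<close>

lemma segment_one_side:
  assumes "open K" and pq: "p \<noteq> q" and seg: "open_segment p q \<subseteq> K"
    and n: "det2 (q - p) n \<noteq> 0"
  obtains P where "P \<in> components (K - open_segment p q)"
    "\<And>w. w \<in> open_segment p q \<Longrightarrow>
       \<exists>\<delta>>0. ball w \<delta> \<subseteq> K \<and> ball w \<delta> \<inter> {z. 0 < det2 (q - p) (z - p) * det2 (q - p) n} \<subseteq> P"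
proof -
  let ?s = "open_segment p q" and ?H = "{z. 0 < det2 (q - p) (z - p) * det2 (q - p) n}"
  have "\<forall>w\<in>?s. \<exists>\<delta>>0. ball w \<delta> \<subseteq> K" using \<open>open K\<close> seg open_contains_ball by blast
  then obtain \<delta> where \<delta>: "\<And>w. w \<in> ?s \<Longrightarrow> \<delta> w > 0 \<and> ball w (\<delta> w) \<subseteq> K" by metis
  define B where "B w = ball w (\<delta> w) \<inter> ?H" for w
  have inH: "w + of_real t * n \<in> ?H" if "w \<in> ?s" "t > 0" for w t
  proof -
    have "w + of_real t * n - p = (w - p) + of_real t * n" by simp
    then have "det2 (q - p) (w + of_real t * n - p) = t * det2 (q - p) n"
      by (simp only: det2_add_right det2_scale_right det2_on_open_segment[OF that(1)])
    then show ?thesis using that n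
      by (simp add: mult.assoc) (metis linorder_neqE_linordered_idom mult_neg_neg mult_pos_pos)
  qed
  have meet: "B w \<inter> B w' \<noteq> {}" if w: "w' \<in> ?s" "w' \<in> ball w (\<delta> w)" for w w'
  proof -
    have "\<forall>\<^sub>F t in at_right (0::real). w' + of_real t * n \<in> ball w (\<delta> w) \<inter> ball w' (\<delta> w')"
      by (rule eventually_translate_ball) (use w \<delta>[OF w(1)] in auto)
    moreover have "\<forall>\<^sub>F t in at_right (0::real). 0 < t" by (simp add: eventually_at_right_less)
    ultimately have "\<forall>\<^sub>F t in at_right (0::real). w' + of_real t * n \<in> B w \<inter> B w'"
      by eventually_elim (use inH[OF w(1)] in \<open>auto simp: B_def\<close>)
    then show ?thesis using eventually_happens' trivial_limit_at_right_real by blast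
  qed
  have "\<exists>C. C \<in> components (K - ?s) \<and> B w \<subseteq> C" if w: "w \<in> ?s" for w
  proof (rule exists_component_superset)
    show sub: "B w \<subseteq> K - ?s" using \<delta>[OF w] det2_on_open_segment by (fastforce simp: B_def)
    show "K - ?s \<noteq> {}" using sub meet[OF w, of w] \<delta>[OF w] by auto
    show "connected (B w)" unfolding B_def by (intro convex_connected convex_Int convex_det2_halfplane convex_ball)
  qed
  then obtain f where f: "\<And>w. w \<in> ?s \<Longrightarrow> f w \<in> components (K - ?s) \<and> B w \<subseteq> f w" by metis
  have "\<forall>w\<in>?s. \<forall>\<^sub>F w' in at w within ?s. f w = f w'"
  proof
    fix w assume w: "w \<in> ?s"
    have "\<forall>\<^sub>F w' in at w within ?s. w' \<in> ball w (\<delta> w)"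
      using \<delta>[OF w] by (metis centre_in_ball eventually_at_topological open_ball)
    moreover have "\<forall>\<^sub>F w' in at w within ?s. w' \<in> ?s" by (simp add: eventually_at_filter)
    ultimately show "\<forall>\<^sub>F w' in at w within ?s. f w = f w'"
    proof eventually_elim
      case (elim w')
      then have "f w \<inter> f w' \<noteq> {}" using meet[of w' w] f[OF w] f[of w'] by blast
      then show ?case using components_eq f[OF w] f[of w'] elim(2) by blast
    qed
  qed
  then have const: "f w = f w'" if "w \<in> ?s" "w' \<in> ?s" for w w'
    using connected_local_const[OF convex_connected[OF convex_open_segment] that] by blast
  obtain w0 where w0: "w0 \<in> ?s" using pq by (metis equals0I open_segment_eq_empty)
  show thesis
  proof (rule that[of "f w0"])
    show "f w0 \<in> components (K - ?s)" using f[OF w0] by blast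
    show "\<exists>\<delta>>0. ball w \<delta> \<subseteq> K \<and> ball w \<delta> \<inter> ?H \<subseteq> f w0" if "w \<in> ?s" for w
      using \<delta>[OF that] f[OF that] const[OF that w0] unfolding B_def by blast
  qed
qed

text \<open>The candidates are the components on the two sides of the segment. A third one could not
  accumulate at the segment, so it would be open and closed in the connected set
  \<open>K\<close>.\<close>

lemma segment_sides:
  assumes "open K" "connected K" "p \<noteq> q" and seg: "open_segment p q \<subseteq> K"
    and pqK: "p \<notin> K" "q \<notin> K" and n: "det2 (q - p) n \<noteq> 0"
  obtains P Q where "components (K - open_segment p q) = {P, Q}"
    "\<And>w. w \<in> open_segment p q \<Longrightarrow>
       \<forall>\<^sub>F t in at_right 0. w + of_real t * n \<in> P \<and> w - of_real t * n \<in> Q"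
proof -
  let ?s = "open_segment p q"
  let ?H = "\<lambda>\<sigma>. {z. 0 < det2 (q - p) (z - p) * det2 (q - p) (of_real \<sigma> * n)}"
  have op: "open (K - ?s)"
  proof -
    have "K - ?s = K - closed_segment p q" using pqK by (auto simp: open_segment_def)
    then show ?thesis using \<open>open K\<close> by (simp add: open_Diff)
  qed
  obtain P where P: "P \<in> components (K - ?s)"
    "\<And>w. w \<in> ?s \<Longrightarrow> \<exists>\<delta>>0. ball w \<delta> \<subseteq> K \<and> ball w \<delta> \<inter> ?H 1 \<subseteq> P"
    using segment_one_side[OF assms(1,3,4) n] by auto
  obtain Q where Q: "Q \<in> components (K - ?s)"
    "\<And>w. w \<in> ?s \<Longrightarrow> \<exists>\<delta>>0. ball w \<delta> \<subseteq> K \<and> ball w \<delta> \<inter> ?H (-1) \<subseteq> Q"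
    using segment_one_side[OF assms(1,3,4), of "-n"] n by (auto simp: det2_minus_right)
  have germ: "\<forall>\<^sub>F t in at_right 0. w + of_real t * (of_real \<sigma> * n) \<in> C"
    if w: "w \<in> ?s" and s0: "\<sigma> \<noteq> 0" and ex: "\<exists>\<delta>>0. ball w \<delta> \<subseteq> K \<and> ball w \<delta> \<inter> ?H \<sigma> \<subseteq> C" for w \<sigma> C
  proof -
    obtain \<delta> where d: "\<delta> > 0" "ball w \<delta> \<inter> ?H \<sigma> \<subseteq> C" using ex by blast
    have "\<forall>\<^sub>F t in at_right (0::real). w + of_real t * (of_real \<sigma> * n) \<in> ball w \<delta>"
      by (rule eventually_translate_ball) (use d in auto)
    moreover have "\<forall>\<^sub>F t in at_right (0::real). 0 < t" by (simp add: eventually_at_right_less)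
    ultimately show ?thesis
    proof eventually_elim
      case (elim t)
      have "w + of_real t * (of_real \<sigma> * n) - p = (w - p) + of_real t * (of_real \<sigma> * n)" by simp
      then have e: "det2 (q - p) (w + of_real t * (of_real \<sigma> * n) - p) = t * (\<sigma> * det2 (q - p) n)"
        by (simp only: det2_add_right det2_scale_right det2_on_open_segment[OF w])
      have "0 < \<sigma> * det2 (q - p) n * (\<sigma> * det2 (q - p) n)"
        using n s0 by (metis mult_eq_0_iff not_real_square_gt_zero)
      then have "w + of_real t * (of_real \<sigma> * n) \<in> ?H \<sigma>"
        using elim(2) unfolding mem_Collect_eq e by (simp add: det2_scale_right mult.assoc)
      then show ?case using elim(1) d(2) by blast
    qed
  qed
  have "X \<in> {P, Q}" if X: "X \<in> components (K - ?s)" for X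
  proof (rule ccontr)
    assume "X \<notin> {P, Q}"
    then have dis: "X \<inter> P = {}" "X \<inter> Q = {}" using X P(1) Q(1) components_nonoverlap by blast+
    have oX: "open X" using X op open_components by blast
    have Xs: "X \<subseteq> K - ?s" "X \<noteq> {}" using X in_components_subset in_components_nonempty by blast+
    have far: "w \<notin> closure X" if w: "w \<in> ?s" for w
    proof -
      obtain d1 where d1: "d1 > 0" "ball w d1 \<subseteq> K" "ball w d1 \<inter> ?H 1 \<subseteq> P" using P(2)[OF w] by blast
      obtain d2 where d2: "d2 > 0" "ball w d2 \<inter> ?H (-1) \<subseteq> Q" using Q(2)[OF w] by blast
      let ?B = "ball w (min d1 d2)"
      \<comment> \<open>Off the line through \<open>p\<close> and \<open>q\<close>, a point near
        \<open>w\<close> is in \<open>P\<close> or \<open>Q\<close>, so \<open>X\<close> could meet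
        the ball on that line only; being open, it then misses the ball.\<close>
      have offline: "det2 (q - p) (z - p) = 0" if "z \<in> ?B \<inter> X" for z
      proof (rule ccontr)
        assume nz: "det2 (q - p) (z - p) \<noteq> 0"
        have "z \<in> ?H 1 \<or> z \<in> ?H (-1)"
        proof -
          have "det2 (q - p) (z - p) * det2 (q - p) n \<noteq> 0" using nz n by simp
          then have "det2 (q - p) (z - p) * det2 (q - p) n < 0 \<or> 0 < det2 (q - p) (z - p) * det2 (q - p) n"
            by linarith
          then show ?thesis by (simp add: det2_minus_right disj_commute)
        qed
        then show False using that d1 d2 dis by auto
      qed
      have "?B \<inter> X = {}"
      proof (rule ccontr)
        assume "?B \<inter> X \<noteq> {}"
        then obtain z where z: "z \<in> ?B \<inter> X" by blast
        have "\<forall>\<^sub>F t in at_right (0::real). z + of_real t * n \<in> ?B \<inter> X"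
          by (rule eventually_translate_ball) (use z oX in auto)
        moreover have "\<forall>\<^sub>F t in at_right (0::real). 0 < t" by (simp add: eventually_at_right_less)
        ultimately have "\<forall>\<^sub>F t in at_right (0::real). False"
        proof eventually_elim
          case (elim t)
          have "z + of_real t * n - p = (z - p) + of_real t * n" by simp
          then have "det2 (q - p) (z + of_real t * n - p) = t * det2 (q - p) n"
            using offline[OF z] by (simp only: det2_add_right det2_scale_right)
          then show ?case using offline[OF elim(1)] elim(2) n by simp
        qed
        then show False by simp
      qed
      then show ?thesis
        using d1(1) d2(1) open_Int_closure_eq_empty[of ?B X] by (metis IntI centre_in_ball emptyE min_less_iff_conj open_ball)
    qed
    have "closedin (top_of_set K) X"
    proof -
      have "X = K \<inter> closure X"
      proof
        show "X \<subseteq> K \<inter> closure X" using Xs closure_subset by blast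
        show "K \<inter> closure X \<subseteq> X"
        proof
          fix z assume z: "z \<in> K \<inter> closure X"
          then have "z \<in> K - ?s" using far by blast
          have "closedin (top_of_set (K - ?s)) X" using X closedin_component by blast
          then show "z \<in> X" using \<open>z \<in> K - ?s\<close> z by (auto simp: closedin_limpt closure_def)
        qed
      qed
      then show ?thesis by (metis closed_closure closedin_closed_Int)
    qed
    moreover have "openin (top_of_set K) X" using oX Xs by (simp add: open_subset Diff_subset subset_trans)
    ultimately have "X = K" using \<open>connected K\<close> Xs by (metis connected_clopen)
    then show False using Xs seg \<open>p \<noteq> q\<close> by (metis Diff_iff equals0I open_segment_eq_empty subsetD)
  qed
  then have "components (K - ?s) = {P, Q}" using P(1) Q(1) by blast
  moreover have "\<forall>\<^sub>F t in at_right 0. w + of_real t * n \<in> P \<and> w - of_real t * n \<in> Q" if "w \<in> ?s" for w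
    using germ[OF that _ P(2)[OF that]] germ[OF that _ Q(2)[OF that]] by (intro eventually_conj) auto
  ultimately show thesis using that by blast
qed

text \<open>By \<open>Janiszewski_dual\<close>, two compact connected plane sets whose union has
  connected complement meet in a connected set. Here these are the complement of \<open>K\<close>,
  seen through an inversion, and the segment; they meet in just the two end points.\<close>

lemma crosscut_disconnects:
  fixes K :: "complex set"
  assumes "bounded K" and op: "open K" and K: "connected (- K)" and pq: "p \<noteq> q"
    and seg: "open_segment p q \<subseteq> K" and pqK: "p \<notin> K" "q \<notin> K"
  shows "\<not> connected (K - open_segment p q)"
proof
  assume c: "connected (K - open_segment p q)"
  have "K - open_segment p q = K - closed_segment p q" using pqK by (auto simp: open_segment_def)
  then have oK: "open (K - open_segment p q)" using op by (simp add: open_Diff)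
  have "K - open_segment p q \<noteq> {}"
  proof
    assume "K - open_segment p q = {}"
    then have "K = open_segment p q" using seg by blast
    then have "open (open_segment p q)" using op by simp
    then have "interior (open_segment p q) = open_segment p q" by (rule interior_open)
    then show False using pq by (simp add: interior_open_segment)
  qed
  then obtain a where a: "a \<in> K" "a \<notin> open_segment p q" by blast
  \<comment> \<open>Inversion at \<open>a\<close> makes the unbounded complement of \<open>K\<close> compact, as \<open>Janiszewski_dual\<close> requires.\<close>
  define f where "f z = inverse (z - a)" for z
  have cf: "continuous_on X f" if "a \<notin> X" for X
    unfolding f_def using that by (intro continuous_intros) auto
  \<comment> \<open>\<open>0\<close> is the image of infinity. Adding it closes up the image of
    \<open>- K\<close>, and connectedness survives because it is a limit point.\<close>
  let ?S = "insert 0 (f ` (- K))" and ?T = "f ` closed_segment p q"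
  have finv: "a + inverse w \<in> X \<longleftrightarrow> w \<in> f ` X" if "w \<noteq> 0" "a \<notin> X" for w X
  proof
    assume "a + inverse w \<in> X"
    then show "w \<in> f ` X" by (intro image_eqI[of _ _ "a + inverse w"]) (auto simp: f_def)
  next
    assume "w \<in> f ` X"
    then show "a + inverse w \<in> X" by (auto simp: f_def)
  qed
  have f0: "f z \<noteq> 0" if "z \<noteq> a" for z using that by (simp add: f_def)
  have finj: "inj f" by (auto simp: inj_on_def f_def)
  have "connected (f ` (- K))" using K cf[of "- K"] a by (intro connected_continuous_image) auto
  moreover have 0: "0 \<in> closure (f ` (- K))"
  proof (unfold closure_approachable, intro allI impI)
    fix e :: real assume "0 < e"
    obtain R where R: "K \<subseteq> ball 0 R" using \<open>bounded K\<close> bounded_subset_ballD by blast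
    define z :: complex where "z = of_real (\<bar>R\<bar> + norm a + 1 / e + 1)"
    have nz: "norm z = \<bar>R\<bar> + norm a + 1 / e + 1"
      unfolding z_def norm_of_real using \<open>0 < e\<close> by simp
    have "0 < 1 / e" using \<open>0 < e\<close> by simp
    then have "R \<le> norm z" using nz norm_ge_zero[of a] by linarith
    then have "z \<notin> ball 0 R" by simp
    then have "z \<notin> K" using R by blast
    have "1 / e < norm (z - a)" using norm_triangle_ineq2[of z a] nz by linarith
    then have "inverse (norm (z - a)) < inverse (1 / e)"
      using \<open>0 < 1 / e\<close> by (rule less_imp_inverse_less)
    then have "dist (f z) 0 < e" by (simp add: f_def norm_inverse)
    then show "\<exists>y\<in>f ` (- K). dist y 0 < e" using \<open>z \<notin> K\<close> by blast
  qed
  ultimately have "connected ?S"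
    using connected_intermediate_closure[of "f ` (- K)" ?S] closure_subset[of "f ` (- K)"] 0
    by (simp add: subset_insertI)
  have "compact ?S"
  proof -
    obtain d where d: "d > 0" "ball a d \<subseteq> K" using a op open_contains_ball by blast
    have "bounded ?S"
    proof (rule boundedI[of _ "1 / d"])
      fix y assume "y \<in> ?S"
      then consider "y = 0" | z where "z \<notin> K" "y = f z" by auto
      then show "norm y \<le> 1 / d"
      proof cases
        case 1 then show ?thesis using d by simp
      next
        case 2
        then have "d \<le> norm (z - a)" using d(2) by (auto simp: dist_norm norm_minus_commute subset_iff not_less)
        then have "inverse (norm (z - a)) \<le> inverse d" using d(1) by (rule le_imp_inverse_le)
        then show ?thesis using 2 by (simp add: f_def norm_inverse divide_inverse)
      qed
    qed
    moreover have "closed ?S"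
    proof -
      have "- ?S = {w \<in> - {0}. a + inverse w \<in> K}"
        using finv[of _ "- K"] a f0 by auto
      moreover have "open {w \<in> - {0}. a + inverse w \<in> K}"
        by (rule continuous_open_preimage[unfolded vimage_def Int_def Collect_conj_eq[symmetric], simplified])
          (auto intro!: continuous_intros op)
      ultimately show ?thesis by (simp add: closed_def)
    qed
    ultimately show ?thesis by (simp add: compact_eq_bounded_closed)
  qed
  have aT: "a \<notin> closed_segment p q" using a pqK by (auto simp: open_segment_def)
  have "compact ?T" "connected ?T"
    using cf[OF aT] by (auto intro!: compact_continuous_image connected_continuous_image)
  have eq: "- (?S \<union> ?T) = f ` (K - open_segment p q - {a})"
  proof (intro equalityI subsetI)
    fix w assume w: "w \<in> - (?S \<union> ?T)"
    then have "a + inverse w \<in> K - open_segment p q - {a}"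
      using finv[of w "- K"] finv[of w "closed_segment p q"] a aT by (auto simp: open_segment_def)
    then show "w \<in> f ` (K - open_segment p q - {a})"
      by (intro image_eqI[of _ _ "a + inverse w"]) (auto simp: f_def)
  next
    fix w assume "w \<in> f ` (K - open_segment p q - {a})"
    then obtain z where "z \<in> K" "z \<notin> open_segment p q" "z \<noteq> a" "w = f z" by blast
    then show "w \<in> - (?S \<union> ?T)" using f0 finj pqK by (auto simp: inj_eq open_segment_def)
  qed
  \<comment> \<open>The pole \<open>a\<close> of \<open>f\<close> has to be left out; an open
    connected plane set stays connected without one point.\<close>
  have "connected (K - open_segment p q - {a})"
    by (rule connected_open_delete[OF oK c]) simp
  then have "connected (- (?S \<union> ?T))"
    unfolding eq by (intro connected_continuous_image cf) auto
  then have "connected (?S \<inter> ?T)"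
    by (rule Janiszewski_dual[OF \<open>compact ?S\<close> \<open>compact ?T\<close> \<open>connected ?S\<close> \<open>connected ?T\<close>])
  moreover have "?S \<inter> ?T = {f p, f q}"
  proof (intro equalityI subsetI)
    fix w assume "w \<in> ?S \<inter> ?T"
    then obtain z where z: "w = f z" "z \<in> closed_segment p q" "w = 0 \<or> z \<notin> K"
      using finj by (auto simp: inj_eq)
    then have "z \<notin> K" using f0 aT by metis
    then have "z = p \<or> z = q" using seg z(2) by (auto simp: open_segment_def)
    then show "w \<in> {f p, f q}" using z(1) by blast
  qed (use pqK in auto)
  moreover have "f p \<noteq> f q" using pq finj by (simp add: inj_eq)
  ultimately show False
    using connected_finite_iff_sing[of "{f p, f q}"] by (auto simp: doubleton_eq_iff)
qed

lemma crosscut_components: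
  fixes K :: "complex set"
  assumes K: "bounded K" "open K" "connected K" "connected (- K)" and pq: "p \<noteq> q"
    and seg: "open_segment p q \<subseteq> K" and pqK: "p \<notin> K" "q \<notin> K" and n: "det2 (q - p) n \<noteq> 0"
  obtains P Q where "P \<noteq> Q" "components (K - open_segment p q) = {P, Q}"
    "\<And>w. w \<in> open_segment p q \<Longrightarrow>
       \<forall>\<^sub>F t in at_right 0. w + of_real t * n \<in> P \<and> w - of_real t * n \<in> Q"
proof -
  obtain P Q where PQ: "components (K - open_segment p q) = {P, Q}"
    "\<And>w. w \<in> open_segment p q \<Longrightarrow>
       \<forall>\<^sub>F t in at_right 0. w + of_real t * n \<in> P \<and> w - of_real t * n \<in> Q"
    using segment_sides[OF K(2,3) pq seg pqK n] by blast
  have "P \<noteq> Q"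
  proof
    assume "P = Q"
    then have "connected (K - open_segment p q)"
      using PQ(1) by (auto simp: connected_eq_connected_components_eq)
    then show False using crosscut_disconnects[OF K(1,2,4) pq seg pqK] by blast
  qed
  then show thesis using that PQ by blast
qed

text \<open>Allows chords to be cut one at a time, with attention only to the component that
  contains the new chord.\<close>

lemma components_union_split:
  assumes K: "K \<in> components N" and "T \<subseteq> K"
  shows "components (N - T) = (components N - {K}) \<union> components (K - T)"
proof (intro equalityI subsetI)
  fix X assume X: "X \<in> components (N - T)"
  then have X': "X \<noteq> {}" "X \<subseteq> N - T" "connected X"
    by (auto simp: in_components_maximal)
  then obtain L where L: "L \<in> components N" "X \<subseteq> L"
    using exists_component_superset[of X N] by blast
  show "X \<in> (components N - {K}) \<union> components (K - T)"
  proof (cases "L = K")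
    case True
    then have "X \<in> components (K - T)"
      using X X' L in_components_subset[OF K]
      by (intro components_intermediate_subset[OF X]) auto
    then show ?thesis by blast
  next
    case False
    then have "L \<inter> K = {}" using components_nonoverlap[OF L(1) K] by simp
    then have "L \<subseteq> N - T" using in_components_subset[OF L(1)] \<open>T \<subseteq> K\<close> by blast
    then have "X = L" using X L in_components_connected in_components_nonempty
      by (metis in_components_maximal)
    then show ?thesis using L False by blast
  qed
next
  fix X assume "X \<in> (components N - {K}) \<union> components (K - T)"
  then show "X \<in> components (N - T)"
  proof
    assume X: "X \<in> components N - {K}"
    then have "X \<inter> K = {}" using components_nonoverlap[of X N K] K by simp
    then have "X \<subseteq> N - T" using X in_components_subset[of X N] \<open>T \<subseteq> K\<close> by blast
    then show ?thesis using X components_intermediate_subset[of X N "N - T"] by blast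
  next
    assume X: "X \<in> components (K - T)"
    have XK: "X \<subseteq> K - T" "X \<noteq> {}" "connected X" using X by (auto simp: in_components_maximal)
    have KN: "K \<subseteq> N" using K in_components_subset by blast
    have "D = X" if D: "D \<noteq> {}" "X \<subseteq> D" "D \<subseteq> N - T" "connected D" for D
    proof -
      have "D \<subseteq> N" "K \<inter> D \<noteq> {}" using D XK by auto
      then have "D \<subseteq> K" using components_maximal[OF K D(4)] by simp
      then have "D \<subseteq> K - T" using D by blast
      then show ?thesis using X D(1,2,4) by (metis in_components_maximal)
    qed
    moreover have "X \<subseteq> N - T" using XK KN by blast
    ultimately show ?thesis using XK by (auto simp: in_components_maximal[of X "N - T"])
  qed
qed

text \<open>Induction on the chords; a new chord splits just one piece into two. Openness and
  connected complement of every piece are carried along since the crosscut theorem asks for them at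
  the next cut.\<close>

lemma crosscuts_card_components:
  fixes C :: "complex set" and p q :: "'v \<Rightarrow> complex"
  assumes C: "bounded C" "open C" "connected C" "C \<noteq> {}" "connected (- C)" and "finite V"
    and ch: "\<And>v. v \<in> V \<Longrightarrow> p v \<noteq> q v \<and> open_segment (p v) (q v) \<subseteq> C \<and> p v \<notin> C \<and> q v \<notin> C"
    and dis: "\<And>v w. v \<in> V \<Longrightarrow> w \<in> V \<Longrightarrow> v \<noteq> w \<Longrightarrow>
                 open_segment (p v) (q v) \<inter> open_segment (p w) (q w) = {}"
  shows "finite (components (C - (\<Union>v\<in>V. open_segment (p v) (q v)))) \<and>
    card (components (C - (\<Union>v\<in>V. open_segment (p v) (q v)))) = card V + 1 \<and>
    (\<forall>K \<in> components (C - (\<Union>v\<in>V. open_segment (p v) (q v))). open K \<and> connected (- K))"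
  using \<open>finite V\<close> ch dis
proof (induction V)
  case empty
  have "components C = {C}" using C by (simp add: components_eq_sing_iff)
  then show ?case using C by simp
next
  case (insert v V)
  let ?s = "open_segment (p v) (q v)"
  let ?N = "C - (\<Union>v\<in>V. open_segment (p v) (q v))"
  have IH: "finite (components ?N)" "card (components ?N) = card V + 1"
    "\<And>K. K \<in> components ?N \<Longrightarrow> open K \<and> connected (- K)"
    using insert.IH insert.prems by (auto simp: Ball_def)
  have v: "p v \<noteq> q v" "?s \<subseteq> C" "p v \<notin> C" "q v \<notin> C" using insert.prems(1) by auto
  have "?s \<inter> open_segment (p w) (q w) = {}" if "w \<in> V" for w
    using insert.prems(2)[of v w] insert.hyps that by auto
  then have sN: "?s \<subseteq> ?N" using v by blast
  then obtain K where K: "K \<in> components ?N" "?s \<subseteq> K"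
  proof -
    have "?N \<noteq> {}" using sN v(1) by (metis open_segment_eq_empty subset_empty)
    then show ?thesis
      using exists_component_superset[OF sN] that convex_connected[OF convex_open_segment] by metis
  qed
  have KC: "K \<subseteq> C" using K(1) in_components_subset by blast
  \<comment> \<open>Any vector transversal to the chord will do, as only the number of sides matters
    here; this one is the normal.\<close>
  have n: "det2 (q v - p v) (\<i> * (q v - p v)) \<noteq> 0"
  proof -
    have "det2 (q v - p v) (\<i> * (q v - p v)) = (Re (q v - p v))\<^sup>2 + (Im (q v - p v))\<^sup>2"
      by (simp add: det2_def power2_eq_square algebra_simps)
    then show ?thesis using v(1) by (metis complex_eq_0 right_minus_eq)
  qed
  obtain P Q where PQ: "P \<noteq> Q" "components (K - ?s) = {P, Q}"
  proof (rule crosscut_components[of K "p v" "q v" "\<i> * (q v - p v)"])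
    show "bounded K" using KC C(1) bounded_subset by blast
    show "connected K" using K(1) in_components_connected by blast
    show "p v \<notin> K" "q v \<notin> K" using v KC by auto
  qed (use IH(3)[OF K(1)] K(2) v(1) n that in auto)
  have eq: "C - (\<Union>w\<in>insert v V. open_segment (p w) (q w)) = ?N - ?s" by auto
  have comp: "components (?N - ?s) = (components ?N - {K}) \<union> {P, Q}"
    using components_union_split[OF K] PQ by simp
  have new: "X \<notin> components ?N" if "X \<in> {P, Q}" for X
  proof
    assume "X \<in> components ?N"
    moreover have X: "X \<subseteq> K - ?s" "X \<noteq> {}" using that PQ(2) in_components_subset in_components_nonempty by (metis, metis)
    ultimately have "X = K" using K components_nonoverlap by blast
    then have "?s = {}" using X K by blast
    then show False using v(1) by simp
  qed
  have "card (components (?N - ?s)) = card (components ?N - {K}) + card {P, Q}"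
    unfolding comp using IH(1) new by (intro card_Un_disjoint) auto
  then have "card (components (?N - ?s)) = card V + 2"
    using IH(1,2) K(1) PQ(1) by simp
  moreover have "open X \<and> connected (- X)" if X: "X \<in> components (?N - ?s)" for X
  proof (cases "X \<in> components ?N")
    case True then show ?thesis using IH(3) by blast
  next
    case False
    then have X: "X \<in> components (K - ?s)" using X comp PQ by blast
    have "K - ?s = K - closed_segment (p v) (q v)" using v KC by (auto simp: open_segment_def)
    moreover have "open (K - closed_segment (p v) (q v))" using IH(3)[OF K(1)] by (simp add: open_Diff)
    ultimately have "open X" using X open_components by metis
    \<comment> \<open>The complement of \<open>K - ?s\<close> is \<open>- K\<close> with the closed
      chord attached at its end points, hence connected; therefore each component of
      \<open>K - ?s\<close> has connected complement as well.\<close>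
    have "connected (- K \<union> closed_segment (p v) (q v))"
      by (rule connected_Un) (use IH(3)[OF K(1)] v KC in auto)
    moreover have "- K \<union> closed_segment (p v) (q v) = - (K - ?s)"
      using v KC by (auto simp: open_segment_def)
    ultimately have "connected (- (K - ?s))" by simp
    then have "connected (- X)" by (rule component_complement_connected) (simp only: double_complement X)
    then show ?thesis using \<open>open X\<close> by blast
  qed
  ultimately show ?case
    unfolding eq using IH(1) comp insert.hyps by simp
qed

subsection \<open>The two sides of an edge\<close>

locale gauged_graph =
  fixes G :: plabic and l :: complex
  assumes graph: "plabic_graph G" and pbdtp: "PBDTP G" and gauge: "gauge_direction G l"
begin

abbreviation c where "c \<equiv> centre G"
abbreviation r where "r \<equiv> radius G"
abbreviation E where "E \<equiv> edges G"
abbreviation D where "D \<equiv> drawing G"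

text \<open>The gauge direction \<open>l\<close> is thought of as pointing straight down.\<close>

definition oseg :: "complex \<times> complex \<Rightarrow> complex set" where
  "oseg e = open_segment (fst e) (snd e)"

definition cseg :: "complex \<times> complex \<Rightarrow> complex set" where
  "cseg e = closed_segment (fst e) (snd e)"

text \<open>In the open disc, \<open>M\<close> and its components are open. The faces of the theorem
  live in the closed disc; \<open>disc_face\<close> translates.\<close>

definition M :: "complex set" where "M = ball c r - D"

section \<open>Elementary facts on the drawing in the disc\<close>

lemma r_pos: "0 < r" and bnum_pos: "0 < bnum G" and finite_internal: "finite (internal G)"
  and internal_ball: "internal G \<subseteq> ball c r" and white_internal: "white G \<subseteq> internal G"
  and boundary_degree: "\<And>b. b \<in> boundary G \<Longrightarrow> degree G b = 1"
  and internal_degree: "\<And>v. v \<in> internal G \<Longrightarrow> degree G v \<in> {2, 3}"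
  using graph unfolding plabic_graph_def by blast+

lemma l_nz: "l \<noteq> 0"
  and gauge_ball: "\<And>b. b \<in> boundary G \<Longrightarrow> ray b l \<inter> ball c r \<noteq> {}"
  and gauge_det: "\<And>u v. (u, v) \<in> E \<Longrightarrow> det2 (v - u) l \<noteq> 0"
  and gauge_internal: "\<And>b. b \<in> boundary G \<Longrightarrow> ray b l \<inter> internal G = {}"
  using gauge unfolding gauge_direction_def by blast+

lemma boundary_sphere: "boundary G \<subseteq> sphere c r"
  using graph unfolding plabic_graph_def boundary_on_common_arc_def boundary_def
  by (force simp: dist_norm norm_mult)

lemma boundary_internal: "boundary G \<inter> internal G = {}"
  using boundary_sphere internal_ball by fastforce

lemma vertices_cball: "vertices G \<subseteq> cball c r"
  using boundary_sphere internal_ball sphere_cball ball_subset_cball unfolding vertices_def by blast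

lemma finite_vertices: "finite (vertices G)"
  by (simp add: vertices_def boundary_def finite_internal)

lemma edge_vertices: "(u, v) \<in> E \<Longrightarrow> u \<in> vertices G \<and> v \<in> vertices G"
  using graph unfolding plabic_graph_def by blast

lemma edge_not_boundary: "(u, v) \<in> E \<Longrightarrow> u \<in> internal G \<or> v \<in> internal G"
  using edge_vertices[of u v] graph unfolding plabic_graph_def vertices_def by blast

lemma embedding: "planar_embedding G"
  using graph unfolding plabic_graph_def by blast

lemma no_off: "no_component_off_boundary G"
  using graph unfolding plabic_graph_def by blast

lemma edge_neq: "(u, v) \<in> E \<Longrightarrow> u \<noteq> v"
  using embedding unfolding planar_embedding_def by blast

lemma oseg_vertices: "e \<in> E \<Longrightarrow> oseg e \<inter> vertices G = {}"
  using embedding unfolding planar_embedding_def oseg_def by (cases e) auto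

lemma oseg_disjoint: "e \<in> E \<Longrightarrow> e' \<in> E \<Longrightarrow> e \<noteq> e' \<Longrightarrow> oseg e \<inter> oseg e' = {}"
  using embedding unfolding planar_embedding_def oseg_def by (cases e; cases e') fastforce

lemma finite_edges: "finite E"
  by (rule finite_subset[of _ "vertices G \<times> vertices G"]) (use edge_vertices finite_vertices in auto)

lemma oseg_nonempty: "e \<in> E \<Longrightarrow> oseg e \<noteq> {}"
  using edge_neq[of "fst e" "snd e"] by (simp add: oseg_def)

lemma cseg_eq: "cseg e = oseg e \<union> {fst e, snd e}"
  by (auto simp: cseg_def oseg_def open_segment_def)

text \<open>One end of an edge is in the open disc and the other in its closure, so convexity keeps
  the rest inside.\<close>

lemma oseg_ball: assumes "e \<in> E" shows "oseg e \<subseteq> ball c r"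
proof -
  obtain u v where e: "e = (u, v)" by fastforce
  have uv: "u \<in> cball c r" "v \<in> cball c r" "u \<in> ball c r \<or> v \<in> ball c r"
    using edge_vertices[of u v] edge_not_boundary[of u v] vertices_cball internal_ball assms e by auto
  have sub: "open_segment a b \<subseteq> ball c r" if "a \<in> ball c r" "b \<in> cball c r" for a b
    using in_interior_closure_convex_segment[of "ball c r" a b] that r_pos by simp
  show ?thesis
    using uv sub[of u v] sub[of v u] e by (auto simp: oseg_def open_segment_commute)
qed

lemma drawing_eq: "D = vertices G \<union> (\<Union>e\<in>E. oseg e)"
  using edge_vertices by (fastforce simp: drawing_def oseg_def open_segment_def)

lemma drawing_eq_cseg: "D = vertices G \<union> (\<Union>e\<in>E. cseg e)"
  by (fastforce simp: drawing_def cseg_def)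

lemma compact_drawing: "compact D"
  unfolding drawing_eq_cseg cseg_def
  by (intro compact_Un compact_UN finite_imp_compact[OF finite_vertices] finite_edges) simp

lemma drawing_cball: "D \<subseteq> cball c r"
  using vertices_cball oseg_ball ball_subset_cball unfolding drawing_eq by blast

lemma drawing_sphere: "D \<inter> sphere c r = boundary G"
proof -
  have "x \<notin> sphere c r" if "x \<in> ball c r" for x using that by auto
  then show ?thesis
    using boundary_sphere oseg_ball internal_ball unfolding drawing_eq vertices_def by blast
qed

lemma open_M: "open M"
  unfolding M_def using compact_drawing by (simp add: compact_imp_closed open_Diff)

lemma M_ball: "M \<subseteq> ball c r"
  by (auto simp: M_def)

section \<open>Removing an edge, and simple connectivity of the faces\<close>

lemma connected_meets_ball:
  assumes "connected X" "X \<inter> sphere c r = {}" "x \<in> X" "x \<in> ball c r"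
  shows "X \<subseteq> ball c r"
proof (rule ccontr)
  assume "\<not> X \<subseteq> ball c r"
  then have "X \<inter> frontier (ball c r) \<noteq> {}"
    using assms by (intro connected_Int_frontier) auto
  then show False using assms(2) r_pos by simp
qed

text \<open>Exhibits circle and drawing without one open edge as a finite union of compact sets,
  which makes the complement open.\<close>

lemma minus_edge_eq:
  assumes "e \<in> E"
  shows "sphere c r \<union> D - oseg e = sphere c r \<union> vertices G \<union> (\<Union>e'\<in>E - {e}. cseg e')"
proof -
  have "oseg e \<inter> (sphere c r \<union> vertices G \<union> (\<Union>e'\<in>E - {e}. cseg e')) = {}"
  proof -
    have "oseg e \<inter> sphere c r = {}" using oseg_ball[OF assms] by fastforce
    moreover have "oseg e \<inter> cseg e' = {}" if "e' \<in> E" "e' \<noteq> e" for e'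
      using oseg_disjoint[OF assms that(1)] that oseg_vertices[OF assms] edge_vertices[of "fst e'" "snd e'"]
      unfolding cseg_eq by auto
    ultimately show ?thesis using oseg_vertices[OF assms] by blast
  qed
  moreover have "cseg e \<subseteq> oseg e \<union> vertices G"
    using edge_vertices[of "fst e" "snd e"] assms by (auto simp: cseg_eq)
  ultimately show ?thesis unfolding drawing_eq_cseg using assms by (auto simp: cseg_eq)
qed

text \<open>The walk that \<open>PBDTP\<close> provides connects the tail of \<open>e\<close> to the circle before its first passage
  through \<open>e\<close>, and the head after the last one.\<close>

lemma connected_minus_edge:
  assumes e: "e \<in> E"
  shows "connected (sphere c r \<union> D - oseg e)"
proof -
  define T where "T = sphere c r \<union> D - oseg e"
  define conn where "conn x \<longleftrightarrow> connected_component T (c + of_real r) x" for x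
  obtain u v where uv: "e = (u, v)" by fastforce
  have T: "T = sphere c r \<union> vertices G \<union> (\<Union>e'\<in>E - {e}. cseg e')"
    unfolding T_def by (rule minus_edge_eq[OF e])
  have sph: "conn x" if "x \<in> sphere c r" for x
    unfolding conn_def connected_component_def
  proof (intro exI conjI)
    show "connected (sphere c r)" by (rule connected_sphere) simp
    show "c + of_real r \<in> sphere c r" using r_pos by (simp add: dist_norm)
  qed (use that T in auto)
  have bd: "conn b" if "b \<in> boundary G" for b using sph boundary_sphere that by blast
  have seg: "conn y" if "e' \<in> E" "e' \<noteq> e" "conn x" "x \<in> cseg e'" "y \<in> cseg e'" for e' x y
  proof -
    have "connected_component T x y"
      unfolding connected_component_def
      by (intro exI[of _ "cseg e'"]) (use that T in \<open>auto simp: cseg_def\<close>)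
    then show ?thesis using that(3) connected_component_trans unfolding conn_def by metis
  qed
  have step: "conn x \<longleftrightarrow> conn y" if "(x, y) \<in> E" "(x, y) \<noteq> e" for x y
    using seg[OF that] seg[OF that, of y x] by (auto simp: cseg_def)
  have pe: "path_edges (x # y # q) = insert (x, y) (path_edges (y # q))" for x y q
    by (simp add: path_edges_def)
  have fwd: "conn u" if "path_edges p \<subseteq> E" "p \<noteq> []" "conn (hd p)" "e \<in> path_edges p" for p
    using that
  proof (induction p rule: induct_list012)
    case (3 x y q)
    show ?case
    proof (cases "(x, y) = e")
      case True then show ?thesis using 3 uv by simp
    next
      case False
      then have "conn y" using 3 step[of x y] by (auto simp: pe)
      then show ?thesis using 3 False by (auto simp: pe)
    qed
  qed (auto simp: path_edges_def)
  have avoid: "conn (hd p)" if "path_edges p \<subseteq> E" "p \<noteq> []" "conn (last p)" "e \<notin> path_edges p" for p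
    using that
  proof (induction p rule: induct_list012)
    case (3 x y q)
    then have "conn y" by (auto simp: pe)
    then show ?case using 3 step[of x y] by (auto simp: pe)
  qed auto
  have bwd: "conn v" if "path_edges p \<subseteq> E" "p \<noteq> []" "conn (last p)" "e \<in> path_edges p" for p
    using that
  proof (induction p rule: induct_list012)
    case (3 x y q)
    show ?case
    proof (cases "e \<in> path_edges (y # q)")
      case True then show ?thesis using 3 by (auto simp: pe)
    next
      case False
      then show ?thesis using 3 avoid[of "y # q"] uv by (auto simp: pe)
    qed
  qed (auto simp: path_edges_def)
  obtain p where p: "p \<noteq> []" "path_edges p \<subseteq> E" "hd p \<in> boundary G" "last p \<in> boundary G" "e \<in> path_edges p"
    using pbdtp e unfolding PBDTP_def by blast
  have cu: "conn u" "conn v" using fwd[OF p(2,1)] bwd[OF p(2,1)] bd p by blast+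
  \<comment> \<open>An undirected walk to the boundary may cross \<open>e\<close>; this is harmless
    as both ends of \<open>e\<close> are already joined to the circle.\<close>
  have vert: "conn x" if "x \<in> vertices G" for x
  proof -
    have "\<exists>b\<in>boundary G. (x, b) \<in> (E \<union> E\<inverse>)\<^sup>*"
      using no_off that unfolding no_component_off_boundary_def by (rule bspec)
    then obtain b where b: "b \<in> boundary G" "(x, b) \<in> (E \<union> E\<inverse>)\<^sup>*" by (elim bexE)
    from b(2) show ?thesis
    proof (induction rule: converse_rtrancl_induct)
      case base then show ?case using bd b(1) by blast
    next
      case (step x y)
      then show ?case using \<open>\<And>x y. (x, y) \<in> E \<Longrightarrow> (x, y) \<noteq> e \<Longrightarrow> conn x = conn y\<close> cu uv
        by (metis UnE converseD prod.inject)
    qed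
  qed
  have "conn x" if xT: "x \<in> T" for x
  proof -
    consider "x \<in> sphere c r" | "x \<in> vertices G" | e' where "e' \<in> E" "e' \<noteq> e" "x \<in> cseg e'"
      using xT unfolding T by blast
    then show ?thesis
    proof cases
      case 3
      have "fst e' \<in> vertices G" using edge_vertices[of "fst e'" "snd e'"] 3 by simp
      then show ?thesis using seg[OF 3(1,2) vert[of "fst e'"] _ 3(3)] by (auto simp: cseg_eq)
    qed (use sph vert in auto)
  qed
  then have "connected T"
    unfolding connected_iff_connected_component conn_def
    using connected_component_sym connected_component_trans by metis
  then show ?thesis unfolding T_def .
qed

lemma edges_nonempty: "E \<noteq> {}"
proof -
  have "bvert G 1 \<in> boundary G" using bnum_pos by (auto simp: boundary_def)
  from boundary_degree[OF this] show ?thesis by (auto simp: degree_def in_degree_def out_degree_def)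
qed

lemma connected_sphere_drawing: "connected (sphere c r \<union> D)"
proof -
  obtain e where e: "e \<in> E" using edges_nonempty by blast
  have "connected ((sphere c r \<union> D - oseg e) \<union> cseg e)"
  proof (rule connected_Un[OF connected_minus_edge[OF e]])
    show "connected (cseg e)" by (simp add: cseg_def)
    have "fst e \<in> vertices G" using edge_vertices[of "fst e" "snd e"] e by simp
    then have "fst e \<in> D" "fst e \<notin> oseg e" using drawing_eq oseg_vertices[OF e] by auto
    then show "(sphere c r \<union> D - oseg e) \<inter> cseg e \<noteq> {}" by (auto simp: cseg_eq)
  qed
  moreover have "(sphere c r \<union> D - oseg e) \<union> cseg e = sphere c r \<union> D"
    using e unfolding drawing_eq_cseg by (auto simp: cseg_eq)
  ultimately show ?thesis by simp
qed

text \<open>The working form of simple connectivity: a face is a component of the complement of the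
  connected set formed by circle and drawing, and such components have connected
  complements.\<close>

lemma face_complement_connected:
  assumes "C \<in> components M" shows "connected (- C)"
proof (rule component_complement_connected[OF connected_sphere_drawing])
  have C: "C \<noteq> {}" "C \<subseteq> M" "connected C" using assms by (auto simp: in_components_maximal)
  have "X = C" if X: "X \<noteq> {}" "C \<subseteq> X" "X \<subseteq> - (sphere c r \<union> D)" "connected X" for X
  proof -
    obtain x where "x \<in> C" using C by blast
    then have "X \<subseteq> ball c r" using connected_meets_ball[of X x] X C M_ball by blast
    then have "X \<subseteq> M" using X by (auto simp: M_def)
    then show ?thesis using assms X by (metis in_components_maximal)
  qed
  moreover have "C \<subseteq> - (sphere c r \<union> D)" using C by (auto simp: M_def)
  ultimately show "C \<in> components (- (sphere c r \<union> D))"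
    using C(1,3) by (subst in_components_maximal) blast
qed

text \<open>The edge is a crosscut of \<open>K\<close>, the region obtained by erasing it. As
  \<open>e\<close> is not a bridge, the complement of \<open>K\<close> is connected, and the
  crosscut theorem gives two different sides; the direction \<open>- l\<close> makes
  \<open>P\<close> the upper one.\<close>

lemma edge_faces:
  assumes e: "e \<in> E"
  obtains P Q where "P \<noteq> Q" "P \<in> components M" "Q \<in> components M"
    "\<forall>w\<in>oseg e. \<forall>\<^sub>F t in at_right 0. w - of_real t * l \<in> P \<and> w + of_real t * l \<in> Q"
    "\<forall>C\<in>components M. oseg e \<inter> closure C \<noteq> {} \<longrightarrow> C = P \<or> C = Q"
proof -
  let ?T = "sphere c r \<union> D - oseg e"
  obtain u v where uv: "e = (u, v)" by fastforce
  have o: "oseg e = open_segment u v" by (simp add: oseg_def uv)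
  have "compact ?T"
    unfolding minus_edge_eq[OF e] cseg_def
    by (intro compact_Un compact_UN finite_imp_compact[OF finite_vertices] finite_Diff finite_edges
        compact_sphere) simp
  then have cl: "open (- ?T)" using compact_imp_closed open_Compl by blast
  have con: "connected (oseg e)" by (simp add: oseg_def convex_connected)
  have sub: "oseg e \<subseteq> - ?T" by blast
  obtain K where K: "K \<in> components (- ?T)" "oseg e \<subseteq> K"
    using exists_component_superset[OF sub _ con] oseg_nonempty[OF e] sub by auto
  have KT: "K \<inter> ?T = {}" using in_components_subset[OF K(1)] by blast
  obtain w where w: "w \<in> oseg e" using oseg_nonempty[OF e] by blast
  have sph: "sphere c r \<subseteq> ?T" using oseg_ball[OF e] by fastforce
  have Kb: "K \<subseteq> ball c r"
    by (rule connected_meets_ball[of _ w]) (use in_components_connected[OF K(1)] KT sph w K oseg_ball[OF e] in auto)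
  have uvK: "u \<notin> K" "v \<notin> K"
    using KT oseg_vertices[OF e] edge_vertices[of u v] e uv unfolding drawing_eq by auto
  obtain P Q where PQ: "P \<noteq> Q" "components (K - open_segment u v) = {P, Q}"
    "\<And>w. w \<in> open_segment u v \<Longrightarrow>
       \<forall>\<^sub>F t in at_right 0. w + of_real t * (- l) \<in> P \<and> w - of_real t * (- l) \<in> Q"
  proof (rule crosscut_components[of K u v "- l"])
    show "bounded K" using Kb bounded_ball bounded_subset by blast
    show "open K" using open_components[OF cl K(1)] .
    show "connected K" using in_components_connected[OF K(1)] .
    show "connected (- K)" by (rule component_complement_connected[OF connected_minus_edge[OF e] K(1)])
    show "u \<noteq> v" using edge_neq e uv by blast
    show "det2 (v - u) (- l) \<noteq> 0" using gauge_det e uv by (simp add: det2_minus_right)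
    show "open_segment u v \<subseteq> K" using K(2) o by simp
  qed (use uvK that in auto)
  have "X \<in> components M" if "X \<in> {P, Q}" for X
  proof -
    have X: "X \<in> components (K - oseg e)" using that PQ(2) o by simp
    then have "X \<in> components (- ?T - oseg e)" using components_union_split[OF K] by blast
    moreover have "X \<subseteq> M" using in_components_subset[OF X] KT Kb by (auto simp: M_def)
    moreover have "M \<subseteq> - ?T - oseg e" using e by (auto simp: M_def drawing_eq)
    ultimately show ?thesis using components_intermediate_subset by blast
  qed
  then have face: "P \<in> components M" "Q \<in> components M" by simp_all
  have "C = P \<or> C = Q" if C: "C \<in> components M" "oseg e \<inter> closure C \<noteq> {}" for C
  proof -
    have "K \<inter> closure C \<noteq> {}" using C(2) K(2) by blast
    then have "K \<inter> C \<noteq> {}" using open_Int_closure_eq_empty[OF open_components[OF cl K(1)]] by blast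
    then obtain z where z: "z \<in> K" "z \<in> C" by blast
    have "z \<notin> oseg e" using z(2) in_components_subset[OF C(1)] e by (auto simp: M_def drawing_eq)
    then have "z \<in> P \<union> Q" using z(1) PQ(2) Union_components[of "K - open_segment u v"] o by auto
    then show ?thesis using components_eq[OF C(1)] face z(2) by blast
  qed
  then show thesis using that[of P Q] PQ face o by simp
qed

definition sides where
  "sides e = (SOME (P, Q). P \<noteq> Q \<and> P \<in> components M \<and> Q \<in> components M \<and>
    (\<forall>w\<in>oseg e. \<forall>\<^sub>F t in at_right 0. w - of_real t * l \<in> P \<and> w + of_real t * l \<in> Q) \<and>
    (\<forall>C\<in>components M. oseg e \<inter> closure C \<noteq> {} \<longrightarrow> C = P \<or> C = Q))"

definition above where "above e = fst (sides e)"
definition below where "below e = snd (sides e)"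

lemma sides:
  assumes "e \<in> E"
  shows above_neq_below: "above e \<noteq> below e" and above_face: "above e \<in> components M"
    and below_face: "below e \<in> components M"
    and above_germ: "\<And>w. w \<in> oseg e \<Longrightarrow> \<forall>\<^sub>F t in at_right 0. w - of_real t * l \<in> above e"
    and below_germ: "\<And>w. w \<in> oseg e \<Longrightarrow> \<forall>\<^sub>F t in at_right 0. w + of_real t * l \<in> below e"
    and face_at_edge: "\<And>w C. w \<in> oseg e \<Longrightarrow> C \<in> components M \<Longrightarrow> w \<in> closure C \<Longrightarrow> C = above e \<or> C = below e"
proof -
  obtain P Q where PQ: "P \<noteq> Q" "P \<in> components M" "Q \<in> components M"
    "\<forall>w\<in>oseg e. \<forall>\<^sub>F t in at_right 0. w - of_real t * l \<in> P \<and> w + of_real t * l \<in> Q"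
    "\<forall>C\<in>components M. oseg e \<inter> closure C \<noteq> {} \<longrightarrow> C = P \<or> C = Q"
    by (rule edge_faces[OF assms]) blast
  have *: "case sides e of (P, Q) \<Rightarrow> P \<noteq> Q \<and> P \<in> components M \<and> Q \<in> components M \<and>
    (\<forall>w\<in>oseg e. \<forall>\<^sub>F t in at_right 0. w - of_real t * l \<in> P \<and> w + of_real t * l \<in> Q) \<and>
    (\<forall>C\<in>components M. oseg e \<inter> closure C \<noteq> {} \<longrightarrow> C = P \<or> C = Q)"
    unfolding sides_def by (rule someI[of _ "(P, Q)"]) (simp add: PQ)
  show "above e \<noteq> below e" "above e \<in> components M" "below e \<in> components M"
    "\<And>w. w \<in> oseg e \<Longrightarrow> \<forall>\<^sub>F t in at_right 0. w - of_real t * l \<in> above e"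
    "\<And>w. w \<in> oseg e \<Longrightarrow> \<forall>\<^sub>F t in at_right 0. w + of_real t * l \<in> below e"
    using * unfolding above_def below_def by (simp_all add: case_prod_beta eventually_conj_iff)
  show "C = above e \<or> C = below e" if "w \<in> oseg e" "C \<in> components M" "w \<in> closure C" for w C
  proof -
    have "oseg e \<inter> closure C \<noteq> {}" using that(1,3) by blast
    then show ?thesis using * that(2) unfolding above_def below_def by (simp add: case_prod_beta)
  qed
qed

subsection \<open>Edges at a vertex\<close>

text \<open>Horizontal and vertical coordinate, scaled so that \<open>l\<close> is the vector \<open>(0, -1)\<close>.\<close>

definition X :: "complex \<Rightarrow> real" where "X z = Re (z / (\<i> * l))"
definition Y :: "complex \<Rightarrow> real" where "Y z = Im (z / (\<i> * l))"

lemma XY_linear [simp]: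
  "X (a + b) = X a + X b" "X (a - b) = X a - X b" "X (- a) = - X a" "X (of_real t * a) = t * X a"
  "X (t *\<^sub>R a) = t * X a" "X l = 0" "X 0 = 0"
  "Y (a + b) = Y a + Y b" "Y (a - b) = Y a - Y b" "Y (- a) = - Y a" "Y (of_real t * a) = t * Y a"
  "Y (t *\<^sub>R a) = t * Y a" "Y l = - 1" "Y 0 = 0"
proof -
  have l: "l / (\<i> * l) = - \<i>" using l_nz by (simp add: field_simps)
  show "X l = 0" "Y l = - 1" by (simp_all add: X_def Y_def l)
  have of: "of_real t * a / (\<i> * l) = of_real t * (a / (\<i> * l))" by simp
  show "X (of_real t * a) = t * X a" "Y (of_real t * a) = t * Y a"
    by (simp_all only: X_def Y_def of Re_complex_of_real Im_complex_of_real times_complex.sel)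
  then show "X (t *\<^sub>R a) = t * X a" "Y (t *\<^sub>R a) = t * Y a" by (simp_all add: scaleR_conv_of_real)
qed (simp_all add: X_def Y_def add_divide_distrib diff_divide_distrib)

lemma XY_decompose: "z = (of_real (X z) + \<i> * of_real (Y z)) * (\<i> * l)"
proof -
  have "of_real (X z) + \<i> * of_real (Y z) = z / (\<i> * l)"
    unfolding X_def Y_def by (simp add: complex_eq_iff)
  then show ?thesis using l_nz by simp
qed

definition vec :: "real \<Rightarrow> real \<Rightarrow> complex" where
  "vec x y = (of_real x + \<i> * of_real y) * (\<i> * l)"

lemma XY_vec [simp]: "X (vec x y) = x" "Y (vec x y) = y"
  using l_nz by (simp_all add: X_def Y_def vec_def)

lemma vec_XY: "vec (X z) (Y z) = z"
  using XY_decompose[of z] by (simp add: vec_def)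

lemma XY_eqI: "X a = X b \<Longrightarrow> Y a = Y b \<Longrightarrow> a = b"
  by (metis vec_XY)

text \<open>Division by \<open>\<i> * l\<close> is a similarity preserving orientation, so
  determinants change by a positive factor only.\<close>

lemma det2_XY: "det2 f g = (norm l)\<^sup>2 * (X f * Y g - Y f * X g)"
proof -
  have "det2 f g = det2 (vec (X f) (Y f)) (vec (X g) (Y g))" by (simp add: vec_XY)
  also have "\<dots> = ((Re l)\<^sup>2 + (Im l)\<^sup>2) * (X f * Y g - Y f * X g)"
    unfolding vec_def det2_def by (simp add: power2_eq_square algebra_simps)
  finally show ?thesis by (simp add: cmod_power2)
qed

lemma edge_X: "(u, v) \<in> E \<Longrightarrow> X (v - u) \<noteq> 0"
  using gauge_det[of u v] by (auto simp: det2_XY)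

lemma convex_XY_halfplane:
  "convex {z. 0 < p * X (z - v) + q * Y (z - v)}" "convex {z. 0 \<le> p * X (z - v) + q * Y (z - v)}"
proof -
  have "linear (\<lambda>z. p * X z + q * Y z)" by (rule linearI) (simp_all add: algebra_simps)
  then have "convex ((\<lambda>z. p * X z + q * Y z) -` {p * X v + q * Y v<..})"
    "convex ((\<lambda>z. p * X z + q * Y z) -` {p * X v + q * Y v..})"
    by (intro convex_linear_vimage; simp)+
  then show "convex {z. 0 < p * X (z - v) + q * Y (z - v)}" "convex {z. 0 \<le> p * X (z - v) + q * Y (z - v)}"
    by (simp_all add: vimage_def algebra_simps)
qed

lemma continuous_on_XY [continuous_intros]:
  "continuous_on A f \<Longrightarrow> continuous_on A (\<lambda>x. X (f x))"
  "continuous_on A f \<Longrightarrow> continuous_on A (\<lambda>x. Y (f x))"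
  unfolding X_def Y_def using l_nz by (auto intro!: continuous_intros)

text \<open>An edge at \<open>v\<close> is described by the side of the vertical line through \<open>v\<close> on which it leaves \<open>v\<close>, and by
  its height per unit of horizontal distance; on either side, a larger slope means a higher edge.\<close>

definition inc :: "complex \<Rightarrow> (complex \<times> complex) set" where
  "inc v = {e \<in> E. fst e = v \<or> snd e = v}"

definition dir :: "complex \<Rightarrow> complex \<times> complex \<Rightarrow> complex" where
  "dir v e = (if fst e = v then snd e else fst e) - v"

definition side :: "complex \<Rightarrow> complex \<times> complex \<Rightarrow> real" where
  "side v e = sgn (X (dir v e))"

definition slope :: "complex \<Rightarrow> complex \<times> complex \<Rightarrow> real" where
  "slope v e = Y (dir v e) / \<bar>X (dir v e)\<bar>"

lemma finite_inc: "finite (inc v)" and inc_edge: "e \<in> inc v \<Longrightarrow> e \<in> E"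
  using finite_edges by (auto simp: inc_def)

lemma dir_X: "e \<in> inc v \<Longrightarrow> X (dir v e) \<noteq> 0"
  using edge_X[of "fst e" "snd e"] by (auto simp: inc_def dir_def)

lemma side_cases: "e \<in> inc v \<Longrightarrow> side v e = 1 \<or> side v e = - 1"
  using dir_X[of e v] by (auto simp: side_def sgn_if)

lemma dir_Y: "e \<in> inc v \<Longrightarrow> Y (dir v e) = slope v e * \<bar>X (dir v e)\<bar>"
  using dir_X[of e v] by (simp add: slope_def)

lemma oseg_dir:
  assumes "e \<in> inc v"
  shows "z \<in> oseg e \<longleftrightarrow> (\<exists>s. 0 < s \<and> s < 1 \<and> z = v + of_real s * dir v e)"
proof -
  define w where "w = v + dir v e"
  have w: "oseg e = open_segment v w" "w = v + dir v e"
    using assms by (auto simp: oseg_def dir_def w_def inc_def open_segment_commute)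
  have "v \<noteq> w" using dir_X[OF assms] w(2) by auto
  moreover have "(1 - s) *\<^sub>R v + s *\<^sub>R w = v + of_real s * dir v e" for s
    unfolding w(2) by (simp add: scaleR_conv_of_real algebra_simps)
  ultimately show ?thesis unfolding w(1) in_segment by auto
qed

lemma edge_slopes_distinct:
  assumes "e \<in> inc v" "e' \<in> inc v" "side v e = side v e'" "slope v e = slope v e'"
  shows "e = e'"
proof (rule ccontr)
  assume "e \<noteq> e'"
  then have dis: "oseg e \<inter> oseg e' = {}" using oseg_disjoint[OF inc_edge inc_edge] assms(1,2) by simp
  let ?x = "\<bar>X (dir v e)\<bar>" and ?x' = "\<bar>X (dir v e')\<bar>"
  have pos: "?x > 0" "?x' > 0" using dir_X assms by auto
  \<comment> \<open>Chosen so that both points have the same horizontal distance from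
    \<open>v\<close>, half the smaller of the two horizontal extents; with equal slopes they
    coincide.\<close>
  define s where "s = min ?x ?x' / (2 * ?x)"
  define s' where "s' = min ?x ?x' / (2 * ?x')"
  have s: "0 < s" "s < 1" "0 < s'" "s' < 1" using pos by (auto simp: s_def s'_def field_simps min_def)
  have sx: "s * ?x = s' * ?x'" using pos by (simp add: s_def s'_def)
  have X: "x * X (dir v e'') = side v e'' * (x * \<bar>X (dir v e'')\<bar>)" for x e''
    by (simp add: side_def abs_mult_sgn mult.left_commute[of "sgn _"] mult.commute[of "sgn _"])
  have "of_real s * dir v e = of_real s' * dir v e'"
  proof (rule XY_eqI)
    show "X (of_real s * dir v e) = X (of_real s' * dir v e')"
      by (simp only: XY_linear X assms(3) sx)
    show "Y (of_real s * dir v e) = Y (of_real s' * dir v e')"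
      unfolding XY_linear dir_Y[OF assms(1)] dir_Y[OF assms(2)] assms(4)
      using sx by (simp add: mult.left_commute)
  qed
  then have "v + of_real s * dir v e \<in> oseg e \<inter> oseg e'"
    using oseg_dir[OF assms(1)] oseg_dir[OF assms(2)] s by auto
  then show False using dis by blast
qed

text \<open>The other vertices and the edges not at \<open>v\<close> form a compact set that misses
  \<open>v\<close>.\<close>

lemma vertex_neighbourhood:
  assumes v: "v \<in> vertices G"
  shows "\<exists>\<rho>>0. ball v \<rho> \<inter> D \<subseteq> {v} \<union> (\<Union>e\<in>inc v. oseg e) \<and> (v \<in> internal G \<longrightarrow> ball v \<rho> \<subseteq> ball c r)"
proof -
  let ?F = "(vertices G - {v}) \<union> (\<Union>e\<in>E - inc v. cseg e)"
  have "compact (\<Union>e\<in>E - inc v. cseg e)"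
    unfolding cseg_def by (intro compact_UN finite_Diff finite_edges) simp
  moreover have "compact (vertices G - {v})" by (intro finite_imp_compact finite_Diff finite_vertices)
  ultimately have "compact ?F" by (rule compact_Un[rotated])
  then have "open (- ?F)" using compact_imp_closed open_Compl by blast
  moreover have "v \<notin> cseg e" if "e \<in> E - inc v" for e
    using oseg_vertices[of e] v that by (auto simp: cseg_eq inc_def)
  then have "v \<in> - ?F" by blast
  ultimately obtain \<rho>1 where 1: "\<rho>1 > 0" "ball v \<rho>1 \<subseteq> - ?F" by (meson open_contains_ball)
  obtain \<rho>2 where 2: "\<rho>2 > 0" "v \<in> internal G \<longrightarrow> ball v \<rho>2 \<subseteq> ball c r"
  proof (cases "v \<in> internal G")
    case True
    then have "\<exists>\<rho>>0. ball v \<rho> \<subseteq> ball c r" using internal_ball open_contains_ball[of "ball c r"] by blast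
    then show ?thesis using that by blast
  next
    case False
    then show ?thesis using that[of 1] by simp
  qed
  have "D \<subseteq> ?F \<union> ({v} \<union> (\<Union>e\<in>inc v. oseg e))"
    unfolding drawing_eq by (fastforce simp: cseg_eq)
  moreover have "ball v (min \<rho>1 \<rho>2) \<subseteq> ball v \<rho>1" by auto
  ultimately have "ball v (min \<rho>1 \<rho>2) \<inter> D \<subseteq> {v} \<union> (\<Union>e\<in>inc v. oseg e)" using 1(2) by blast
  moreover have "v \<in> internal G \<longrightarrow> ball v (min \<rho>1 \<rho>2) \<subseteq> ball c r" using 2 by auto
  ultimately show ?thesis using 1 2 by (intro exI[of _ "min \<rho>1 \<rho>2"]) auto
qed

definition rho :: "complex \<Rightarrow> real" where
  "rho v = (SOME \<rho>. \<rho> > 0 \<and> ball v \<rho> \<inter> D \<subseteq> {v} \<union> (\<Union>e\<in>inc v. oseg e) \<and>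
     (v \<in> internal G \<longrightarrow> ball v \<rho> \<subseteq> ball c r))"

text \<open>The intersection with the disc matters at boundary vertices only; it keeps
  \<open>N v\<close> convex, and a boundary vertex lies outside its own \<open>N v\<close>.\<close>

definition N :: "complex \<Rightarrow> complex set" where
  "N v = ball v (rho v) \<inter> ball c r"

lemma rho:
  assumes "v \<in> vertices G"
  shows "rho v > 0" "ball v (rho v) \<inter> D \<subseteq> {v} \<union> (\<Union>e\<in>inc v. oseg e)"
    "v \<in> internal G \<Longrightarrow> N v = ball v (rho v)"
  using someI_ex[OF vertex_neighbourhood[OF assms], folded rho_def] by (auto simp: N_def)

lemma open_N: "open (N v)" and convex_N: "convex (N v)"
  by (auto simp: N_def convex_Int)

text \<open>Reduces membership in \<open>M\<close> near \<open>v\<close> to comparing slopes with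
  the edges on the same side.\<close>

lemma N_off_edges:
  assumes v: "v \<in> vertices G" and z: "z \<in> N v" "z \<noteq> v"
    and off: "\<And>e. e \<in> inc v \<Longrightarrow> side v e = sgn (X (z - v)) \<Longrightarrow> Y (z - v) \<noteq> slope v e * \<bar>X (z - v)\<bar>"
  shows "z \<in> M"
proof (rule ccontr)
  assume "z \<notin> M"
  then have "z \<in> ball v (rho v) \<inter> D" using z by (auto simp: N_def M_def)
  then obtain e where e: "e \<in> inc v" "z \<in> oseg e" using rho(2)[OF v] z(2) by blast
  then obtain s where s: "0 < s" "z = v + of_real s * dir v e" using oseg_dir by blast
  have "side v e = sgn (X (z - v))" using s by (simp add: side_def sgn_mult)
  moreover have "Y (z - v) = slope v e * \<bar>X (z - v)\<bar>"
    using s dir_Y[OF e(1)] by (simp add: abs_mult)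
  ultimately show False using off[OF e(1)] by blast
qed

subsection \<open>Faces around a vertex\<close>

text \<open>The faces on the two sides of an edge, and those vertically next to a vertex, are indexed by
  \<open>\<tau> = 1\<close> (upwards) and \<open>\<tau> = -1\<close> (downwards), so that each local fact is proved once.\<close>

definition eface :: "real \<Rightarrow> complex \<times> complex \<Rightarrow> complex set" where
  "eface \<tau> e = (if \<tau> = 1 then above e else below e)"

definition vface :: "real \<Rightarrow> complex \<Rightarrow> complex set" where
  "vface \<tau> v = (SOME C. C \<in> components M \<and>
     (\<forall>t>0. v - of_real (\<tau> * t) * l \<in> N v \<longrightarrow> v - of_real (\<tau> * t) * l \<in> C))"

lemma eface_simps [simp]: "eface 1 e = above e" "eface (- 1) e = below e"
  by (simp_all add: eface_def)

lemma face_eqI: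
  assumes "C \<in> components M" "C' \<in> components M" "p \<in> C" "p \<in> C'"
  shows "C = C'"
  using components_eq[OF assms(1,2)] assms(3,4) by blast

lemma same_face:
  assumes "closed_segment p q \<subseteq> M" "C \<in> components M"
  shows "p \<in> C \<longleftrightarrow> q \<in> C"
  using components_maximal[OF assms(2) _ assms(1)] by (metis connected_segment disjoint_iff ends_in_segment subsetD)

text \<open>No edge is vertical, so the vertical half line from \<open>v\<close> meets no edge at
  \<open>v\<close>; its part in the convex set \<open>N v\<close> is connected and stays in one
  face.\<close>

lemma vface:
  assumes v: "v \<in> vertices G" and tau: "\<tau> = 1 \<or> \<tau> = - 1"
    and t0: "0 < t0" "v - of_real (\<tau> * t0) * l \<in> N v"
  shows "vface \<tau> v \<in> components M"
    and "\<And>t. 0 < t \<Longrightarrow> v - of_real (\<tau> * t) * l \<in> N v \<Longrightarrow> v - of_real (\<tau> * t) * l \<in> vface \<tau> v"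
proof -
  let ?q = "\<lambda>t. v - of_real (\<tau> * t) * l"
  have inM: "?q t \<in> M" if "0 < t" "?q t \<in> N v" for t
  proof (rule N_off_edges[OF v that(2)])
    have "Y (?q t - v) = \<tau> * t" by (simp del: of_real_mult)
    moreover have "\<tau> * t \<noteq> 0" using that tau by auto
    ultimately show "?q t \<noteq> v" by (metis XY_linear(14) diff_self)
    fix e assume "e \<in> inc v" "side v e = sgn (X (?q t - v))"
    then show "Y (?q t - v) \<noteq> slope v e * \<bar>X (?q t - v)\<bar>"
      using side_cases[of e v] by (auto simp del: of_real_mult)
  qed
  have seg: "closed_segment (?q t0) (?q t) \<subseteq> M" if t: "0 < t" "?q t \<in> N v" for t
  proof
    fix z assume z: "z \<in> closed_segment (?q t0) (?q t)"
    then have zN: "z \<in> N v" using t t0 convex_N[of v] by (meson convex_contains_segment subsetD)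
    obtain u where u: "0 \<le> u" "u \<le> 1" "z = (1 - u) *\<^sub>R ?q t0 + u *\<^sub>R ?q t" using z by (auto simp: in_segment)
    have "z = ?q ((1 - u) * t0 + u * t)" unfolding u(3) by (simp add: scaleR_conv_of_real algebra_simps)
    moreover have "0 < (1 - u) * t0 + u * t"
      using u t t0 by (cases "u = 1") (auto intro: add_pos_nonneg)
    ultimately show "z \<in> M" using inM zN by blast
  qed
  obtain C where C: "C \<in> components M" "?q t0 \<in> C"
    using inM[OF t0] by (metis Union_components UnionE)
  have "\<forall>t>0. ?q t \<in> N v \<longrightarrow> ?q t \<in> C"
    using same_face[OF seg C(1)] C(2) by blast
  then have "\<exists>C. C \<in> components M \<and> (\<forall>t>0. ?q t \<in> N v \<longrightarrow> ?q t \<in> C)" using C(1) by blast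
  from someI_ex[OF this, folded vface_def]
  show "vface \<tau> v \<in> components M" "\<And>t. 0 < t \<Longrightarrow> ?q t \<in> N v \<Longrightarrow> ?q t \<in> vface \<tau> v" by blast+
qed

lemma internal_N: "v \<in> internal G \<Longrightarrow> v \<in> N v"
  using rho[of v] by (simp add: vertices_def)

text \<open>Once the ray is in the open disc at some time \<open>t0\<close>, convexity of the disc
  puts all earlier positive times inside as well.\<close>

lemma boundary_enters:
  assumes "b \<in> boundary G"
  shows "\<forall>\<^sub>F t in at_right 0. b + of_real t * l \<in> ball c r"
proof -
  obtain t0 where t0: "0 < t0" "b + of_real t0 * l \<in> ball c r"
    using gauge_ball[OF assms] by (auto simp: ray_def)
  have "b + of_real t * l \<in> ball c r" if "0 < t" "t < t0" for t
  proof -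
    have "b \<in> cball c r" using boundary_sphere assms by auto
    then have "open_segment (b + of_real t0 * l) b \<subseteq> ball c r"
      using in_interior_closure_convex_segment[of "ball c r" "b + of_real t0 * l" b] t0 r_pos by simp
    moreover have "b + of_real t * l \<in> open_segment (b + of_real t0 * l) b"
      unfolding in_segment
    proof (intro conjI exI[of _ "1 - t / t0"])
      show "b + of_real t * l = (1 - (1 - t / t0)) *\<^sub>R (b + of_real t0 * l) + (1 - t / t0) *\<^sub>R b"
        using t0 by (simp add: scaleR_conv_of_real algebra_simps)
    qed (use that t0 l_nz in auto)
    ultimately show ?thesis by blast
  qed
  then show ?thesis using t0(1) by (auto simp: eventually_at_right_field)
qed

text \<open>At a boundary vertex only the downward direction enters the disc; this is why
  \<open>\<tau> = - 1\<close> is demanded there, here and below.\<close>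

lemma vertical_N:
  assumes "v \<in> internal G \<or> v \<in> boundary G \<and> \<tau> = - 1" "\<tau> = 1 \<or> \<tau> = - 1"
  shows "\<forall>\<^sub>F t in at_right 0. v - of_real (\<tau> * t) * l \<in> N v"
proof (cases "v \<in> internal G")
  case True
  have "\<forall>\<^sub>F t in at_right 0. v + of_real t * (- of_real \<tau> * l) \<in> N v"
    by (rule eventually_translate_ball[OF open_N internal_N[OF True]])
  then show ?thesis by (simp add: mult_ac)
next
  case False
  then have v: "v \<in> boundary G" "\<tau> = - 1" using assms by auto
  then have "\<forall>\<^sub>F t in at_right 0. v + of_real t * l \<in> ball v (rho v)"
    using rho(1)[of v] by (intro eventually_translate_ball) (auto simp: vertices_def)
  with boundary_enters[OF v(1)] show ?thesis
    by eventually_elim (use v in \<open>auto simp: N_def\<close>)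
qed

lemma vface_germ:
  assumes "v \<in> internal G \<or> v \<in> boundary G \<and> \<tau> = - 1" "\<tau> = 1 \<or> \<tau> = - 1"
  shows "vface \<tau> v \<in> components M"
    and "\<forall>\<^sub>F t in at_right 0. 0 < t \<and> v - of_real (\<tau> * t) * l \<in> N v \<and> v - of_real (\<tau> * t) * l \<in> vface \<tau> v"
proof -
  have v: "v \<in> vertices G" using assms by (auto simp: vertices_def)
  have ev: "\<forall>\<^sub>F t in at_right 0. 0 < t \<and> v - of_real (\<tau> * t) * l \<in> N v"
    using vertical_N[OF assms] by (simp add: eventually_conj_iff eventually_at_right_less)
  then obtain t0 where t0: "0 < t0" "v - of_real (\<tau> * t0) * l \<in> N v"
    using eventually_happens' trivial_limit_at_right_real by blast
  show "vface \<tau> v \<in> components M" by (rule vface(1)[OF v assms(2) t0])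
  show "\<forall>\<^sub>F t in at_right 0. 0 < t \<and> v - of_real (\<tau> * t) * l \<in> N v \<and> v - of_real (\<tau> * t) * l \<in> vface \<tau> v"
    using ev by eventually_elim (use vface(2)[OF v assms(2) t0] in blast)
qed

lemma eface_face: "e \<in> E \<Longrightarrow> eface \<tau> e \<in> components M"
  using sides by (simp add: eface_def)

lemma eface_germ:
  assumes "e \<in> E" "w \<in> oseg e" "\<tau> = 1 \<or> \<tau> = - 1"
  shows "\<forall>\<^sub>F t in at_right 0. w - of_real (\<tau> * t) * l \<in> eface \<tau> e"
  using above_germ[OF assms(1,2)] below_germ[OF assms(1,2)] assms(3) by auto

lemma connected_germ_face:
  assumes "C \<in> components M" "connected Q" "Q \<subseteq> M" "\<forall>\<^sub>F t in at_right (0::real). f t \<in> C" "\<forall>\<^sub>F t in at_right 0. f t \<in> Q"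
  shows "Q \<subseteq> C"
proof -
  have "\<forall>\<^sub>F t in at_right 0. f t \<in> C \<inter> Q" using assms(4,5) by eventually_elim simp
  then have "C \<inter> Q \<noteq> {}" using eventually_happens' trivial_limit_at_right_real by blast
  then show ?thesis by (rule components_maximal[OF assms(1-3)])
qed

text \<open>Brings the germ beside \<open>e\<close> into the coordinates at \<open>v\<close>: it
  starts at a point of \<open>e\<close> near \<open>v\<close>, at horizontal distance
  \<open>x\<close>, and moves vertically.\<close>

lemma edge_germ_near_vertex:
  assumes v: "v \<in> vertices G" and e: "e \<in> inc v" and tau: "\<tau> = 1 \<or> \<tau> = - 1"
  obtains f x where "0 < x" "\<forall>\<^sub>F t in at_right 0. 0 < t \<and> f t \<in> N v" "\<forall>\<^sub>F t in at_right 0. f t \<in> eface \<tau> e"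
    "\<forall>t. X (f t - v) = side v e * x" "\<forall>t. Y (f t - v) = slope v e * x + \<tau> * t"
proof -
  have "\<forall>\<^sub>F s in at_right 0. v + of_real s * dir v e \<in> ball v (rho v)"
    by (rule eventually_translate_ball) (use rho(1)[OF v] in auto)
  moreover have "\<forall>\<^sub>F s in at_right (0::real). 0 < s \<and> s < 1"
    unfolding eventually_at_right_field by (intro exI[of _ 1]) auto
  ultimately have "\<forall>\<^sub>F s in at_right (0::real). 0 < s \<and> s < 1 \<and> v + of_real s * dir v e \<in> ball v (rho v)"
    by eventually_elim auto
  then obtain s where s: "0 < s" "s < 1" "v + of_real s * dir v e \<in> ball v (rho v)"
    using eventually_happens' trivial_limit_at_right_real by blast
  let ?w = "v + of_real s * dir v e"
  have w: "?w \<in> oseg e" using oseg_dir[OF e] s by blast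
  then have wN: "?w \<in> N v" using s(3) oseg_ball[OF inc_edge[OF e]] by (auto simp: N_def)
  have "\<forall>\<^sub>F t in at_right 0. ?w + of_real t * (- of_real \<tau> * l) \<in> N v"
    by (rule eventually_translate_ball[OF open_N wN])
  then have N: "\<forall>\<^sub>F t in at_right 0. 0 < t \<and> ?w - of_real (\<tau> * t) * l \<in> N v"
    by (simp add: mult_ac eventually_conj_iff eventually_at_right_less)
  have d: "?w - of_real (\<tau> * t) * l - v = of_real s * dir v e - of_real (\<tau> * t) * l" for t by simp
  show thesis
  proof (rule that[OF _ N eface_germ[OF inc_edge[OF e] w tau]])
    show "0 < s * \<bar>X (dir v e)\<bar>" using s dir_X[OF e] by simp
    show "\<forall>t. X (?w - of_real (\<tau> * t) * l - v) = side v e * (s * \<bar>X (dir v e)\<bar>)"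
      unfolding d by (simp only: XY_linear mult_zero_right diff_zero side_def mult.left_commute sgn_mult_abs simp_thms)
    show "\<forall>t. Y (?w - of_real (\<tau> * t) * l - v) = slope v e * (s * \<bar>X (dir v e)\<bar>) + \<tau> * t"
      unfolding d by (simp only: XY_linear dir_Y[OF e] mult_minus_right diff_minus_eq_add mult_1_right mult.left_commute simp_thms)
  qed
qed

text \<open>The sector between the outermost edge and the vertical half line is convex and free of
  edges; it contains both the germ beside the edge and the vertical germ at
  \<open>v\<close>.\<close>

lemma outermost_edge_face:
  assumes v: "v \<in> internal G \<or> v \<in> boundary G \<and> \<tau> = - 1" and e: "e \<in> inc v" and tau: "\<tau> = 1 \<or> \<tau> = - 1"
    and outer: "\<And>e'. e' \<in> inc v \<Longrightarrow> side v e' = side v e \<Longrightarrow> \<tau> * slope v e' \<le> \<tau> * slope v e"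
  shows "eface \<tau> e = vface \<tau> v"
proof -
  have v': "v \<in> vertices G" using v by (auto simp: vertices_def)
  let ?\<sigma> = "side v e"
  \<comment> \<open>The closed half plane keeps the vertical half line itself in \<open>Q\<close>,
    so the germ at \<open>v\<close> belongs to it.\<close>
  define Q where "Q = N v \<inter> {z. 0 \<le> ?\<sigma> * X (z - v) + 0 * Y (z - v)} \<inter>
    {z. 0 < (- \<tau> * slope v e * ?\<sigma>) * X (z - v) + \<tau> * Y (z - v)}"
  have Q: "z \<in> Q \<longleftrightarrow> z \<in> N v \<and> 0 \<le> ?\<sigma> * X (z - v) \<and> \<tau> * (slope v e * (?\<sigma> * X (z - v))) < \<tau> * Y (z - v)" for z
    by (simp add: Q_def del: XY_linear) argo
  have conn: "connected Q" unfolding Q_def by (intro convex_connected convex_Int convex_N convex_XY_halfplane)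
  have "Q \<subseteq> M"
  proof
    fix z assume "z \<in> Q"
    then have z: "z \<in> N v" "0 \<le> ?\<sigma> * X (z - v)" "\<tau> * (slope v e * (?\<sigma> * X (z - v))) < \<tau> * Y (z - v)"
      using Q by blast+
    show "z \<in> M"
    proof (rule N_off_edges[OF v' z(1)])
      show "z \<noteq> v" using z(3) by auto
      fix e' assume e': "e' \<in> inc v" "side v e' = sgn (X (z - v))"
      have "X (z - v) \<noteq> 0" using e' side_cases[OF e'(1)] by (auto simp del: XY_linear)
      then have sd: "?\<sigma> = sgn (X (z - v))" "?\<sigma> * X (z - v) = \<bar>X (z - v)\<bar>"
        using z(2) side_cases[OF e] by (auto simp: sgn_if simp del: XY_linear)
      have "\<tau> * slope v e' * \<bar>X (z - v)\<bar> \<le> \<tau> * slope v e * \<bar>X (z - v)\<bar>"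
        using outer[OF e'(1)] e'(2) sd(1) by (intro mult_right_mono) simp_all
      then show "Y (z - v) \<noteq> slope v e' * \<bar>X (z - v)\<bar>" using z(3) unfolding sd(2) by (auto simp: mult.assoc simp del: XY_linear)
    qed
  qed
  note sub = connected_germ_face[OF _ conn this]
  obtain f x where f: "0 < x" "\<forall>\<^sub>F t in at_right 0. 0 < t \<and> f t \<in> N v" "\<forall>\<^sub>F t in at_right 0. f t \<in> eface \<tau> e"
    "\<forall>t. X (f t - v) = ?\<sigma> * x" "\<forall>t. Y (f t - v) = slope v e * x + \<tau> * t"
    by (rule edge_germ_near_vertex[OF v' e tau]) blast
  have fQ: "\<forall>\<^sub>F t in at_right 0. f t \<in> Q"
    using f(2) by eventually_elim
      (use f(1) side_cases[OF e] tau in \<open>auto simp: Q f(4,5) distrib_left simp del: XY_linear\<close>)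
  have vQ: "\<forall>\<^sub>F t in at_right 0. v - of_real (\<tau> * t) * l \<in> Q" "\<forall>\<^sub>F t in at_right 0. v - of_real (\<tau> * t) * l \<in> vface \<tau> v"
    using vface_germ(2)[OF v tau] by (eventually_elim, use tau in \<open>auto simp: Q simp del: of_real_mult\<close>)+
  have "Q \<noteq> {}" using eventually_happens'[OF trivial_limit_at_right_real fQ] by blast
  then show ?thesis
    using sub[OF eface_face[OF inc_edge[OF e]] f(3) fQ] sub[OF vface_germ(1)[OF v tau] vQ(2,1)]
      components_eq[OF eface_face[OF inc_edge[OF e]] vface_germ(1)[OF v tau]] by blast
qed

text \<open>The open wedge between the two edges is convex and free of the drawing, and it contains
  the germs above \<open>e\<close> and below \<open>e'\<close>.\<close>

lemma consecutive_edges_face: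
  assumes v: "v \<in> internal G" and e: "e \<in> inc v" "e' \<in> inc v" "side v e' = side v e" "slope v e < slope v e'"
    and between: "\<And>e''. e'' \<in> inc v \<Longrightarrow> side v e'' = side v e \<Longrightarrow> slope v e'' \<le> slope v e \<or> slope v e' \<le> slope v e''"
  shows "above e = below e'"
proof -
  have v': "v \<in> vertices G" using v by (simp add: vertices_def)
  let ?\<sigma> = "side v e"
  define Q where "Q = N v \<inter> {z. 0 < ?\<sigma> * X (z - v) + 0 * Y (z - v)} \<inter>
    {z. 0 < (- slope v e * ?\<sigma>) * X (z - v) + 1 * Y (z - v)} \<inter>
    {z. 0 < (slope v e' * ?\<sigma>) * X (z - v) + (- 1) * Y (z - v)}"
  have Q: "z \<in> Q \<longleftrightarrow> z \<in> N v \<and> 0 < ?\<sigma> * X (z - v) \<and> slope v e * (?\<sigma> * X (z - v)) < Y (z - v) \<and>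
    Y (z - v) < slope v e' * (?\<sigma> * X (z - v))" for z
    by (simp add: Q_def del: XY_linear) argo
  have conn: "connected Q" unfolding Q_def by (intro convex_connected convex_Int convex_N convex_XY_halfplane)
  have "Q \<subseteq> M"
  proof
    fix z assume "z \<in> Q"
    then have z: "z \<in> N v" "0 < ?\<sigma> * X (z - v)" "slope v e * (?\<sigma> * X (z - v)) < Y (z - v)"
      "Y (z - v) < slope v e' * (?\<sigma> * X (z - v))" using Q by blast+
    show "z \<in> M"
    proof (rule N_off_edges[OF v' z(1)])
      show "z \<noteq> v" using z(2) by auto
      fix e'' assume e'': "e'' \<in> inc v" "side v e'' = sgn (X (z - v))"
      have sd: "?\<sigma> = sgn (X (z - v))" "?\<sigma> * X (z - v) = \<bar>X (z - v)\<bar>"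
        using z(2) side_cases[OF e(1)] by (auto simp: sgn_if simp del: XY_linear)
      have "slope v e'' * \<bar>X (z - v)\<bar> \<le> slope v e * \<bar>X (z - v)\<bar> \<or> slope v e' * \<bar>X (z - v)\<bar> \<le> slope v e'' * \<bar>X (z - v)\<bar>"
        using between[OF e''(1)] e''(2) sd(1) by (auto intro: mult_right_mono simp del: XY_linear)
      then show "Y (z - v) \<noteq> slope v e'' * \<bar>X (z - v)\<bar>" using z(3,4) unfolding sd(2) by linarith
    qed
  qed
  note sub = connected_germ_face[OF _ conn this]
  obtain f x where f: "0 < x" "\<forall>\<^sub>F t in at_right 0. 0 < t \<and> f t \<in> N v" "\<forall>\<^sub>F t in at_right 0. f t \<in> eface 1 e"
    "\<forall>t. X (f t - v) = ?\<sigma> * x" "\<forall>t. Y (f t - v) = slope v e * x + 1 * t"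
    by (rule edge_germ_near_vertex[OF v' e(1), of 1]) (simp, blast)
  obtain g y where g: "0 < y" "\<forall>\<^sub>F t in at_right 0. 0 < t \<and> g t \<in> N v" "\<forall>\<^sub>F t in at_right 0. g t \<in> eface (- 1) e'"
    "\<forall>t. X (g t - v) = side v e' * y" "\<forall>t. Y (g t - v) = slope v e' * y + - 1 * t"
    by (rule edge_germ_near_vertex[OF v' e(2), of "- 1"]) (simp, blast)
  \<comment> \<open>At horizontal distance \<open>x'\<close> the two edges are this far apart;
    shorter vertical steps stay in the wedge.\<close>
  have gap: "\<forall>\<^sub>F t in at_right 0. t < (slope v e' - slope v e) * x'" if "0 < x'" for x'
    unfolding eventually_at_right_field using that e(4) by (intro exI[of _ "(slope v e' - slope v e) * x'"]) auto
  have sg: "?\<sigma> * ?\<sigma> = 1" using side_cases[OF e(1)] by auto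
  have fQ: "\<forall>\<^sub>F t in at_right 0. f t \<in> Q"
    using f(2) gap[OF f(1)]
    by eventually_elim (use f(1) sg in \<open>simp add: Q f(4,5) mult.assoc[symmetric] left_diff_distrib del: XY_linear\<close>)
  have gQ: "\<forall>\<^sub>F t in at_right 0. g t \<in> Q"
    using g(2) gap[OF g(1)]
    by eventually_elim (use g(1) sg in \<open>simp add: Q g(4,5) e(3) mult.assoc[symmetric] left_diff_distrib del: XY_linear\<close>)
  have "Q \<noteq> {}" using eventually_happens'[OF trivial_limit_at_right_real fQ] by blast
  then show ?thesis
    using sub[OF eface_face[OF inc_edge[OF e(1)]] f(3) fQ] sub[OF eface_face[OF inc_edge[OF e(2)]] g(3) gQ]
      components_eq[OF eface_face[OF inc_edge[OF e(1)]] eface_face[OF inc_edge[OF e(2)]], of 1 "- 1"] by simp blast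
qed

text \<open>The open half of \<open>N v\<close> without edges is connected and overlaps both the
  upper and the lower quarter, which contain the two vertical germs.\<close>

lemma edge_free_side_face:
  assumes v: "v \<in> internal G" and sg: "\<sigma> = 1 \<or> \<sigma> = - 1" and free: "\<And>e. e \<in> inc v \<Longrightarrow> side v e \<noteq> \<sigma>"
  shows "vface 1 v = vface (- 1) v"
proof -
  have v': "v \<in> vertices G" using v by (simp add: vertices_def)
  let ?H = "N v \<inter> {z. 0 < \<sigma> * X (z - v) + 0 * Y (z - v)}"
  have sub: "Q \<subseteq> M" if "Q \<subseteq> N v" "\<And>z. z \<in> Q \<Longrightarrow> z \<noteq> v \<and> 0 \<le> \<sigma> * X (z - v)" for Q
  proof
    fix z assume z: "z \<in> Q"
    show "z \<in> M"
    proof (rule N_off_edges[OF v'])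
      fix e assume e: "e \<in> inc v" "side v e = sgn (X (z - v))"
      have "side v e = \<sigma>"
        using e(2) side_cases[OF e(1)] sg that(2)[OF z] by (auto simp: sgn_if simp del: XY_linear split: if_splits)
      then show "Y (z - v) \<noteq> slope v e * \<bar>X (z - v)\<bar>" using free[OF e(1)] by blast
    qed (use that z in auto)
  qed
  have H: "connected ?H" "?H \<subseteq> M"
    by (intro convex_connected convex_Int convex_N convex_XY_halfplane) (rule sub, auto)
  have "?H \<subseteq> vface \<tau> v" if tau: "\<tau> = 1 \<or> \<tau> = - 1" for \<tau>
  proof -
    let ?Q = "N v \<inter> {z. 0 \<le> \<sigma> * X (z - v) + 0 * Y (z - v)} \<inter> {z. 0 < 0 * X (z - v) + \<tau> * Y (z - v)}"
    have c: "connected ?Q" by (intro convex_connected convex_Int convex_N convex_XY_halfplane)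
    have m: "?Q \<subseteq> M" by (rule sub) auto
    have g: "\<forall>\<^sub>F t in at_right 0. v - of_real (\<tau> * t) * l \<in> ?Q" "\<forall>\<^sub>F t in at_right 0. v - of_real (\<tau> * t) * l \<in> vface \<tau> v"
      using vface_germ(2)[OF disjI1[OF v] tau] by (eventually_elim, use tau in \<open>auto simp del: of_real_mult\<close>)+
    have Q: "?Q \<subseteq> vface \<tau> v"
      by (rule connected_germ_face[OF vface_germ(1)[OF disjI1[OF v] tau] c m g(2,1)])
    have "\<forall>\<^sub>F s in at_right 0. v + of_real s * vec \<sigma> \<tau> \<in> N v"
      by (rule eventually_translate_ball[OF open_N internal_N[OF v]])
    then have "\<forall>\<^sub>F s in at_right 0. 0 < s \<and> v + of_real s * vec \<sigma> \<tau> \<in> N v"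
      by (simp add: eventually_conj_iff eventually_at_right_less)
    then obtain s where "0 < s" "v + of_real s * vec \<sigma> \<tau> \<in> N v"
      using eventually_happens' trivial_limit_at_right_real by blast
    then have "v + of_real s * vec \<sigma> \<tau> \<in> ?Q \<inter> ?H" using sg tau by auto
    then have "vface \<tau> v \<inter> ?H \<noteq> {}" using Q by blast
    then show ?thesis by (rule components_maximal[OF vface_germ(1)[OF disjI1[OF v] tau] H])
  qed
  then have sub: "?H \<subseteq> vface 1 v" "?H \<subseteq> vface (- 1) v" by simp_all
  have "?H \<noteq> {}"
    using eventually_happens'[OF trivial_limit_at_right_real eventually_conj[OF eventually_at_right_less
      eventually_translate_ball[OF open_N internal_N[OF v], of "vec \<sigma> 0"]]] sg by auto
  then have "vface 1 v \<inter> vface (- 1) v \<noteq> {}" using sub by blast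
  then show ?thesis using components_eq[OF vface_germ(1)[of v 1] vface_germ(1)[of v "- 1"]] v by simp
qed

text \<open>Otherwise no frontier point of \<open>C\<close> would lie in the punctured neighbourhood
  of \<open>v\<close>, which is connected, so \<open>C\<close> would fill it; but an edge ends at
  \<open>v\<close>.\<close>

lemma face_at_vertex:
  assumes v: "v \<in> internal G" and C: "C \<in> components M" "v \<in> closure C"
  shows "\<exists>e\<in>inc v. C = above e \<or> C = below e"
proof (rule ccontr)
  assume no: "\<not> ?thesis"
  have v': "v \<in> vertices G" using v by (simp add: vertices_def)
  have CM: "C \<subseteq> M" using C(1) in_components_subset by blast
  have off: "oseg e \<inter> closure C = {}" if "e \<in> inc v" for e
    using face_at_edge[OF inc_edge[OF that] _ C(1)] no that by blast
  let ?B = "N v - {v}"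
  have "?B \<inter> frontier C = {}"
  proof -
    have "frontier C \<subseteq> closure C" "frontier C \<inter> M = {}"
      using frontier_of_components_subset[OF C(1)] open_M by (auto simp: frontier_def interior_open)
    moreover have "?B - M \<subseteq> (\<Union>e\<in>inc v. oseg e)" using rho(2)[OF v'] by (auto simp: N_def M_def)
    ultimately show ?thesis using off by blast
  qed
  moreover have "connected ?B"
    using connected_open_delete[OF open_N convex_connected[OF convex_N]] by simp
  moreover have "?B \<inter> C \<noteq> {}"
  proof -
    have "N v \<inter> C \<noteq> {}" using open_Int_closure_eq_empty[OF open_N, of v C] internal_N[OF v] C(2) by blast
    moreover have "v \<notin> C" using CM v' by (auto simp: M_def drawing_eq)
    ultimately show ?thesis by blast
  qed
  ultimately have sub: "?B \<subseteq> C" using connected_Int_frontier[of ?B C] by blast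
  have "inc v \<noteq> {}"
  proof
    assume "inc v = {}"
    then have "{u. (u, v) \<in> E} = {}" "{w. (v, w) \<in> E} = {}" by (auto simp: inc_def)
    then have "degree G v = 0" unfolding degree_def in_degree_def out_degree_def by simp
    then show False using internal_degree[OF v] by simp
  qed
  then obtain e where e: "e \<in> inc v" by blast
  have "v \<in> closure (oseg e)"
    using e edge_neq[of "fst e" "snd e"] inc_edge[OF e] by (auto simp: oseg_def inc_def closure_open_segment)
  then have "N v \<inter> oseg e \<noteq> {}" using open_Int_closure_eq_empty[OF open_N, of v "oseg e"] internal_N[OF v] by blast
  moreover have "oseg e \<inter> (C \<union> {v}) = {}"
    using CM oseg_vertices[OF inc_edge[OF e]] v' inc_edge[OF e] by (auto simp: M_def drawing_eq)
  ultimately show False using sub by blast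
qed

subsection \<open>Cutting a face along vertical chords\<close>

text \<open>\<open>Up w\<close> is the vertical segment from \<open>w\<close> to the next point of the drawing or circle above it, and
  \<open>exit_region\<close> consists of the points of the disc that see the circle below them.\<close>

definition Up :: "complex \<Rightarrow> complex set" where
  "Up w = {w - of_real t * l | t. 0 < t \<and> (\<forall>s. 0 < s \<and> s \<le> t \<longrightarrow> w - of_real s * l \<in> M)}"

definition strip :: "complex \<times> complex \<Rightarrow> complex set" where
  "strip e = (\<Union>w\<in>oseg e. Up w)"

definition exit_region :: "complex set" where
  "exit_region = {p \<in> ball c r. \<forall>t\<ge>0. p + of_real t * l \<notin> D}"

text \<open>\<open>M\<close> is bounded, so there are times outside \<open>M\<close>; they form a
  closed set because \<open>M\<close> is open, and the infimum is attained.\<close>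

lemma first_exit:
  assumes "d \<noteq> 0" and ev: "\<forall>\<^sub>F t in at_right 0. p + of_real t * d \<in> M"
  obtains T where "0 < T" "p + of_real T * d \<notin> M" "\<And>s. 0 < s \<Longrightarrow> s < T \<Longrightarrow> p + of_real s * d \<in> M"
proof -
  obtain b where b: "0 < b" "\<And>t. 0 < t \<Longrightarrow> t < b \<Longrightarrow> p + of_real t * d \<in> M"
    using ev by (auto simp: eventually_at_right_field)
  \<comment> \<open>Starting at \<open>b\<close> excludes time \<open>0\<close>, where
    \<open>p\<close> itself may be outside \<open>M\<close>.\<close>
  define A where "A = {b..} \<inter> {t. p + of_real t * d \<notin> M}"
  have "closed ((\<lambda>t::real. p + of_real t * d) -` (- M))"
    using open_M by (intro closed_vimage) (auto intro!: continuous_intros)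
  then have clA: "closed A" by (auto simp: A_def vimage_def)
  have "bounded M" using M_ball bounded_ball bounded_subset by blast
  then obtain R where R: "\<And>z. z \<in> M \<Longrightarrow> norm z \<le> R" by (auto simp: bounded_iff)
  \<comment> \<open>So late that the point is farther from the origin than all of
    \<open>M\<close>.\<close>
  define t where "t = max b ((\<bar>R\<bar> + norm p + 1) / norm d)"
  have "\<bar>R\<bar> + norm p + 1 \<le> t * norm d" using assms(1) by (auto simp: t_def max_def field_simps)
  moreover have "t * norm d - norm p \<le> norm (p + of_real t * d)"
    using norm_triangle_ineq2[of "of_real t * d" "- p"] b(1) by (simp add: norm_mult t_def add.commute)
  ultimately have "t \<in> A" using R[of "p + of_real t * d"] by (force simp: A_def t_def)
  then have ne: "A \<noteq> {}" by blast
  have bd: "bdd_below A" by (auto simp: A_def bdd_below_def)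
  define T where "T = Inf A"
  have TA: "T \<in> A" unfolding T_def using closed_contains_Inf[OF ne bd clA] .
  show thesis
  proof (rule that[of T])
    show "0 < T" "p + of_real T * d \<notin> M" using TA b(1) by (auto simp: A_def)
    fix s assume s: "0 < s" "s < T"
    have "s \<notin> A" using s cInf_lower[OF _ bd] unfolding T_def by force
    then show "p + of_real s * d \<in> M" using b(2)[of s] s by (auto simp: A_def not_le)
  qed
qed

lemma Up_M: "Up w \<subseteq> M" by (auto simp: Up_def)

lemma Up_convex: "convex (Up w)"
proof (rule convexI)
  fix x y :: complex and a b :: real
  assume h: "x \<in> Up w" "y \<in> Up w" "0 \<le> a" "0 \<le> b" "a + b = 1"
  obtain s where s: "x = w - of_real s * l" "0 < s" "\<And>s'. 0 < s' \<Longrightarrow> s' \<le> s \<Longrightarrow> w - of_real s' * l \<in> M"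
    using h(1) by (auto simp: Up_def)
  obtain t where t: "y = w - of_real t * l" "0 < t" "\<And>s'. 0 < s' \<Longrightarrow> s' \<le> t \<Longrightarrow> w - of_real s' * l \<in> M"
    using h(2) by (auto simp: Up_def)
  have ab: "a = 1 - b" using h(5) by simp
  then have "a *\<^sub>R x + b *\<^sub>R y = w - of_real (a * s + b * t) * l"
    unfolding s(1) t(1) ab by (simp add: scaleR_conv_of_real algebra_simps)
  moreover have "min s t \<le> a * s + b * t" "a * s + b * t \<le> max s t"
    using convex_bound_le[of s "max s t" t a b] convex_bound_le[of "- s" "- min s t" "- t" a b] h by auto
  moreover have "w - of_real s' * l \<in> M" if "0 < s'" "s' \<le> max s t" for s'
    using s(3)[of s'] t(3)[of s'] that by (auto simp: max_def split: if_splits)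
  ultimately show "a *\<^sub>R x + b *\<^sub>R y \<in> Up w"
    using s(2) t(2) unfolding Up_def by (auto intro!: exI[of _ "a * s + b * t"] simp del: of_real_add of_real_mult)
qed

text \<open>The base is the first point outside \<open>M\<close> met on the way down from
  \<open>p\<close>. The disjointness of chords and strips rests on this.\<close>

lemma Up_unique:
  assumes "p \<in> Up w" "p \<in> Up w'" "w \<notin> M" "w' \<notin> M"
  shows "w = w'"
proof -
  obtain t where t: "p = w - of_real t * l" "0 < t" "\<And>s. 0 < s \<Longrightarrow> s \<le> t \<Longrightarrow> w - of_real s * l \<in> M"
    using assms(1) by (auto simp: Up_def)
  obtain t' where t': "p = w' - of_real t' * l" "0 < t'" "\<And>s. 0 < s \<Longrightarrow> s \<le> t' \<Longrightarrow> w' - of_real s * l \<in> M"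
    using assms(2) by (auto simp: Up_def)
  have w: "w = w' - of_real (t' - t) * l" "w' = w - of_real (t - t') * l"
    using t(1) t'(1) by (auto simp: algebra_simps)
  show ?thesis
  proof (rule linorder_cases[of t t'])
    assume "t < t'" then show ?thesis using t'(3)[of "t' - t"] t(2) w(1) assms(3) by simp
  next
    assume "t = t'" then show ?thesis using w by simp
  next
    assume "t' < t" then show ?thesis using t(3)[of "t - t'"] t'(2) w(2) assms(4) by simp
  qed
qed

lemma Up_face:
  assumes "C \<in> components M" "p \<in> Up w" "p \<in> C"
  shows "Up w \<subseteq> C"
  using components_maximal[OF assms(1) convex_connected[OF Up_convex] Up_M, of w] assms(2,3) by blast

lemma Up_germ:
  assumes "C \<in> components M" "\<forall>\<^sub>F t in at_right 0. w - of_real t * l \<in> C"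
  shows "Up w \<noteq> {}" "Up w \<subseteq> C"
proof -
  obtain b where b: "0 < b" "\<And>t. 0 < t \<Longrightarrow> t < b \<Longrightarrow> w - of_real t * l \<in> C"
    using assms(2) by (auto simp: eventually_at_right_field)
  have "C \<subseteq> M" using assms(1) in_components_subset by blast
  then have "w - of_real (b / 2) * l \<in> Up w" using b by (auto simp: Up_def intro!: exI[of _ "b / 2"])
  then show "Up w \<noteq> {}" "Up w \<subseteq> C"
    using Up_face[OF assms(1)] b(2)[of "b / 2"] b(1) by auto
qed

lemma Up_base:
  assumes p: "p \<in> M"
  obtains w where "w \<notin> M" "p \<in> Up w"
proof -
  have "\<forall>\<^sub>F t in at_right 0. p + of_real t * l \<in> M" by (rule eventually_translate_ball[OF open_M p])
  then obtain T where T: "0 < T" "p + of_real T * l \<notin> M" "\<And>s. 0 < s \<Longrightarrow> s < T \<Longrightarrow> p + of_real s * l \<in> M"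
    using first_exit[OF l_nz] by metis
  have "p + of_real T * l - of_real s * l \<in> M" if "0 < s" "s \<le> T" for s
  proof (cases "s = T")
    case False
    have e: "p + of_real T * l - of_real s * l = p + of_real (T - s) * l" by (simp add: algebra_simps)
    show ?thesis unfolding e using that False by (intro T(3)) auto
  qed (use p in simp)
  then have "p \<in> Up (p + of_real T * l)" using T(1) by (auto simp: Up_def intro!: exI[of _ T])
  then show thesis using that T(2) by blast
qed

text \<open>Rewrites \<open>Up v\<close> as an open segment with ends outside \<open>M\<close>, the
  shape in which the crosscut theorem accepts it.\<close>

lemma up_chord:
  assumes v: "v \<in> internal G"
  obtains q where "q \<noteq> v" "q \<notin> M" "open_segment v q = Up v"
proof -
  have face: "vface 1 v \<in> components M" "\<forall>\<^sub>F t in at_right 0. v - of_real t * l \<in> vface 1 v"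
    using vface_germ[of v 1] v by (auto simp: eventually_conj_iff)
  then have "vface 1 v \<subseteq> M" using in_components_subset by blast
  then have "\<forall>\<^sub>F t in at_right 0. v + of_real t * (- l) \<in> M"
    using face(2) by (auto elim!: eventually_mono)
  then obtain T where T: "0 < T" "v + of_real T * (- l) \<notin> M" "\<And>s. 0 < s \<Longrightarrow> s < T \<Longrightarrow> v + of_real s * (- l) \<in> M"
    using first_exit[of "- l"] l_nz by (metis neg_equal_0_iff_equal)
  let ?q = "v - of_real T * l"
  have seg: "z \<in> open_segment v ?q \<longleftrightarrow> (\<exists>t. 0 < t \<and> t < T \<and> z = v - of_real t * l)" for z
  proof
    assume "z \<in> open_segment v ?q"
    then obtain u where u: "0 < u" "u < 1" "z = (1 - u) *\<^sub>R v + u *\<^sub>R ?q" by (auto simp: in_segment)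
    then show "\<exists>t. 0 < t \<and> t < T \<and> z = v - of_real t * l"
      using T(1) by (intro exI[of _ "u * T"]) (auto simp: scaleR_conv_of_real algebra_simps)
  next
    assume "\<exists>t. 0 < t \<and> t < T \<and> z = v - of_real t * l"
    then obtain t where t: "0 < t" "t < T" "z = v - of_real t * l" by blast
    then show "z \<in> open_segment v ?q" unfolding in_segment
      using T(1) l_nz by (intro conjI exI[of _ "t / T"]) (auto simp: scaleR_conv_of_real algebra_simps)
  qed
  have "Up v = open_segment v ?q"
  proof (intro set_eqI iffI)
    fix z assume "z \<in> Up v"
    then obtain t where t: "z = v - of_real t * l" "0 < t" "\<And>s. 0 < s \<Longrightarrow> s \<le> t \<Longrightarrow> v - of_real s * l \<in> M"
      by (auto simp: Up_def)
    then have "t < T" using T(1,2) by (metis linorder_not_le minus_mult_right uminus_add_conv_diff add.commute)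
    then show "z \<in> open_segment v ?q" using seg t by blast
  next
    fix z assume "z \<in> open_segment v ?q"
    then obtain t where "0 < t" "t < T" "z = v - of_real t * l" using seg by blast
    then show "z \<in> Up v" using T(3) unfolding Up_def by fastforce
  qed
  moreover have "?q \<noteq> v" using T l_nz by simp
  ultimately show thesis using that[of ?q] T(2) by simp
qed

section \<open>The disc in vertical coordinates\<close>

lemma ball_XY: "z \<in> ball c r \<longleftrightarrow> (norm l)\<^sup>2 * ((X (z - c))\<^sup>2 + (Y (z - c))\<^sup>2) < r\<^sup>2"
  and sphere_XY: "z \<in> sphere c r \<longleftrightarrow> (norm l)\<^sup>2 * ((X (z - c))\<^sup>2 + (Y (z - c))\<^sup>2) = r\<^sup>2"
proof -
  have "(norm (z - c))\<^sup>2 = (norm l)\<^sup>2 * ((X (z - c))\<^sup>2 + (Y (z - c))\<^sup>2)"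
  proof -
    have "(norm (z - c))\<^sup>2 = (norm (vec (X (z - c)) (Y (z - c))))\<^sup>2" by (simp only: vec_XY)
    also have "\<dots> = ((X (z - c))\<^sup>2 + (Y (z - c))\<^sup>2) * (norm l)\<^sup>2"
      unfolding vec_def norm_mult power_mult_distrib by (simp add: cmod_power2)
    finally show ?thesis by simp
  qed
  moreover have "norm (z - c) < r \<longleftrightarrow> (norm (z - c))\<^sup>2 < r\<^sup>2"
    using r_pos by (simp add: not_le[symmetric] power_mono_iff)
  moreover have "norm (z - c) = r \<longleftrightarrow> (norm (z - c))\<^sup>2 = r\<^sup>2"
    using r_pos by (simp add: power_eq_iff_eq_base)
  ultimately show "z \<in> ball c r \<longleftrightarrow> (norm l)\<^sup>2 * ((X (z - c))\<^sup>2 + (Y (z - c))\<^sup>2) < r\<^sup>2"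
    and "z \<in> sphere c r \<longleftrightarrow> (norm l)\<^sup>2 * ((X (z - c))\<^sup>2 + (Y (z - c))\<^sup>2) = r\<^sup>2"
    by (simp_all only: mem_ball mem_sphere dist_norm norm_minus_commute[of c z])
qed

text \<open>The vertical line through \<open>w\<close> meets the circle at \<open>t = 0\<close> and
  at \<open>t = - 2 * Y (w - c)\<close>; in between it is inside.\<close>

lemma sphere_vertical:
  assumes w: "w \<in> sphere c r"
  shows "w - of_real t * l \<in> ball c r \<longleftrightarrow> t * (t + 2 * Y (w - c)) < 0"
    and "w - of_real t * l \<in> cball c r \<longleftrightarrow> t * (t + 2 * Y (w - c)) \<le> 0"
proof -
  let ?z = "w - of_real t * l"
  have d: "?z - c = (w - c) - of_real t * l" by simp
  have X: "X (?z - c) = X (w - c)" and Y: "Y (?z - c) = Y (w - c) + t"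
    unfolding d by (simp_all only: XY_linear mult_zero_right diff_zero mult_minus_right diff_minus_eq_add mult_1_right)
  have e: "(norm l)\<^sup>2 * ((X (?z - c))\<^sup>2 + (Y (?z - c))\<^sup>2) = r\<^sup>2 + (norm l)\<^sup>2 * (t * (t + 2 * Y (w - c)))"
    unfolding X Y using w unfolding sphere_XY by (simp only: power2_sum) algebra
  have n: "0 < (norm l)\<^sup>2" using l_nz by simp
  show ball: "?z \<in> ball c r \<longleftrightarrow> t * (t + 2 * Y (w - c)) < 0"
    unfolding ball_XY e using n by (simp add: mult_less_0_iff)
  have "?z \<in> sphere c r \<longleftrightarrow> t * (t + 2 * Y (w - c)) = 0"
    unfolding sphere_XY e using n by simp
  then show "?z \<in> cball c r \<longleftrightarrow> t * (t + 2 * Y (w - c)) \<le> 0"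
    using ball by (auto simp: le_less)
qed

text \<open>A downward ray from the circle can enter the open disc only from the upper half circle,
  so the gauge condition places all boundary vertices there.\<close>

lemma boundary_Y:
  assumes "b \<in> boundary G" shows "Y (b - c) > 0"
proof -
  obtain t where t: "0 < t" "b + of_real t * l \<in> ball c r" using gauge_ball[OF assms] by (auto simp: ray_def)
  have "b - of_real (- t) * l \<in> ball c r" using t by simp
  then have "- t * (- t + 2 * Y (b - c)) < 0" using sphere_vertical(1)[of b "- t"] assms boundary_sphere by blast
  then show ?thesis using t(1) by (simp add: zero_less_mult_iff mult_less_0_iff)
qed

text \<open>Boundary vertices cannot occur as \<open>w\<close>: they lie on the upper half circle,
  with nothing of the disc above them. A base off the drawing is on the lower half circle, and below
  it there is only the outside of the disc.\<close>

lemma Up_cases: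
  assumes w: "w \<notin> M" and p: "p \<in> Up w"
  shows "w \<in> internal G \<or> (\<exists>e\<in>E. w \<in> oseg e) \<or> (w \<in> sphere c r \<and> w \<notin> D \<and> Y (w - c) < 0 \<and> p \<in> exit_region)"
proof -
  obtain t where t: "p = w - of_real t * l" "0 < t" "\<And>s. 0 < s \<Longrightarrow> s \<le> t \<Longrightarrow> w - of_real s * l \<in> M"
    using p by (auto simp: Up_def)
  have inb: "w - of_real s * l \<in> ball c r" if "0 < s" "s \<le> t" for s using t(3)[OF that] M_ball by blast
  show ?thesis
  proof (cases "w \<in> D")
    case True
    have "w \<notin> boundary G"
    proof
      assume b: "w \<in> boundary G"
      then have "t * (t + 2 * Y (w - c)) < 0"
        using sphere_vertical(1)[of w t] inb[of t] boundary_sphere t(2) by blast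
      then show False using boundary_Y[OF b] t(2) by (simp add: mult_less_0_iff)
    qed
    then show ?thesis using True unfolding drawing_eq vertices_def by blast
  next
    case False
    then have wb: "w \<notin> ball c r" using w by (auto simp: M_def)
    have "((\<lambda>s. w - of_real s * l) \<longlongrightarrow> w - of_real 0 * l) (at_right (0::real))" by (intro tendsto_intros)
    moreover have "\<forall>\<^sub>F s in at_right 0. w - of_real s * l \<in> cball c r"
      unfolding eventually_at_right_field using t(2) inb by (intro exI[of _ t]) (auto simp: less_imp_le)
    ultimately have "w \<in> cball c r"
      using Lim_in_closed_set[of "cball c r" "\<lambda>s. w - of_real s * l" "at_right 0" "w - of_real 0 * l"]
      by simp
    then have ws: "w \<in> sphere c r" using wb by simp
    have "t * (t + 2 * Y (w - c)) < 0" using sphere_vertical(1)[OF ws, of t] inb[of t] t(2) by simp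
    then have Yw: "Y (w - c) < 0" using t(2) by (simp add: mult_less_0_iff)
    have "p + of_real t' * l \<notin> D" if "0 \<le> t'" for t'
    proof -
      have e: "p + of_real t' * l = w - of_real (t - t') * l" unfolding t(1) by (simp add: algebra_simps)
      consider "t' < t" | "t' = t" | "t < t'" by linarith
      then show ?thesis
      proof cases
        case 1 then show ?thesis unfolding e using t(3)[of "t - t'"] that by (auto simp: M_def)
      next
        case 2 then show ?thesis unfolding e using False by simp
      next
        case 3
        then have "\<not> (t - t') * ((t - t') + 2 * Y (w - c)) \<le> 0"
          using Yw by (simp add: mult_le_0_iff)
        then show ?thesis unfolding e using sphere_vertical(2)[OF ws] drawing_cball by blast
      qed
    qed
    then have "p \<in> exit_region" using inb[of t] t(1,2) by (auto simp: exit_region_def)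
    then show ?thesis using ws False Yw by blast
  qed
qed

section \<open>Topology of the exit region and of the strips\<close>

lemma exit_region_M: "exit_region \<subseteq> M"
  unfolding exit_region_def M_def by (force dest: spec[of _ 0])

lemma exit_region_Up:
  assumes "w \<in> D" shows "exit_region \<inter> Up w = {}"
proof -
  have False if "p \<in> exit_region" "p \<in> Up w" for p
  proof -
    obtain t where "p = w - of_real t * l" "0 < t" using \<open>p \<in> Up w\<close> by (auto simp: Up_def)
    then have "p + of_real t * l = w" "0 \<le> t" by auto
    then show False using that(1) assms by (auto simp: exit_region_def)
  qed
  then show ?thesis by blast
qed

text \<open>The complement is the sum of the compact drawing and the closed upward half line, hence
  closed.\<close>

lemma open_above_drawing: "open {p. \<forall>t\<ge>0. p + of_real t * l \<notin> D}"
proof -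
  let ?R = "{z. X z = 0 \<and> 0 \<le> Y z}"
  have "closed ?R"
    by (intro closed_Collect_conj closed_Collect_eq closed_Collect_le continuous_intros)
  then have "closed (\<Union>x\<in>D. \<Union>y\<in>?R. {x + y})" by (rule compact_closed_sums[OF compact_drawing])
  moreover have "- (\<Union>x\<in>D. \<Union>y\<in>?R. {x + y}) = {p. \<forall>t\<ge>0. p + of_real t * l \<notin> D}"
  proof (intro set_eqI iffI)
    fix p assume p: "p \<in> - (\<Union>x\<in>D. \<Union>y\<in>?R. {x + y})"
    have "p + of_real t * l \<notin> D" if "0 \<le> t" for t
    proof
      assume "p + of_real t * l \<in> D"
      moreover have "- (of_real t * l) \<in> ?R" using that by simp
      moreover have "p = (p + of_real t * l) + - (of_real t * l)" by simp
      ultimately show False using p by blast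
    qed
    then show "p \<in> {p. \<forall>t\<ge>0. p + of_real t * l \<notin> D}" by blast
  next
    fix p assume p: "p \<in> {p. \<forall>t\<ge>0. p + of_real t * l \<notin> D}"
    have False if "x \<in> D" "y \<in> ?R" "p = x + y" for x y
    proof -
      have "y = - (of_real (Y y) * l)" by (rule XY_eqI) (use that in auto)
      then have y0: "y + of_real (Y y) * l = 0" by (rule iffD1[OF eq_neg_iff_add_eq_0])
      have px: "p + of_real (Y y) * l = x" unfolding that(3) add.assoc y0 by (rule add.right_neutral)
      have "\<forall>t\<ge>0. p + of_real t * l \<notin> D" "0 \<le> Y y" using p that(2) by simp_all
      then have "p + of_real (Y y) * l \<notin> D" by blast
      then show False unfolding px using that(1) by (rule notE)
    qed
    then show "p \<in> - (\<Union>x\<in>D. \<Union>y\<in>?R. {x + y})" by blast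
  qed
  ultimately show ?thesis by (simp only: closed_def)
qed

lemma exit_region_eq: "exit_region = ball c r \<inter> {p. \<forall>t\<ge>0. p + of_real t * l \<notin> D}"
  by (auto simp: exit_region_def)

lemma open_exit_region: "open exit_region"
  unfolding exit_region_eq using open_above_drawing by auto

text \<open>Connected fibres force the parts of a separation of \<open>W\<close> to consist of whole
  fibres; since \<open>X\<close> is an open map, their images would separate the image of
  \<open>W\<close>.\<close>

lemma connected_fibres:
  assumes "open W" "connected (X ` W)" "\<And>x. connected {z \<in> W. X z = x}"
  shows "connected W"
proof (rule connectedI)
  fix P Q assume PQ: "open P" "open Q" "P \<inter> W \<noteq> {}" "Q \<inter> W \<noteq> {}" "P \<inter> Q \<inter> W = {}" "W \<subseteq> P \<union> Q"
  have "linear X" "surj X" by (auto intro!: linearI surjI[of X "\<lambda>x. vec x 0"])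
  then have "open (X ` (P \<inter> W))" "open (X ` (Q \<inter> W))"
    using PQ(1,2) assms(1) by (auto intro!: open_surjective_linear_image)
  moreover have "X ` (P \<inter> W) \<inter> X ` (Q \<inter> W) = {}"
  proof (rule ccontr)
    assume "X ` (P \<inter> W) \<inter> X ` (Q \<inter> W) \<noteq> {}"
    then obtain p q where pq: "p \<in> P \<inter> W" "q \<in> Q \<inter> W" "X p = X q" by auto
    let ?F = "{z \<in> W. X z = X p}"
    have "P \<inter> ?F = {} \<or> Q \<inter> ?F = {}"
      by (rule connectedD[OF assms(3) PQ(1,2)]) (use PQ(5,6) in auto)
    then show False using pq by auto
  qed
  ultimately have "X ` (P \<inter> W) \<inter> X ` W = {} \<or> X ` (Q \<inter> W) \<inter> X ` W = {}"
    by (intro connectedD[OF assms(2)]) (use PQ(6) in auto)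
  then show False using PQ(3,4) by auto
qed

lemma vertical_meets_oseg_once:
  assumes e: "e \<in> E" and z: "z \<in> oseg e" "z' \<in> oseg e" and X: "X z = X z'"
  shows "z = z'"
proof -
  let ?v = "fst e"
  have i: "e \<in> inc ?v" using e by (simp add: inc_def)
  obtain s where s: "z = ?v + of_real s * dir ?v e" using oseg_dir[OF i] z by blast
  obtain s' where s': "z' = ?v + of_real s' * dir ?v e" using oseg_dir[OF i] z by blast
  have "s * X (dir ?v e) = s' * X (dir ?v e)" using X unfolding s s' by simp
  then have "s = s'" using dir_X[OF i] by simp
  then show ?thesis using s s' by simp
qed

lemma oseg_not_M: "e \<in> E \<Longrightarrow> w \<in> oseg e \<Longrightarrow> w \<notin> M"
  by (auto simp: M_def drawing_eq)

lemma strip_face: assumes "e \<in> E" shows "strip e \<noteq> {}" "strip e \<subseteq> above e"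
  using Up_germ[OF above_face[OF assms] above_germ[OF assms]] oseg_nonempty[OF assms]
  by (fastforce simp: strip_def)+

text \<open>The vertical segment \<open>J\<close> from the edge up to \<open>p\<close> is compact in
  the open set \<open>M \<union> oseg e\<close>, so a neighbourhood of uniform width stays there;
  \<open>p\<close> can be moved along the edge and vertically within that margin.\<close>

lemma open_strip:
  assumes e: "e \<in> E"
  shows "open (strip e)"
proof (subst open_subopen, intro ballI)
  fix p assume "p \<in> strip e"
  then obtain w t0 where w: "w \<in> oseg e" and p: "p = w - of_real t0 * l" "0 < t0"
    "\<And>s. 0 < s \<Longrightarrow> s \<le> t0 \<Longrightarrow> w - of_real s * l \<in> M"
    by (auto simp: strip_def Up_def)
  define u v g where "u = fst e" and "v = snd e" and "g = v - u"
  have uv: "(u, v) \<in> E" "oseg e = open_segment u v" using e by (simp_all add: u_def v_def oseg_def)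
  have Xg: "X g \<noteq> 0" using edge_X[OF uv(1)] by (simp add: g_def)
  obtain s0 where s0: "0 < s0" "s0 < 1" "w = (1 - s0) *\<^sub>R u + s0 *\<^sub>R v"
    using w by (auto simp: uv(2) in_segment)
  have along: "w + of_real a * g \<in> oseg e" if "\<bar>a\<bar> < min s0 (1 - s0)" for a
    unfolding uv(2) in_segment
  proof (intro conjI exI[of _ "s0 + a"])
    show "u \<noteq> v" using edge_neq uv(1) by blast
    show "w + of_real a * g = (1 - (s0 + a)) *\<^sub>R u + (s0 + a) *\<^sub>R v"
      unfolding s0(3) g_def by (simp add: scaleR_conv_of_real algebra_simps)
  qed (use that in auto)
  \<comment> \<open>A vertical shift leaves the line of the edge, so a point of
    \<open>M \<union> oseg e\<close> reached this way is in \<open>M\<close>.\<close>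
  have off: "w + of_real a * g - of_real s * l \<notin> oseg e" if "s \<noteq> 0" for a s
  proof
    assume "w + of_real a * g - of_real s * l \<in> oseg e"
    then have "det2 g (w + of_real a * g - of_real s * l - u) = 0" "det2 g (w - u) = 0"
      using det2_on_open_segment w by (simp_all add: uv(2) g_def)
    moreover have "w + of_real a * g - of_real s * l - u = (w - u) + of_real a * g - of_real s * l" by simp
    ultimately have "s * det2 g l = 0"
      by (simp only: det2_add_right det2_diff_right det2_scale_right det2_self)
    then show False using that gauge_det[OF uv(1)] by (simp add: g_def)
  qed
  have "compact (\<Union>e'\<in>E - {e}. cseg e')"
    unfolding cseg_def by (intro compact_UN finite_Diff finite_edges) simp
  then have "compact (sphere c r \<union> D - oseg e)" unfolding minus_edge_eq[OF e]
    by (intro compact_Un compact_sphere finite_imp_compact[OF finite_vertices])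
  then have O: "open (ball c r - (sphere c r \<union> D - oseg e))" by (simp add: compact_imp_closed open_Diff)
  have OM: "ball c r - (sphere c r \<union> D - oseg e) = M \<union> oseg e"
    using oseg_ball[OF e] by (auto simp: M_def)
  define J where "J = (\<lambda>s. w - of_real s * l) ` {0..t0}"
  have "compact J" unfolding J_def by (intro compact_continuous_image continuous_intros) auto
  moreover have "J \<subseteq> M \<union> oseg e" using p(3) w by (force simp: J_def le_less)
  ultimately obtain \<epsilon> where \<epsilon>: "0 < \<epsilon>" "(\<Union>x\<in>J. ball x \<epsilon>) \<subseteq> M \<union> oseg e"
    using compact_subset_open_imp_ball_epsilon_subset O unfolding OM by metis
  define m where "m = norm g + norm l"
  have m: "0 < m" using l_nz by (auto simp: m_def intro: add_nonneg_pos)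
  \<comment> \<open>\<open>s0\<close> and \<open>1 - s0\<close> keep the foot on the edge,
    \<open>t0\<close> keeps the height positive, and \<open>\<epsilon> / m\<close> keeps the shifted
    segment within \<open>\<epsilon>\<close> of \<open>J\<close>.\<close>
  define \<eta> where "\<eta> = Min {s0, 1 - s0, t0, \<epsilon> / m}"
  have \<eta>: "0 < \<eta>" "\<eta> \<le> s0" "\<eta> \<le> 1 - s0" "\<eta> \<le> t0" "\<eta> \<le> \<epsilon> / m"
    using s0 p(2) \<epsilon>(1) m unfolding \<eta>_def by (auto intro: Min_le)
  have \<eta>m: "\<eta> * m \<le> \<epsilon>" using \<eta>(5) m by (simp add: pos_le_divide_eq)
  \<comment> \<open>\<open>a z\<close> and \<open>\<tau> z\<close> are the coordinates of
    \<open>z - p\<close> in the basis \<open>g\<close>, \<open>- l\<close>.\<close>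
  define a where "a z = X (z - p) / X g" for z
  define \<tau> where "\<tau> z = Y (z - p) - a z * Y g" for z
  define U where "U = {z. \<bar>a z\<bar> < \<eta>} \<inter> {z. \<bar>\<tau> z\<bar> < \<eta>}"
  have ca: "continuous_on UNIV a" unfolding a_def using Xg by (intro continuous_intros) auto
  have "continuous_on UNIV \<tau>" unfolding \<tau>_def by (intro continuous_intros ca)
  then have "open U" unfolding U_def by (intro open_Int open_Collect_less continuous_intros ca)
  moreover have "p \<in> U" using \<eta>(1) by (simp add: U_def \<tau>_def a_def)
  moreover have "U \<subseteq> strip e"
  proof
    fix z assume "z \<in> U"
    then have az: "\<bar>a z\<bar> < \<eta>" "\<bar>\<tau> z\<bar> < \<eta>" by (auto simp: U_def)
    have "z - p = of_real (a z) * g - of_real (\<tau> z) * l"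
    proof (rule XY_eqI)
      have "X (z - p) = a z * X g" using Xg by (simp add: a_def)
      then show "X (z - p) = X (of_real (a z) * g - of_real (\<tau> z) * l)" by simp
      have "Y (z - p) = a z * Y g + \<tau> z" by (simp add: \<tau>_def)
      then show "Y (z - p) = Y (of_real (a z) * g - of_real (\<tau> z) * l)" by simp
    qed
    then have z: "z = w + of_real (a z) * g - of_real (t0 + \<tau> z) * l"
      unfolding p(1) by (simp add: algebra_simps)
    have "w + of_real (a z) * g - of_real s * l \<in> M" if s: "0 < s" "s \<le> t0 + \<tau> z" for s
    proof -
      \<comment> \<open>The nearest height occurring in \<open>J\<close>; the moved segment may
        exceed it by less than \<open>\<eta>\<close>.\<close>
      define s' where "s' = min s t0"
      have s': "w - of_real s' * l \<in> J" "\<bar>s - s'\<bar> < \<eta>"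
        using s az p(2) by (auto simp: s'_def J_def min_def)
      have "dist (w - of_real s' * l) (w + of_real (a z) * g - of_real s * l) = norm (of_real (a z) * g - of_real (s - s') * l)"
        by (subst dist_commute) (simp add: dist_norm algebra_simps)
      also have "\<dots> \<le> \<bar>a z\<bar> * norm g + \<bar>s - s'\<bar> * norm l"
        using norm_triangle_ineq4[of "of_real (a z) * g" "of_real (s - s') * l"] by (simp only: norm_mult norm_of_real)
      also have "\<dots> < \<eta> * norm g + \<eta> * norm l"
        using az s' l_nz by (intro add_le_less_mono mult_right_mono mult_strict_right_mono) auto
      also have "\<dots> \<le> \<epsilon>" using \<eta>m by (simp add: m_def distrib_left)
      finally have "w + of_real (a z) * g - of_real s * l \<in> M \<union> oseg e" using \<epsilon>(2) s'(1) by (auto simp: subset_iff)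
      then show ?thesis using off[of s "a z"] s(1) by simp
    qed
    moreover have "0 < t0 + \<tau> z" using az \<eta> by linarith
    ultimately have "z \<in> Up (w + of_real (a z) * g)" unfolding Up_def using z by blast
    moreover have "w + of_real (a z) * g \<in> oseg e" using along az \<eta> by simp
    ultimately show "z \<in> strip e" by (auto simp: strip_def)
  qed
  ultimately show "\<exists>T. open T \<and> p \<in> T \<and> T \<subseteq> strip e" by blast
qed

lemma Up_X: "z \<in> Up w \<Longrightarrow> X z = X w"
  by (auto simp: Up_def)

text \<open>The nonempty vertical fibres are the sets \<open>Up w\<close>, and the horizontal
  projection is that of the edge.\<close>

lemma connected_strip:
  assumes e: "e \<in> E"
  shows "connected (strip e)"
proof (rule connected_fibres[OF open_strip[OF e]])
  have "X ` strip e = X ` oseg e"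
  proof (intro equalityI subsetI)
    fix x assume "x \<in> X ` oseg e"
    then obtain w where w: "w \<in> oseg e" "x = X w" by blast
    then obtain z where "z \<in> Up w" using Up_germ(1)[OF above_face[OF e] above_germ[OF e]] by blast
    then show "x \<in> X ` strip e" using w Up_X[of z w] by (intro image_eqI[of _ _ z]) (auto simp: strip_def)
  qed (auto simp: strip_def Up_X)
  then show "connected (X ` strip e)"
    by (auto intro!: connected_continuous_image continuous_intros simp: oseg_def convex_connected)
  show "connected {z \<in> strip e. X z = x}" for x
  proof (cases "\<exists>w\<in>oseg e. X w = x")
    case True
    then obtain w where w: "w \<in> oseg e" "X w = x" by blast
    have "{z \<in> strip e. X z = x} = Up w"
    proof (intro equalityI subsetI)
      fix z assume "z \<in> {z \<in> strip e. X z = x}"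
      then obtain w' where w': "w' \<in> oseg e" "z \<in> Up w'" "X z = x" by (auto simp: strip_def)
      then have "w' = w" using vertical_meets_oseg_once[OF e w'(1) w(1)] Up_X[of z w'] w(2) by simp
      then show "z \<in> Up w" using w' by simp
    qed (use w Up_X in \<open>auto simp: strip_def\<close>)
    then show ?thesis using convex_connected[OF Up_convex] by simp
  next
    case False
    then have "{z \<in> strip e. X z = x} = {}" using Up_X by (force simp: strip_def)
    then show ?thesis by (simp only: connected_empty)
  qed
qed

text \<open>The lower half circle as a graph over the horizontal coordinate relative to the centre.
  \<open>X\<close> and \<open>Y\<close> measure in units of \<open>norm l\<close>, so the radius
  appears as \<open>r / norm l\<close>.\<close>

definition lower_arc :: "real \<Rightarrow> complex" where
  "lower_arc x = c + vec x (- sqrt ((r / norm l)\<^sup>2 - x\<^sup>2))"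

lemma lower_arc:
  assumes "\<bar>x\<bar> < r / norm l"
  shows "lower_arc x \<in> sphere c r" "Y (lower_arc x - c) < 0" "lower_arc x \<notin> D"
proof -
  have pos: "x\<^sup>2 < (r / norm l)\<^sup>2" using assms by (metis abs_ge_zero power2_abs power_strict_mono zero_less_numeral)
  have XY: "X (lower_arc x - c) = x" "Y (lower_arc x - c) = - sqrt ((r / norm l)\<^sup>2 - x\<^sup>2)"
    by (simp_all add: lower_arc_def)
  show sph: "lower_arc x \<in> sphere c r"
    unfolding sphere_XY XY using pos l_nz by (simp add: power_divide)
  show neg: "Y (lower_arc x - c) < 0" unfolding XY(2) using pos by simp
  have "lower_arc x \<notin> boundary G" using boundary_Y[of "lower_arc x"] neg by linarith
  then show "lower_arc x \<notin> D" using sph drawing_sphere by blast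
qed

lemma lower_arc_surj:
  assumes "w \<in> sphere c r" "Y (w - c) < 0"
  shows "\<exists>x. \<bar>x\<bar> < r / norm l \<and> w = lower_arc x"
proof (intro exI conjI)
  let ?x = "X (w - c)" and ?y = "Y (w - c)"
  have "(norm l)\<^sup>2 * (?x\<^sup>2 + ?y\<^sup>2) = r\<^sup>2" using assms(1) sphere_XY by blast
  then have e: "?x\<^sup>2 + ?y\<^sup>2 = (r / norm l)\<^sup>2" using l_nz by (simp add: power_divide field_simps del: XY_linear)
  have "0 < ?y\<^sup>2" using assms(2) by simp
  then have "?x\<^sup>2 < (r / norm l)\<^sup>2" using e by linarith
  then have "\<bar>?x\<bar>\<^sup>2 < (r / norm l)\<^sup>2" by (simp only: power2_abs)
  then show "\<bar>?x\<bar> < r / norm l" by (rule power2_less_imp_less) (use r_pos in simp)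
  have "sqrt ((r / norm l)\<^sup>2 - ?x\<^sup>2) = sqrt (?y\<^sup>2)" by (simp only: flip: e) simp
  then have "- sqrt ((r / norm l)\<^sup>2 - ?x\<^sup>2) = ?y" using assms(2) by (simp only: real_sqrt_abs)
  then show "w = lower_arc ?x" unfolding lower_arc_def by (simp only: vec_XY) simp
qed

text \<open>Below a point of the lower arc there is only the outside of the disc, so no drawing; by
  \<open>open_above_drawing\<close> this extends to a neighbourhood.\<close>

lemma lower_arc_Up:
  assumes x: "\<bar>x\<bar> < r / norm l" and U: "open U" "lower_arc x \<in> U"
  shows "Up (lower_arc x) \<inter> U \<noteq> {}" and "Up (lower_arc x) \<subseteq> exit_region"
    and "\<exists>\<delta>>0. ball (lower_arc x) \<delta> \<inter> ball c r \<subseteq> exit_region"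
proof -
  let ?w = "lower_arc x"
  note w = lower_arc[OF x]
  have "?w \<in> {p. \<forall>t\<ge>0. p + of_real t * l \<notin> D}"
  proof (intro CollectI allI impI)
    fix t :: real assume "0 \<le> t"
    show "?w + of_real t * l \<notin> D"
    proof (cases "t = 0")
      case False
      then have "\<not> (- t) * (- t + 2 * Y (?w - c)) \<le> 0"
        using \<open>0 \<le> t\<close> w(2) by (simp add: mult_le_0_iff zero_le_mult_iff del: XY_linear)
      then have "?w - of_real (- t) * l \<notin> cball c r" using sphere_vertical(2)[OF w(1)] by blast
      then show ?thesis using drawing_cball by auto
    qed (use w in simp)
  qed
  then obtain \<delta> where \<delta>: "\<delta> > 0" "ball ?w \<delta> \<subseteq> {p. \<forall>t\<ge>0. p + of_real t * l \<notin> D}"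
    using open_above_drawing open_contains_ball by blast
  then have sub: "ball ?w \<delta> \<inter> ball c r \<subseteq> exit_region" unfolding exit_region_eq by blast
  then show "\<exists>\<delta>>0. ball ?w \<delta> \<inter> ball c r \<subseteq> exit_region" using \<delta>(1) by blast
  have wM: "?w \<notin> M" using w(1) by (auto simp: M_def)
  show "Up ?w \<subseteq> exit_region"
  proof
    fix p assume "p \<in> Up ?w"
    from Up_cases[OF wM this] show "p \<in> exit_region"
      using w(3) by (auto simp: drawing_eq vertices_def)
  qed
  have "\<forall>\<^sub>F t in at_right 0. ?w + of_real t * (- l) \<in> U \<inter> ball ?w \<delta>"
    by (rule eventually_translate_ball) (use U \<delta> in auto)
  moreover have "\<forall>\<^sub>F t in at_right 0. ?w - of_real t * l \<in> ball c r"
    unfolding eventually_at_right_field sphere_vertical(1)[OF w(1)]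
    using w(2) by (intro exI[of _ "- 2 * Y (?w - c)"]) (auto simp: mult_less_0_iff simp del: XY_linear)
  ultimately have "\<forall>\<^sub>F t in at_right 0. ?w - of_real t * l \<in> U \<inter> exit_region"
    by eventually_elim (use sub in auto)
  then obtain b where b: "0 < b" "\<And>t. 0 < t \<Longrightarrow> t < b \<Longrightarrow> ?w - of_real t * l \<in> U \<inter> exit_region"
    by (auto simp: eventually_at_right_field)
  then have "?w - of_real (b / 2) * l \<in> Up ?w"
    using exit_region_M unfolding Up_def by (intro CollectI exI[of _ "b / 2"]) auto
  then show "Up ?w \<inter> U \<noteq> {}" using b(2)[of "b / 2"] b(1) by auto
qed

lemma exit_region_nonempty: "exit_region \<noteq> {}"
  using lower_arc_Up(1,2)[OF _ open_UNIV, of 0] r_pos l_nz by auto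

text \<open>Every vertical line through the open disc leaves it through the lower arc, so the
  projection is the full width of the disc; the fibres are convex.\<close>

lemma exit_region_connected: "connected exit_region"
proof (rule connected_fibres[OF open_exit_region])
  have "X ` exit_region = {X c - r / norm l<..<X c + r / norm l}"
  proof (intro equalityI subsetI)
    fix x assume "x \<in> X ` exit_region"
    then obtain z where z: "z \<in> ball c r" "x = X z" by (auto simp: exit_region_def)
    have "(norm l)\<^sup>2 * (X (z - c))\<^sup>2 \<le> (norm l)\<^sup>2 * ((X (z - c))\<^sup>2 + (Y (z - c))\<^sup>2)"
      by (intro mult_left_mono) (simp_all del: XY_linear)
    also have "\<dots> < r\<^sup>2" using z(1) ball_XY by blast
    finally have "\<bar>X (z - c)\<bar>\<^sup>2 < (r / norm l)\<^sup>2"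
      using l_nz by (simp add: power_divide pos_less_divide_eq mult.commute del: XY_linear)
    then have "\<bar>X (z - c)\<bar> < r / norm l" by (rule power2_less_imp_less) (use r_pos in simp)
    then show "x \<in> {X c - r / norm l<..<X c + r / norm l}" using z(2) by (simp add: abs_less_iff)
  next
    fix x assume "x \<in> {X c - r / norm l<..<X c + r / norm l}"
    then have x: "\<bar>x - X c\<bar> < r / norm l" by (auto simp: abs_less_iff)
    then obtain z where "z \<in> Up (lower_arc (x - X c))" "z \<in> exit_region"
      using lower_arc_Up(1,2)[OF x open_UNIV] by blast
    moreover have "X (lower_arc (x - X c)) = x" by (simp add: lower_arc_def)
    ultimately show "x \<in> X ` exit_region" using Up_X by (metis image_eqI)
  qed
  then show "connected (X ` exit_region)" by (simp add: convex_connected)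
  show "connected {z \<in> exit_region. X z = x}" for x
  proof (intro convex_connected convexI)
    fix z z' :: complex and a b :: real
    assume h: "z \<in> {z \<in> exit_region. X z = x}" "z' \<in> {z \<in> exit_region. X z = x}" "0 \<le> a" "0 \<le> b" "a + b = 1"
    let ?p = "a *\<^sub>R z + b *\<^sub>R z'"
    have Xp: "X ?p = x" using h by (simp flip: distrib_right)
    have "?p \<in> ball c r" using h convex_ball[of c r] by (auto simp: exit_region_def convex_def)
    moreover have "?p + of_real t * l \<notin> D" if t: "0 \<le> t" for t
    proof -
      \<comment> \<open>\<open>q\<close> is the higher of the two points: what lies below
        \<open>?p\<close> also lies below \<open>q\<close>.\<close>
      obtain q where q: "q \<in> exit_region" "X q = x" "Y ?p \<le> Y q"
      proof (cases "Y z \<le> Y z'")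
        case True
        then show ?thesis using that[of z'] h convex_bound_le[of "Y z" "Y z'" "Y z'" a b] by simp
      next
        case False
        then show ?thesis using that[of z] h convex_bound_le[of "Y z" "Y z" "Y z'" a b] by simp
      qed
      have e: "?p + of_real t * l = q + of_real (t + (Y q - Y ?p)) * l"
        by (rule XY_eqI) (use Xp q(2) in \<open>simp_all del: of_real_add of_real_diff\<close>)
      have "0 \<le> t + (Y q - Y ?p)" using t q(3) by linarith
      then show ?thesis unfolding e using q(1) unfolding exit_region_def by blast
    qed
    ultimately show "?p \<in> {z \<in> exit_region. X z = x}" using Xp by (simp add: exit_region_def)
  qed
qed

text \<open>Identified with the infinite face in \<open>infinite_face_iff\<close>. The exit region
  is nonempty and connected, so there is exactly one choice.\<close>

definition outer :: "complex set" where
  "outer = (SOME C. C \<in> components M \<and> exit_region \<subseteq> C)"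

lemma outer_face: "outer \<in> components M" and exit_region_outer: "exit_region \<subseteq> outer"
proof -
  have "M \<noteq> {}" using exit_region_nonempty exit_region_M by blast
  then have "\<exists>C. C \<in> components M \<and> exit_region \<subseteq> C"
    using exists_component_superset[OF exit_region_M _ exit_region_connected] by blast
  from someI_ex[OF this, folded outer_def] show "outer \<in> components M" "exit_region \<subseteq> outer" by auto
qed

section \<open>Counting the pieces of a face\<close>

lemma internal_not_M: "v \<in> internal G \<Longrightarrow> v \<notin> M"
  by (auto simp: M_def drawing_eq vertices_def)

theorem face_euler:
  assumes C: "C \<in> components M"
  shows "card {e \<in> E. above e = C} + (if C = outer then 1 else 0) =
    card {v \<in> internal G. vface 1 v = C} + 1"
proof -
  define V where "V = {v \<in> internal G. vface 1 v = C}"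
  define EC where "EC = {e \<in> E. above e = C}"
  define Z where "Z = (if C = outer then {exit_region} else {})"
  have CM: "C \<subseteq> M" using C in_components_subset by blast
  have "\<forall>v\<in>internal G. \<exists>q. q \<noteq> v \<and> q \<notin> M \<and> open_segment v q = Up v" using up_chord by metis
  then obtain q where q: "\<And>v. v \<in> internal G \<Longrightarrow> q v \<noteq> v \<and> q v \<notin> M \<and> open_segment v (q v) = Up v"
    by metis
  have UpV: "Up v \<subseteq> vface 1 v" if "v \<in> internal G" for v
    using Up_germ(2)[OF vface_germ(1)[of v 1], of v] vface_germ(2)[of v 1] that by (auto simp: eventually_conj_iff)
  have "card (components (C - (\<Union>v\<in>V. open_segment v (q v)))) = card V + 1"
  proof -
    have "finite (components (C - (\<Union>v\<in>V. open_segment v (q v)))) \<and>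
      card (components (C - (\<Union>v\<in>V. open_segment v (q v)))) = card V + 1 \<and>
      (\<forall>K \<in> components (C - (\<Union>v\<in>V. open_segment v (q v))). open K \<and> connected (- K))"
    proof (rule crosscuts_card_components)
      show "bounded C" using CM M_ball bounded_ball bounded_subset by blast
      show "open C" using C open_M open_components by blast
      show "connected C" "C \<noteq> {}" using C in_components_connected in_components_nonempty by blast+
      show "connected (- C)" by (rule face_complement_connected[OF C])
      show "finite V" using finite_internal by (simp add: V_def)
      show "v \<noteq> q v \<and> open_segment v (q v) \<subseteq> C \<and> v \<notin> C \<and> q v \<notin> C" if "v \<in> V" for v
        using q[of v] UpV[of v] internal_not_M[of v] that CM by (auto simp: V_def)
      show "open_segment v (q v) \<inter> open_segment w (q w) = {}" if "v \<in> V" "w \<in> V" "v \<noteq> w" for v w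
        using q[of v] q[of w] that Up_unique[of _ v w] internal_not_M by (auto simp: V_def)
    qed
    then show ?thesis by blast
  qed
  moreover have "(\<Union>v\<in>V. open_segment v (q v)) = (\<Union>v\<in>V. Up v)" using q by (auto simp: V_def)
  ultimately have "card (components (C - (\<Union>v\<in>V. Up v))) = card V + 1" by simp
  \<comment> \<open>The pieces are recognised, not computed: pairwise disjoint nonempty open
    connected sets with the right union are the components. Each point is assigned to its piece by
    the base of its vertical segment.\<close>
  moreover have "components (C - (\<Union>v\<in>V. Up v)) = strip ` EC \<union> Z"
  proof (rule components_open_unique)
    have strips: "strip e \<inter> strip e' = {}" if "e \<in> E" "e' \<in> E" "e \<noteq> e'" for e e'
    proof -
      have False if h: "w \<in> oseg e" "w' \<in> oseg e'" "p \<in> Up w" "p \<in> Up w'" for w w' p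
      proof -
        have "w = w'" using Up_unique[OF h(3,4)] oseg_not_M h \<open>e \<in> E\<close> \<open>e' \<in> E\<close> by blast
        then show False using h oseg_disjoint[OF \<open>e \<in> E\<close> \<open>e' \<in> E\<close> \<open>e \<noteq> e'\<close>] by blast
      qed
      then show ?thesis by (auto simp: strip_def)
    qed
    have exits: "strip e \<inter> exit_region = {}" if "e \<in> E" for e
      using exit_region_Up that by (fastforce simp: strip_def drawing_eq)
    show "pairwise disjnt (strip ` EC \<union> Z)"
      using strips exits unfolding pairwise_def disjnt_def EC_def Z_def by (auto split: if_splits) blast+
    show "open S \<and> connected S \<and> S \<noteq> {}" if "S \<in> strip ` EC \<union> Z" for S
      using that open_strip connected_strip strip_face(1) open_exit_region exit_region_connected exit_region_nonempty
      by (auto simp: EC_def Z_def split: if_splits)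
    show "\<Union> (strip ` EC \<union> Z) = C - (\<Union>v\<in>V. Up v)"
    proof (intro equalityI subsetI)
      fix p assume "p \<in> \<Union> (strip ` EC \<union> Z)"
      then consider e where "e \<in> EC" "p \<in> strip e" | "p \<in> exit_region" "C = outer"
        by (auto simp: Z_def split: if_splits)
      then show "p \<in> C - (\<Union>v\<in>V. Up v)"
      proof cases
        case 1
        then have e: "e \<in> E" "above e = C" by (auto simp: EC_def)
        obtain w where w: "w \<in> oseg e" "p \<in> Up w" using 1 by (auto simp: strip_def)
        have "p \<notin> Up v" if "v \<in> V" for v
        proof
          assume "p \<in> Up v"
          then have "v = w" using Up_unique[of p v w] w oseg_not_M[OF e(1)] internal_not_M that by (auto simp: V_def)
          then show False using w oseg_vertices[OF e(1)] that by (auto simp: V_def vertices_def)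
        qed
        then show ?thesis using strip_face(2)[OF e(1)] e 1 by blast
      next
        case 2
        have "p \<notin> Up v" if "v \<in> V" for v
          using exit_region_Up[of v] 2 that by (auto simp: V_def drawing_eq vertices_def)
        then show ?thesis using exit_region_outer 2 by blast
      qed
    next
      fix p assume p: "p \<in> C - (\<Union>v\<in>V. Up v)"
      then obtain w where w: "w \<notin> M" "p \<in> Up w" using Up_base CM by blast
      from Up_cases[OF w] consider "w \<in> internal G" | e where "e \<in> E" "w \<in> oseg e" | "p \<in> exit_region" by blast
      then show "p \<in> \<Union> (strip ` EC \<union> Z)"
      proof cases
        case 1
        then have "vface 1 w = C" using face_eqI[OF vface_germ(1)[of w 1] C] UpV[OF 1] w p by blast
        then show ?thesis using 1 p w by (auto simp: V_def)
      next
        case 2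
        then have "p \<in> strip e" using w by (auto simp: strip_def)
        then have "above e = C" using face_eqI[OF above_face C] strip_face(2) 2 p by blast
        then have "e \<in> EC" using 2 by (simp add: EC_def)
        then show ?thesis using \<open>p \<in> strip e\<close> by blast
      next
        case 3
        then have "C = outer" using face_eqI[OF C outer_face] exit_region_outer p by blast
        then show ?thesis using 3 by (auto simp: Z_def)
      qed
    qed
  qed
  moreover have "card (strip ` EC \<union> Z) = card EC + (if C = outer then 1 else 0)"
  proof -
    have inj: "inj_on strip EC"
    proof (rule inj_onI, rule ccontr)
      fix e e' assume h: "e \<in> EC" "e' \<in> EC" "strip e = strip e'" "e \<noteq> e'"
      then have E: "e \<in> E" "e' \<in> E" by (auto simp: EC_def)
      obtain w p where w: "w \<in> oseg e" "p \<in> Up w" using strip_face(1)[OF E(1)] by (auto simp: strip_def)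
      then have "p \<in> strip e'" using h(3) by (auto simp: strip_def)
      then obtain w' where w': "w' \<in> oseg e'" "p \<in> Up w'" by (auto simp: strip_def)
      have "w = w'" using Up_unique[OF w(2) w'(2)] oseg_not_M E w w' by blast
      then show False using oseg_disjoint[OF E h(4)] w w' by blast
    qed
    have "exit_region \<notin> strip ` EC"
    proof
      assume "exit_region \<in> strip ` EC"
      then obtain e where e: "e \<in> E" "strip e = exit_region" by (auto simp: EC_def)
      obtain w p where w: "w \<in> oseg e" "p \<in> Up w" using strip_face(1)[OF e(1)] by (auto simp: strip_def)
      then show False using exit_region_Up[of w] e by (auto simp: strip_def drawing_eq)
    qed
    then have "card (strip ` EC \<union> Z) = card (strip ` EC) + card Z"
      using finite_edges by (intro card_Un_disjoint) (auto simp: EC_def Z_def)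
    then show ?thesis using card_image[OF inj] by (simp add: Z_def)
  qed
  ultimately show ?thesis by (simp add: EC_def V_def)
qed

end

subsection \<open>Parity at an internal vertex\<close>

text \<open>With \<open>H\<close> sorted by \<open>key\<close>, \<open>after\<close> of an element
  is \<open>before\<close> of the next. Serves the edges on one side of a vertex, sorted by slope,
  and the edges crossed by a ray, sorted by time; the last hypothesis covers the case of no
  edges.\<close>

lemma telescoping_sum:
  fixes key :: "'a \<Rightarrow> real" and before after :: "'a \<Rightarrow> int"
  assumes "finite H" "inj_on key H"
    and "\<And>h. h \<in> H \<Longrightarrow> \<forall>h'\<in>H. key h \<le> key h' \<Longrightarrow> before h = s"
    and "\<And>h h'. h \<in> H \<Longrightarrow> h' \<in> H \<Longrightarrow> key h < key h' \<Longrightarrow>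
           \<forall>h''\<in>H. key h'' \<le> key h \<or> key h' \<le> key h'' \<Longrightarrow> after h = before h'"
    and "\<And>h. h \<in> H \<Longrightarrow> \<forall>h'\<in>H. key h' \<le> key h \<Longrightarrow> after h = q"
    and "H = {} \<Longrightarrow> s = q"
  shows "(\<Sum>h\<in>H. after h - before h) = q - s"
  using assms
\<comment> \<open>The largest element is split off, so \<open>q\<close> has to vary: for the rest
  the end value is \<open>before x\<close>.\<close>
proof (induction H arbitrary: q rule: finite_ranking_induct[where f = key])
  case (insert x S)
  show ?case
  proof (cases "x \<in> S")
    case True
    then have "insert x S = S" by blast
    then show ?thesis using insert.IH insert.prems by simp
  next
    case False
    have lt: "key y < key x" if "y \<in> S" for y
      using insert.hyps(2)[OF that] insert.prems(1) that False by (auto simp: inj_on_def less_le)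
    have ax: "after x = q" using insert.prems(4)[of x] insert.hyps(2) by auto
    have "(\<Sum>h\<in>S. after h - before h) = before x - s"
    proof (rule insert.IH)
      show "inj_on key S" using insert.prems(1) by simp
      show "before h = s" if "h \<in> S" "\<forall>h'\<in>S. key h \<le> key h'" for h
        using insert.prems(2)[of h] that lt[OF that(1)] by auto
      show "after h = before h'" if "h \<in> S" "h' \<in> S" "key h < key h'"
        "\<forall>h''\<in>S. key h'' \<le> key h \<or> key h' \<le> key h''" for h h'
        using insert.prems(3)[of h h'] that lt[OF that(2)] by auto
      show "after h = before x" if "h \<in> S" "\<forall>h'\<in>S. key h' \<le> key h" for h
        using insert.prems(3)[of h x] that lt[OF that(1)] by auto
      show "s = before x" if "S = {}"
        using insert.prems(2)[of x] that by auto
    qed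
    then show ?thesis using ax False insert.hyps(1) by simp
  qed
qed simp

context gauged_graph
begin

abbreviation out_edges where "out_edges v \<equiv> {e \<in> E. fst e = v}"
abbreviation in_edges where "in_edges v \<equiv> {e \<in> E. snd e = v}"

text \<open>Integer indicators, ready for congruences. By \<open>above_neq_below\<close>,
  \<open>A C e + B C e\<close> is the indicator of \<open>e\<close> lying on the boundary of
  \<open>C\<close>.\<close>

definition A :: "complex set \<Rightarrow> complex \<times> complex \<Rightarrow> int" where "A C e = of_bool (above e = C)"
definition B :: "complex set \<Rightarrow> complex \<times> complex \<Rightarrow> int" where "B C e = of_bool (below e = C)"
definition U :: "complex set \<Rightarrow> complex \<Rightarrow> int" where "U C v = of_bool (vface 1 v = C)"
definition L :: "complex set \<Rightarrow> complex \<Rightarrow> int" where "L C v = of_bool (vface (- 1) v = C)"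

lemma inj_on_slope: "inj_on (slope v) {e \<in> inc v. side v e = \<sigma> \<and> P e}"
  by (rule inj_onI, rule edge_slopes_distinct[of _ v]) simp_all

text \<open>Climbing through the edges on one side of \<open>v\<close> leads from the face directly
  below \<open>v\<close> to the one directly above; on a side without edges these are the same
  face.\<close>

lemma side_sum:
  assumes v: "v \<in> internal G" and sg: "\<sigma> = 1 \<or> \<sigma> = - 1"
  shows "(\<Sum>e\<in>{e \<in> inc v. side v e = \<sigma>}. A C e - B C e) = U C v - L C v" (is "sum _ ?H = _")
proof (rule telescoping_sum[where key = "slope v"])
  show "inj_on (slope v) ?H" using inj_on_slope[of v \<sigma> "\<lambda>_. True"] by simp
  show "B C h = L C v" if "h \<in> ?H" "\<forall>h'\<in>?H. slope v h \<le> slope v h'" for h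
    using outermost_edge_face[of v "- 1" h] v that by (auto simp: B_def L_def)
  show "A C h = U C v" if "h \<in> ?H" "\<forall>h'\<in>?H. slope v h' \<le> slope v h" for h
    using outermost_edge_face[of v 1 h] v that by (auto simp: A_def U_def)
  show "A C h = B C h'" if "h \<in> ?H" "h' \<in> ?H"
    "slope v h < slope v h'" "\<forall>h''\<in>?H. slope v h'' \<le> slope v h \<or> slope v h' \<le> slope v h''" for h h'
    using consecutive_edges_face[of v h h'] v that by (auto simp: A_def B_def)
  show "L C v = U C v" if "?H = {}"
    using edge_free_side_face[of v \<sigma>] v sg that by (auto simp: U_def L_def)
qed (simp add: finite_inc)

text \<open>The same climb, started just above \<open>e\<close>; needed where \<open>wind\<close>
  selects the edges higher than \<open>e\<close>.\<close>

lemma above_sum: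
  assumes v: "v \<in> internal G" and e: "e \<in> inc v"
  shows "(\<Sum>e'\<in>{e' \<in> inc v. side v e' = side v e \<and> slope v e < slope v e'}. A C e' - B C e') = U C v - A C e"
    (is "sum _ ?H = _")
proof (rule telescoping_sum[where key = "slope v"])
  show "inj_on (slope v) ?H" by (rule inj_on_slope)
  show "B C h = A C e" if "h \<in> ?H" "\<forall>h'\<in>?H. slope v h \<le> slope v h'" for h
    using consecutive_edges_face[of v e h] v e that by (force simp: A_def B_def)
  show "A C h = U C v" if "h \<in> ?H" "\<forall>h'\<in>?H. slope v h' \<le> slope v h" for h
    using outermost_edge_face[of v 1 h] v that by (force simp: A_def U_def)
  show "A C h = B C h'" if "h \<in> ?H" "h' \<in> ?H"
    "slope v h < slope v h'" "\<forall>h''\<in>?H. slope v h'' \<le> slope v h \<or> slope v h' \<le> slope v h''" for h h'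
    using consecutive_edges_face[of v h h'] v that by (force simp: A_def B_def)
  show "A C e = U C v" if "?H = {}"
    using outermost_edge_face[of v 1 e] v e that by (force simp: A_def U_def not_less)
qed (simp add: finite_inc)

text \<open>Obtained by subtracting \<open>above_sum\<close> and the term of \<open>e\<close> from
  the full climb.\<close>

lemma below_sum:
  assumes v: "v \<in> internal G" and e: "e \<in> inc v"
  shows "(\<Sum>e'\<in>{e' \<in> inc v. side v e' = side v e \<and> slope v e' < slope v e}. A C e' - B C e') = B C e - L C v"
    (is "sum ?f ?H = _")
proof -
  let ?K = "{e' \<in> inc v. side v e' = side v e \<and> slope v e < slope v e'}"
  have "{e' \<in> inc v. side v e' = side v e} = insert e (?H \<union> ?K)"
    using e edge_slopes_distinct[OF e] by fastforce
  moreover have "sum ?f (insert e (?H \<union> ?K)) = ?f e + (sum ?f ?H + sum ?f ?K)"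
    using finite_inc by (simp add: sum.union_disjoint disjoint_iff)
  ultimately have "?f e + (sum ?f ?H + sum ?f ?K) = U C v - L C v"
    using side_sum[OF v side_cases[OF e], of C] by simp
  then show ?thesis using above_sum[OF v e, of C] by simp
qed

lemma edge_in_closure:
  assumes e: "e \<in> E"
  shows "cseg e \<subseteq> closure (above e)" "cseg e \<subseteq> closure (below e)"
proof -
  have cl: "cseg e \<subseteq> closure C" if "\<And>w. w \<in> oseg e \<Longrightarrow> \<forall>\<^sub>F t in at_right 0. w + of_real t * d \<in> C" for C d
  proof -
    have "w \<in> closure C" if w: "w \<in> oseg e" for w
    proof -
      have "((\<lambda>t. w + of_real t * d) \<longlongrightarrow> w + of_real 0 * d) (at_right (0::real))" by (intro tendsto_intros)
      moreover have "\<forall>\<^sub>F t in at_right 0. w + of_real t * d \<in> closure C"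
        using \<open>\<And>w. w \<in> oseg e \<Longrightarrow> \<forall>\<^sub>F t in at_right 0. w + of_real t * d \<in> C\<close>[OF w]
        by eventually_elim (use closure_subset in blast)
      ultimately show ?thesis
        using Lim_in_closed_set[of "closure C" "\<lambda>t. w + of_real t * d" "at_right 0" "w + of_real 0 * d"] by simp
    qed
    then have "closure (oseg e) \<subseteq> closure C" by (intro closure_minimal) auto
    moreover have "closure (oseg e) = cseg e"
      using edge_neq[of "fst e" "snd e"] e by (simp add: oseg_def cseg_def closure_open_segment)
    ultimately show ?thesis by simp
  qed
  show "cseg e \<subseteq> closure (above e)" using cl[of "- l"] above_germ[OF e] by simp
  show "cseg e \<subseteq> closure (below e)" using cl[of l] below_germ[OF e] by simp
qed

lemma inc_split: "inc v = in_edges v \<union> out_edges v" "in_edges v \<inter> out_edges v = {}"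
  using edge_neq by (auto simp: inc_def)

lemma card_in: "card (in_edges v) = in_degree G v" and card_out: "card (out_edges v) = out_degree G v"
proof -
  have "in_edges v = (\<lambda>u. (u, v)) ` {u. (u, v) \<in> E}" by force
  then show "card (in_edges v) = in_degree G v"
    by (simp add: in_degree_def card_image inj_on_def)
  have "out_edges v = (\<lambda>w. (v, w)) ` {w. (v, w) \<in> E}" by force
  then show "card (out_edges v) = out_degree G v"
    by (simp add: out_degree_def card_image inj_on_def)
qed

lemma card_inc: "card (inc v) = degree G v"
  unfolding degree_def card_in[symmetric] card_out[symmetric] unfolding inc_split(1)
  using finite_edges inc_split(2)[of v] by (intro card_Un_disjoint) auto

lemma incident_sums:
  assumes v: "v \<in> internal G"
  shows "(\<Sum>e\<in>inc v. A C e - B C e) = 2 * (U C v - L C v)"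
proof -
  have "inc v = {e \<in> inc v. side v e = 1} \<union> {e \<in> inc v. side v e = - 1}"
    using side_cases by blast
  then have "(\<Sum>e\<in>inc v. A C e - B C e) =
      (\<Sum>e\<in>{e \<in> inc v. side v e = 1} \<union> {e \<in> inc v. side v e = - 1}. A C e - B C e)" by simp
  also have "\<dots> = (\<Sum>e\<in>{e \<in> inc v. side v e = 1}. A C e - B C e) + (\<Sum>e\<in>{e \<in> inc v. side v e = - 1}. A C e - B C e)"
    by (rule sum.union_disjoint) (auto simp: finite_inc)
  finally show ?thesis using side_sum[OF v] by simp
qed

text \<open>Each corner of \<open>C\<close> at \<open>v\<close> is bounded by two edge sides, so twice the number of corners is at
  most the degree, i.e. at most 3.\<close>

lemma corner_count:
  assumes v: "v \<in> internal G" and C: "C \<in> components M"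
  shows "(\<Sum>e\<in>inc v. B C e) + U C v - L C v = of_bool (v \<in> closure C)"
    and "(\<Sum>e\<in>inc v. A C e + B C e) = 2 * of_bool (v \<in> closure C)"
proof -
  \<comment> \<open>The number of corners of \<open>C\<close> at \<open>v\<close>. A corner inside
    one side is counted by \<open>B\<close> at its upper edge. If both sides have edges, the corner
    above \<open>v\<close> is counted by \<open>U\<close>, and the one below by \<open>B\<close> on
    both sides, whence \<open>- L\<close>. If one side is empty, the corner around it gets
    \<open>1 + 1 - 1\<close>.\<close>
  let ?occ = "(\<Sum>e\<in>inc v. B C e) + U C v - L C v"
  let ?n = "\<Sum>e\<in>inc v. A C e + B C e"
  have n: "?n = 2 * ?occ" using incident_sums[OF v, of C] by (simp add: sum.distrib sum_subtractf)
  have AB: "0 \<le> A C e + B C e" "A C e + B C e \<le> 1" if "e \<in> inc v" for e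
    using above_neq_below[OF inc_edge[OF that]] by (auto simp: A_def B_def)
  have "?n \<le> (\<Sum>e\<in>inc v. 1)" by (intro sum_mono AB)
  also have "\<dots> \<le> 3" using internal_degree[OF v] by (auto simp: card_inc)
  finally have "2 * ?occ \<le> 3" using n by simp
  moreover have "x \<le> 1" if "2 * x \<le> 3" for x :: int using that by presburger
  ultimately have le: "?occ \<le> 1" by blast
  have "?occ = of_bool (v \<in> closure C)"
  proof (cases "v \<in> closure C")
    case True
    then obtain e where e: "e \<in> inc v" "C = above e \<or> C = below e" using face_at_vertex[OF v C] by blast
    then have "1 \<le> A C e + B C e" by (auto simp: A_def B_def)
    also have "\<dots> \<le> ?n" using AB e(1) finite_inc by (intro member_le_sum) auto
    finally show ?thesis using le n True by simp
  next
    case False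
    have "A C e = 0 \<and> B C e = 0" if "e \<in> inc v" for e
      using edge_in_closure[OF inc_edge[OF that]] that False by (auto simp: A_def B_def inc_def cseg_eq)
    then have "?n = 0" by (simp add: sum.neutral)
    then show ?thesis using n False by simp
  qed
  then show "?occ = of_bool (v \<in> closure C)" "?n = 2 * of_bool (v \<in> closure C)" using n by auto
qed

text \<open>With both edges directed away from \<open>v\<close>, the signs of \<open>orient\<close>
  involving \<open>l\<close> agree exactly if the edges are on the same side; given that, the
  remaining sign compares their slopes. The value \<open>- 1\<close> counts as \<open>1\<close> mod
  2.\<close>

lemma wind_parity:
  assumes "(u, v) \<in> E" "(v, w) \<in> E"
  shows "[wind l (v - u) (w - v) =
    of_bool (side v (u, v) = side v (v, w) \<and> slope v (v, w) < slope v (u, v))] (mod 2)"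
proof -
  have inc: "(u, v) \<in> inc v" "(v, w) \<in> inc v" using assms by (auto simp: inc_def)
  have uv: "u \<noteq> v" using edge_neq assms by blast
  define x1 x2 m1 m2 where "x1 = X (dir v (u, v))" and "x2 = X (dir v (v, w))"
    and "m1 = slope v (u, v)" and "m2 = slope v (v, w)"
  have d: "dir v (u, v) = u - v" "dir v (v, w) = w - v" using uv by (auto simp: dir_def)
  have f: "v - u = - (dir v (u, v))" by (simp add: d)
  have x: "x1 \<noteq> 0" "x2 \<noteq> 0" using dir_X[OF inc(1)] dir_X[OF inc(2)] by (simp_all add: x1_def x2_def)
  have Y: "Y (dir v (u, v)) = m1 * \<bar>x1\<bar>" "Y (dir v (v, w)) = m2 * \<bar>x2\<bar>"
    using dir_Y inc by (simp_all add: x1_def x2_def m1_def m2_def)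
  have n: "0 < (norm l)\<^sup>2" using l_nz by simp
  have det: "det2 (v - u) (w - v) = (norm l)\<^sup>2 * (m1 * \<bar>x1\<bar> * x2 - x1 * (m2 * \<bar>x2\<bar>))"
    "det2 (v - u) l = (norm l)\<^sup>2 * x1" "det2 l (w - v) = (norm l)\<^sup>2 * x2"
    unfolding f d(2)[symmetric] det2_XY XY_linear Y x1_def[symmetric] x2_def[symmetric] by simp_all
  have o: "orient (v - u) l = (if 0 < x1 then 1 else - 1)" "orient l (w - v) = (if 0 < x2 then 1 else - 1)"
    unfolding orient_def det using n x by (auto simp: zero_less_mult_iff)
  have s: "side v (u, v) = (if 0 < x1 then 1 else - 1)" "side v (v, w) = (if 0 < x2 then 1 else - 1)"
    unfolding side_def x1_def[symmetric] x2_def[symmetric] using x by (auto simp: sgn_if)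
  consider "0 < x1" "0 < x2" | "x1 < 0" "x2 < 0" | "0 < x1" "x2 < 0" | "x1 < 0" "0 < x2" using x by linarith
  then show ?thesis
  proof cases
    case 1
    define k where "k = (norm l)\<^sup>2 * (x1 * x2)"
    have "det2 (v - u) (w - v) = k * (m1 - m2)"
      unfolding det k_def using 1 by (simp add: algebra_simps)
    moreover have "0 < k" using n 1 by (simp add: k_def)
    ultimately have "orient (v - u) (w - v) = (if m2 < m1 then 1 else if m1 = m2 then 0 else - 1)"
      unfolding orient_def by (auto simp: zero_less_mult_iff)
    then show ?thesis unfolding wind_def o s m1_def[symmetric] m2_def[symmetric] using 1 by auto
  next
    case 2
    define k where "k = (norm l)\<^sup>2 * (x1 * x2)"
    have "det2 (v - u) (w - v) = k * (m2 - m1)"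
      unfolding det k_def using 2 by (simp add: algebra_simps)
    moreover have "0 < k" using n 2 by (simp add: k_def zero_less_mult_iff)
    ultimately have "orient (v - u) (w - v) = (if m1 < m2 then 1 else if m1 = m2 then 0 else - 1)"
      unfolding orient_def by (auto simp: zero_less_mult_iff)
    then show ?thesis unfolding wind_def o s m1_def[symmetric] m2_def[symmetric] using 2
      by (auto simp: cong_def)
  qed (unfold wind_def o s, auto)
qed

text \<open>Mod 2 the wind terms select the outgoing edges on the same side as the incoming edge and
  below it. Their sum is rewritten by \<open>below_sum\<close>, the vertex indicator by
  \<open>corner_count\<close>; \<open>B\<close> of the incoming edge and \<open>L\<close> of
  \<open>v\<close> then cancel.\<close>

lemma white_vertex_parity:
  assumes v: "v \<in> white G" and C: "C \<in> components M"
  shows "[(\<Sum>e\<in>out_edges v. (A C e + B C e) * (1 + wind l (incoming G v) (snd e - v))) +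
     of_bool (v \<in> closure C) = U C v + sum (A C) (out_edges v)] (mod 2)"
proof -
  have vi: "v \<in> internal G" using v white_internal by blast
  let ?O = "out_edges v"
  have "in_degree G v = 1" using graph v vi unfolding plabic_graph_def perfect_orientation_def by blast
  then obtain u where u: "{u. (u, v) \<in> E} = {u}" unfolding in_degree_def using card_1_singletonE by blast
  then have uE: "(u, v) \<in> E" by blast
  have inc_u: "incoming G v = v - u" unfolding incoming_def using u by (metis (mono_tags, lifting) mem_Collect_eq singletonD singletonI the_equality)
  have iu: "(u, v) \<in> inc v" using uE by (simp add: inc_def)
  have "in_edges v = {(u, v)}" using u by force
  then have inc: "inc v = insert (u, v) ?O" "(u, v) \<notin> ?O" using inc_split[of v] by auto
  let ?H = "{e \<in> inc v. side v e = side v (u, v) \<and> slope v e < slope v (u, v)}"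
  have H: "?H = {e \<in> ?O. side v e = side v (u, v) \<and> slope v e < slope v (u, v)}" using inc by auto
  have fO: "finite ?O" using finite_edges by simp
  have "[(\<Sum>e\<in>?O. (A C e + B C e) * (1 + wind l (incoming G v) (snd e - v))) =
    (\<Sum>e\<in>?O. (A C e + B C e) * (1 + of_bool (side v e = side v (u, v) \<and> slope v e < slope v (u, v))))] (mod 2)"
  proof (intro cong_sum cong_mult cong_add cong_refl)
    fix e assume "e \<in> ?O"
    then obtain w where e: "e = (v, w)" "(v, w) \<in> E" by (cases e) auto
    show "[wind l (incoming G v) (snd e - v) = of_bool (side v e = side v (u, v) \<and> slope v e < slope v (u, v))] (mod 2)"
      using wind_parity[OF uE e(2)] unfolding inc_u e(1) snd_conv
      by (simp only: eq_commute[of "side v (u, v)" "side v (v, w)"])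
  qed
  also have "(\<Sum>e\<in>?O. (A C e + B C e) * (1 + of_bool (side v e = side v (u, v) \<and> slope v e < slope v (u, v)))) =
      (\<Sum>e\<in>?O. A C e + B C e) + (\<Sum>e\<in>?H. A C e + B C e)"
    unfolding H distrib_left mult_1_right sum.distrib[of "\<lambda>e. A C e + B C e"]
    using fO by (simp add: sum.inter_filter[symmetric] if_distrib of_bool_def cong: if_cong)
  finally have c: "[(\<Sum>e\<in>?O. (A C e + B C e) * (1 + wind l (incoming G v) (snd e - v))) + of_bool (v \<in> closure C) =
      (\<Sum>e\<in>?O. A C e + B C e) + (\<Sum>e\<in>?H. A C e + B C e) + of_bool (v \<in> closure C)] (mod 2)"
    by (intro cong_add cong_refl)
  have occ: "of_bool (v \<in> closure C) = (\<Sum>e\<in>?O. B C e) + B C (u, v) + U C v - L C v"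
    using corner_count(1)[OF vi C] inc fO by simp
  have low: "(\<Sum>e\<in>?H. A C e) - (\<Sum>e\<in>?H. B C e) = B C (u, v) - L C v"
    using below_sum[OF vi iu, of C] by (simp add: sum_subtractf)
  have "(\<Sum>e\<in>?O. A C e + B C e) + (\<Sum>e\<in>?H. A C e + B C e) + of_bool (v \<in> closure C) =
      U C v + (\<Sum>e\<in>?O. A C e) + 2 * ((\<Sum>e\<in>?O. B C e) + (\<Sum>e\<in>?H. A C e))"
    unfolding occ using low by (simp add: sum.distrib)
  then have "[(\<Sum>e\<in>?O. A C e + B C e) + (\<Sum>e\<in>?H. A C e + B C e) + of_bool (v \<in> closure C) =
      U C v + (\<Sum>e\<in>?O. A C e)] (mod 2)" by (simp add: cong_iff_dvd_diff)
  with c show ?thesis by (rule cong_trans)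
qed

text \<open>Mod 2 the wind terms select the incoming edges on the same side as the outgoing edge and
  above it, so \<open>above_sum\<close> applies; its \<open>A\<close> term is the sum over the
  single outgoing edge.\<close>

lemma black_vertex_parity:
  assumes v: "v \<in> internal G" "v \<notin> white G" and C: "C \<in> components M"
  shows "[(\<Sum>e\<in>in_edges v. (A C e + B C e) * wind l (v - fst e) (outgoing G v)) =
    U C v + sum (A C) (out_edges v)] (mod 2)"
proof -
  let ?I = "in_edges v"
  have "out_degree G v = 1" using graph v unfolding plabic_graph_def perfect_orientation_def by blast
  then obtain w where w: "{w. (v, w) \<in> E} = {w}" unfolding out_degree_def using card_1_singletonE by blast
  then have wE: "(v, w) \<in> E" by blast
  have out_w: "outgoing G v = w - v" unfolding outgoing_def using w by (metis (mono_tags, lifting) mem_Collect_eq singletonD singletonI the_equality)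
  have iw: "(v, w) \<in> inc v" using wE by (simp add: inc_def)
  have O: "out_edges v = {(v, w)}" using w by force
  then have inc: "inc v = insert (v, w) ?I" "(v, w) \<notin> ?I" using inc_split[of v] by auto
  let ?H = "{e \<in> inc v. side v e = side v (v, w) \<and> slope v (v, w) < slope v e}"
  have H: "?H = {e \<in> ?I. side v e = side v (v, w) \<and> slope v (v, w) < slope v e}" using inc by auto
  have fI: "finite ?I" using finite_edges by simp
  have "[(\<Sum>e\<in>?I. (A C e + B C e) * wind l (v - fst e) (outgoing G v)) =
    (\<Sum>e\<in>?I. (A C e + B C e) * of_bool (side v e = side v (v, w) \<and> slope v (v, w) < slope v e))] (mod 2)"
  proof (intro cong_sum cong_mult cong_refl)
    fix e assume "e \<in> ?I"
    then obtain u where e: "e = (u, v)" "(u, v) \<in> E" by (cases e) auto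
    show "[wind l (v - fst e) (outgoing G v) = of_bool (side v e = side v (v, w) \<and> slope v (v, w) < slope v e)] (mod 2)"
      using wind_parity[OF e(2) wE] unfolding out_w e(1) fst_conv .
  qed
  also have "(\<Sum>e\<in>?I. (A C e + B C e) * of_bool (side v e = side v (v, w) \<and> slope v (v, w) < slope v e)) =
      (\<Sum>e\<in>?H. A C e + B C e)"
    unfolding H using fI by (simp add: sum.inter_filter[symmetric] if_distrib of_bool_def cong: if_cong)
  also have "\<dots> = U C v + sum (A C) (out_edges v) + 2 * ((\<Sum>e\<in>?H. B C e) - A C (v, w))"
    using above_sum[OF v(1) iw, of C] unfolding O by (simp add: sum.distrib sum_subtractf)
  also have "[\<dots> = U C v + sum (A C) (out_edges v)] (mod 2)" by (simp add: cong_iff_dvd_diff)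
  finally show ?thesis .
qed

end

subsection \<open>Rays of the sources\<close>

lemma circle_point_eq_iff:
  assumes "0 < r"
  shows "c + of_real r * cis a = c + of_real r * cis b \<longleftrightarrow> (\<exists>n::int. a = b + 2 * pi * n)"
proof -
  have "c + of_real r * cis a = c + of_real r * cis b \<longleftrightarrow> cis a = cis b" using assms by simp
  also have "\<dots> \<longleftrightarrow> sin a = sin b \<and> cos a = cos b" by (auto simp: complex_eq_iff)
  finally show ?thesis using sin_cos_eq_iff[of a b] by simp
qed

context gauged_graph
begin

text \<open>Open segments suffice since the rays pass through no vertex, by
  \<open>ray_vertices\<close>.\<close>

definition hits :: "complex \<Rightarrow> (complex \<times> complex) set" where
  "hits b = {e \<in> E. oseg e \<inter> ray b l \<noteq> {}}"

definition param :: "complex \<Rightarrow> complex \<times> complex \<Rightarrow> real" where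
  "param b e = (SOME t. 0 < t \<and> b + of_real t * l \<in> oseg e)"

lemma param:
  assumes "e \<in> hits b"
  shows "0 < param b e" "b + of_real (param b e) * l \<in> oseg e"
proof -
  have "\<exists>t. 0 < t \<and> b + of_real t * l \<in> oseg e" using assms by (auto simp: hits_def ray_def)
  from someI_ex[OF this, folded param_def] show "0 < param b e" "b + of_real (param b e) * l \<in> oseg e" by auto
qed

lemma hits_edge: "e \<in> hits b \<Longrightarrow> e \<in> E" by (simp add: hits_def)

text \<open>\<open>b\<close> lies on the upper half circle; \<open>2 * Y (b - c)\<close> is the
  length of the vertical chord from \<open>b\<close> in units of \<open>l\<close>.\<close>

lemma ray_ball:
  assumes "b \<in> boundary G"
  shows "b + of_real t * l \<in> ball c r \<longleftrightarrow> 0 < t \<and> t < 2 * Y (b - c)"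
    and "b + of_real t * l \<in> cball c r \<longleftrightarrow> 0 \<le> t \<and> t \<le> 2 * Y (b - c)"
proof -
  have b: "b \<in> sphere c r" using assms boundary_sphere by blast
  have e: "b + of_real t * l = b - of_real (- t) * l" by simp
  show "b + of_real t * l \<in> ball c r \<longleftrightarrow> 0 < t \<and> t < 2 * Y (b - c)"
    unfolding e sphere_vertical(1)[OF b] using boundary_Y[OF assms] by (auto simp: mult_less_0_iff zero_less_mult_iff)
  show "b + of_real t * l \<in> cball c r \<longleftrightarrow> 0 \<le> t \<and> t \<le> 2 * Y (b - c)"
    unfolding e sphere_vertical(2)[OF b] using boundary_Y[OF assms] by (auto simp: mult_le_0_iff zero_le_mult_iff)
qed

text \<open>The ray leaves the disc through the lower half circle, whereas all boundary vertices are
  on the upper one.\<close>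

lemma ray_boundary:
  assumes "b \<in> boundary G" "b' \<in> boundary G" shows "b' \<notin> ray b l"
proof
  assume "b' \<in> ray b l"
  then obtain t where t: "0 < t" "b' = b + of_real t * l" by (auto simp: ray_def)
  have "b' \<in> sphere c r" using assms(2) boundary_sphere by blast
  then have "b' \<in> cball c r" "b' \<notin> ball c r" by auto
  then have "t = 2 * Y (b - c)" using ray_ball[OF assms(1), of t] t by auto
  moreover have "Y (b' - c) = Y (b - c) - t" unfolding t(2) by simp
  ultimately show False using boundary_Y[OF assms(1)] boundary_Y[OF assms(2)] by linarith
qed

lemma ray_vertices: "b \<in> boundary G \<Longrightarrow> ray b l \<inter> vertices G = {}"
  using ray_boundary gauge_internal by (auto simp: vertices_def)

lemma ray_cseg:
  assumes "b \<in> boundary G" "e \<in> E" shows "cseg e \<inter> ray b l = oseg e \<inter> ray b l"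
  using ray_vertices[OF assms(1)] edge_vertices[of "fst e" "snd e"] assms(2) by (auto simp: cseg_eq)

lemma param_unique:
  assumes "e \<in> E" "0 < t" "b + of_real t * l \<in> oseg e"
  shows "e \<in> hits b" "param b e = t"
proof -
  show h: "e \<in> hits b" using assms by (auto simp: hits_def ray_def)
  have "b + of_real t * l = b + of_real (param b e) * l"
    by (rule vertical_meets_oseg_once[OF assms(1,3) param(2)[OF h]]) simp
  then show "param b e = t" using l_nz by simp
qed

lemma param_less:
  assumes "b \<in> boundary G" "e \<in> hits b" shows "param b e < 2 * Y (b - c)"
  using param(2)[OF assms(2)] oseg_ball[OF hits_edge[OF assms(2)]] ray_ball(1)[OF assms(1)] by blast

lemma oseg_ray_subset:
  assumes "e \<in> E" shows "oseg e \<inter> ray b l \<subseteq> {b + of_real (param b e) * l}"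
proof
  fix z assume z: "z \<in> oseg e \<inter> ray b l"
  then obtain t where t: "0 < t" "z = b + of_real t * l" by (auto simp: ray_def)
  then have "param b e = t" using param_unique(2)[OF assms t(1)] z by blast
  then show "z \<in> {b + of_real (param b e) * l}" using t(2) by simp
qed

lemma card_cseg_ray:
  assumes "b \<in> boundary G" "e \<in> E" shows "card (cseg e \<inter> ray b l) = of_bool (e \<in> hits b)"
proof (cases "e \<in> hits b")
  case True
  have "oseg e \<inter> ray b l = {b + of_real (param b e) * l}"
    using oseg_ray_subset[OF assms(2), of b] param[OF True] unfolding ray_def by blast
  then show ?thesis using True ray_cseg[OF assms] by simp
next
  case False
  then show ?thesis using ray_cseg[OF assms] assms(2) by (simp add: hits_def)
qed

lemma inj_on_param: "inj_on (param b) (hits b)"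
proof (rule inj_onI)
  fix e e' assume h: "e \<in> hits b" "e' \<in> hits b" "param b e = param b e'"
  then have "b + of_real (param b e) * l \<in> oseg e \<inter> oseg e'" using param(2)[of e b] param(2)[of e' b] by simp
  then show "e = e'" using oseg_disjoint[of e e'] h hits_edge by blast
qed

text \<open>Between consecutive crossings the ray is a connected subset of \<open>M\<close>.\<close>

lemma ray_gap:
  assumes b: "b \<in> boundary G" and st: "0 \<le> s" "s < t" "t \<le> 2 * Y (b - c)"
    and gap: "\<And>e. e \<in> hits b \<Longrightarrow> param b e \<le> s \<or> t \<le> param b e"
  obtains C where "C \<in> components M" "\<And>x. s < x \<Longrightarrow> x < t \<Longrightarrow> b + of_real x * l \<in> C"
proof -
  let ?S = "(\<lambda>x. b + of_real x * l) ` {s<..<t}"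
  have "?S \<subseteq> M"
  proof
    fix z assume "z \<in> ?S"
    then obtain x where x: "s < x" "x < t" "z = b + of_real x * l" by auto
    have "z \<in> ball c r" using ray_ball(1)[OF b, of x] x st by simp
    moreover have "z \<notin> D"
    proof
      assume "z \<in> D"
      moreover have "z \<in> ray b l" using x st by (auto simp: ray_def)
      ultimately obtain e where e: "e \<in> E" "z \<in> oseg e" using ray_vertices[OF b] by (auto simp: drawing_eq)
      then show False using param_unique[of e x b] gap[of e] x st by auto
    qed
    ultimately show "z \<in> M" by (simp add: M_def)
  qed
  moreover have "connected ?S" by (intro connected_continuous_image continuous_intros) (simp add: convex_connected)
  moreover have "?S \<noteq> {}" using st by simp
  ultimately have "\<exists>C. C \<in> components M \<and> ?S \<subseteq> C"
    by (intro exists_component_superset) (blast dest: subset_empty[THEN iffD1])+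
  then obtain C where C: "C \<in> components M" "?S \<subseteq> C" by blast
  have "b + of_real x * l \<in> C" if "s < x" "x < t" for x
    using C(2) that by (auto simp: image_subset_iff)
  then show thesis using that C(1) by blast
qed

lemma ray_gap_end:
  assumes "C \<in> components M" "s < t" "\<And>x. s < x \<Longrightarrow> x < t \<Longrightarrow> b + of_real x * l \<in> C" "C' \<in> components M"
  shows "(\<forall>\<^sub>F x in at_right 0. b + of_real s * l + of_real x * l \<in> C') \<Longrightarrow> C' = C"
    and "(\<forall>\<^sub>F x in at_right 0. b + of_real t * l - of_real x * l \<in> C') \<Longrightarrow> C' = C"
proof -
  have ts: "\<forall>\<^sub>F x in at_right 0. 0 < x \<and> x < t - s"
    unfolding eventually_at_right_field using assms(2) by (intro exI[of _ "t - s"]) auto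
  {
    assume "\<forall>\<^sub>F x in at_right 0. b + of_real s * l + of_real x * l \<in> C'"
    with ts have "\<forall>\<^sub>F x in at_right 0. b + of_real s * l + of_real x * l \<in> C' \<and> 0 < x \<and> x < t - s"
      by eventually_elim auto
    then obtain x where x: "b + of_real s * l + of_real x * l \<in> C'" "0 < x" "x < t - s"
      using eventually_happens' trivial_limit_at_right_real by blast
    have "b + of_real (s + x) * l \<in> C" using assms(3)[of "s + x"] x by auto
    then show "C' = C" using face_eqI[OF assms(4,1)] x(1) by (simp add: algebra_simps)
  }
  {
    assume "\<forall>\<^sub>F x in at_right 0. b + of_real t * l - of_real x * l \<in> C'"
    with ts have "\<forall>\<^sub>F x in at_right 0. b + of_real t * l - of_real x * l \<in> C' \<and> 0 < x \<and> x < t - s"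
      by eventually_elim auto
    then obtain x where x: "b + of_real t * l - of_real x * l \<in> C'" "0 < x" "x < t - s"
      using eventually_happens' trivial_limit_at_right_real by blast
    have "b + of_real (t - x) * l \<in> C" using assms(3)[of "t - x"] x by auto
    then show "C' = C" using face_eqI[OF assms(4,1)] x(1) by (simp add: algebra_simps)
  }
qed

text \<open>After its last crossing the ray has no drawing below it, so it is in the exit
  region.\<close>

lemma ray_exit:
  assumes b: "b \<in> boundary G" and s: "0 \<le> s" "s < 2 * Y (b - c)"
    and gap: "\<And>e. e \<in> hits b \<Longrightarrow> param b e \<le> s"
    and C: "C \<in> components M" "\<And>x. s < x \<Longrightarrow> x < 2 * Y (b - c) \<Longrightarrow> b + of_real x * l \<in> C"
  shows "C = outer"
proof -
  define x where "x = (s + 2 * Y (b - c)) / 2"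
  have x: "s < x" "x < 2 * Y (b - c)" using s by (auto simp: x_def field_simps simp del: XY_linear)
  let ?p = "b + of_real x * l"
  have "?p + of_real t * l \<notin> D" if "0 \<le> t" for t
  proof
    have e: "?p + of_real t * l = b + of_real (x + t) * l" by (simp add: algebra_simps)
    assume "?p + of_real t * l \<in> D"
    moreover have "?p + of_real t * l \<in> ray b l" unfolding e ray_def using x s that by (intro CollectI exI[of _ "x + t"]) auto
    ultimately obtain e' where "e' \<in> E" "?p + of_real t * l \<in> oseg e'" using ray_vertices[OF b] by (auto simp: drawing_eq)
    then show False using param_unique[of e' "x + t" b] gap[of e'] x s that unfolding e by auto
  qed
  moreover have "?p \<in> ball c r" using ray_ball(1)[OF b, of x] x s by simp
  ultimately have "?p \<in> outer" using exit_region_outer by (auto simp: exit_region_def)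
  then show ?thesis using face_eqI[OF C(1) outer_face] C(2)[OF x] by blast
qed

lemma boundary_germ:
  assumes "b \<in> boundary G"
  shows "vface (- 1) b \<in> components M" "\<forall>\<^sub>F x in at_right 0. b + of_real 0 * l + of_real x * l \<in> vface (- 1) b"
  using vface_germ[of b "- 1"] assms by (auto simp: eventually_conj_iff)

text \<open>The faces met along a ray change exactly at the edges it crosses.\<close>

lemma ray_sum:
  assumes b: "b \<in> boundary G"
  shows "(\<Sum>e\<in>hits b. B C e - A C e) = of_bool (outer = C) - L C b"
\<comment> \<open>Going down, the face above a crossed edge comes first and the one below it next,
  the reverse of the order at a vertex.\<close>
proof (rule telescoping_sum[where key = "param b"])
  note Yb = boundary_Y[OF b]
  show "finite (hits b)" using finite_edges by (simp add: hits_def)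
  show "inj_on (param b) (hits b)" by (rule inj_on_param)
  have belowg: "\<forall>\<^sub>F x in at_right 0. b + of_real (param b h) * l + of_real x * l \<in> below h" if "h \<in> hits b" for h
    using below_germ[OF hits_edge[OF that] param(2)[OF that]] .
  have aboveg: "\<forall>\<^sub>F x in at_right 0. b + of_real (param b h) * l - of_real x * l \<in> above h" if "h \<in> hits b" for h
    using above_germ[OF hits_edge[OF that] param(2)[OF that]] .
  show "A C h = L C b" if h: "h \<in> hits b" and first: "\<forall>h'\<in>hits b. param b h \<le> param b h'" for h
  proof -
    obtain C' where C': "C' \<in> components M" "\<And>x. 0 < x \<Longrightarrow> x < param b h \<Longrightarrow> b + of_real x * l \<in> C'"
      by (rule ray_gap[OF b, of 0 "param b h"]) (use param[OF h] param_less[OF b h] first in auto)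
    have "above h = C'"
      by (rule ray_gap_end(2)[OF C'(1) param(1)[OF h] C'(2) above_face[OF hits_edge[OF h]] aboveg[OF h]])
    moreover have "vface (- 1) b = C'"
      by (rule ray_gap_end(1)[OF C'(1) param(1)[OF h] C'(2) boundary_germ[OF b]])
    ultimately show ?thesis by (simp add: A_def L_def)
  qed
  show "B C h = A C h'" if h: "h \<in> hits b" "h' \<in> hits b" "param b h < param b h'"
    and between: "\<forall>h''\<in>hits b. param b h'' \<le> param b h \<or> param b h' \<le> param b h''" for h h'
  proof -
    obtain C' where C': "C' \<in> components M" "\<And>x. param b h < x \<Longrightarrow> x < param b h' \<Longrightarrow> b + of_real x * l \<in> C'"
      by (rule ray_gap[OF b, of "param b h" "param b h'"])
        (use param(1)[OF h(1)] param_less[OF b h(2)] h(3) between in auto)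
    have "above h' = C'"
      by (rule ray_gap_end(2)[OF C'(1) h(3) C'(2) above_face[OF hits_edge[OF h(2)]] aboveg[OF h(2)]])
    moreover have "below h = C'"
      by (rule ray_gap_end(1)[OF C'(1) h(3) C'(2) below_face[OF hits_edge[OF h(1)]] belowg[OF h(1)]])
    ultimately show ?thesis by (simp add: A_def B_def)
  qed
  show "B C h = of_bool (outer = C)" if h: "h \<in> hits b" and last: "\<forall>h'\<in>hits b. param b h' \<le> param b h" for h
  proof -
    note lt = param_less[OF b h]
    obtain C' where C': "C' \<in> components M" "\<And>x. param b h < x \<Longrightarrow> x < 2 * Y (b - c) \<Longrightarrow> b + of_real x * l \<in> C'"
      by (rule ray_gap[OF b, of "param b h" "2 * Y (b - c)"]) (use param(1)[OF h] lt last in auto)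
    have "below h = C'"
      by (rule ray_gap_end(1)[OF C'(1) lt C'(2) below_face[OF hits_edge[OF h]] belowg[OF h]])
    moreover have "C' = outer"
      by (rule ray_exit[OF b _ lt _ C']) (use param(1)[OF h] last in auto)
    ultimately show ?thesis by (simp add: B_def)
  qed
  show "L C b = of_bool (outer = C)" if none: "hits b = {}"
  proof -
    have lt: "0 < 2 * Y (b - c)" using Yb by linarith
    obtain C' where C': "C' \<in> components M" "\<And>x. 0 < x \<Longrightarrow> x < 2 * Y (b - c) \<Longrightarrow> b + of_real x * l \<in> C'"
      by (rule ray_gap[OF b, of 0 "2 * Y (b - c)"]) (use lt none in auto)
    have "vface (- 1) b = C'"
      by (rule ray_gap_end(1)[OF C'(1) lt C'(2) boundary_germ[OF b]])
    moreover have "C' = outer" by (rule ray_exit[OF b _ lt _ C']) (use none in auto)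
    ultimately show ?thesis by (simp add: L_def)
  qed
qed

section \<open>Sources and intersection numbers\<close>

lemma common_arc:
  obtains \<theta> :: "nat \<Rightarrow> real" where
    "\<And>i. i \<in> {1..bnum G} \<Longrightarrow> bvert G i = c + of_real r * cis (\<theta> i)"
    "\<And>i j. i \<in> {1..bnum G} \<Longrightarrow> j \<in> {1..bnum G} \<Longrightarrow> i < j \<Longrightarrow> \<theta> j < \<theta> i"
    "\<theta> 1 - \<theta> (bnum G) < pi"
proof -
  have "boundary_on_common_arc G" using graph unfolding plabic_graph_def by blast
  then obtain \<theta> :: "nat \<Rightarrow> real" where
    "(\<forall>i\<in>{1..bnum G}. bvert G i = c + of_real r * cis (\<theta> i)) \<and>
     (\<forall>i\<in>{1..bnum G}. \<forall>j\<in>{1..bnum G}. i < j \<longrightarrow> \<theta> j < \<theta> i) \<and> \<theta> 1 - \<theta> (bnum G) < pi"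
    unfolding boundary_on_common_arc_def by (elim exE)
  then show thesis using that[of \<theta>] by simp
qed

lemma int_multiple_2pi_small:
  assumes "a = b + 2 * pi * real_of_int n" "\<bar>a - b\<bar> < 2 * pi"
  shows "n = 0"
proof -
  have "2 * pi * \<bar>real_of_int n\<bar> < 2 * pi * 1" using assms by (simp add: abs_mult)
  then have "\<bar>real_of_int n\<bar> < 1" using pi_gt_zero by (simp only: mult_less_cancel_left_pos[of "2 * pi"] mult_pos_pos zero_less_numeral)
  then show ?thesis by simp
qed

lemma inj_on_bvert: "inj_on (bvert G) {1..bnum G}"
proof -
  obtain \<theta> :: "nat \<Rightarrow> real" where
    1: "\<And>i. i \<in> {1..bnum G} \<Longrightarrow> bvert G i = c + of_real r * cis (\<theta> i)" and
    2: "\<And>i j. i \<in> {1..bnum G} \<Longrightarrow> j \<in> {1..bnum G} \<Longrightarrow> i < j \<Longrightarrow> \<theta> j < \<theta> i" and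
    3: "\<theta> 1 - \<theta> (bnum G) < pi" using common_arc by metis
  have bd: "\<theta> (bnum G) \<le> \<theta> i \<and> \<theta> i \<le> \<theta> 1" if "i \<in> {1..bnum G}" for i
    using 2[of 1 i] 2[of i "bnum G"] that by (cases "i = 1"; cases "i = bnum G") (auto simp: less_imp_le)
  have "bvert G i \<noteq> bvert G j" if ij: "i \<in> {1..bnum G}" "j \<in> {1..bnum G}" "i < j" for i j
  proof
    assume "bvert G i = bvert G j"
    then obtain n :: int where n: "\<theta> i = \<theta> j + 2 * pi * n" using 1 ij circle_point_eq_iff[OF r_pos] by metis
    moreover have "\<bar>\<theta> i - \<theta> j\<bar> < 2 * pi" using bd[OF ij(1)] bd[OF ij(2)] 3 pi_gt_zero by linarith
    ultimately have "n = 0" by (rule int_multiple_2pi_small)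
    then show False using n 2[OF ij] by simp
  qed
  then show ?thesis by (metis inj_onI linorder_neqE_nat)
qed

abbreviation sources :: "complex set" where "sources \<equiv> bvert G ` source_indices G"

lemma sources_boundary: "sources \<subseteq> boundary G" and finite_sources: "finite sources"
  and card_sources: "card sources = card (source_indices G)"
proof -
  show "sources \<subseteq> boundary G" "finite sources" by (auto simp: source_indices_def boundary_def)
  show "card sources = card (source_indices G)"
    by (intro card_image inj_on_subset[OF inj_on_bvert]) (auto simp: source_indices_def)
qed

text \<open>The rays of two sources are disjoint, as otherwise one would contain the starting point
  of the other; each meets an edge at most once, and the sign \<open>orient l (v - u)\<close> is
  odd.\<close>

lemma intersection_number_parity:
  assumes "e \<in> E"
  shows "[intersection_number G l e = (\<Sum>b\<in>sources. of_bool (e \<in> hits b))] (mod 2)"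
proof -
  obtain u v where uv: "e = (u, v)" by fastforce
  have dis: "(cseg e \<inter> ray b l) \<inter> (cseg e \<inter> ray b' l) = {}" if b: "b \<in> sources" "b' \<in> sources" "b \<noteq> b'" for b b'
  proof -
    have bb: "b \<in> boundary G" "b' \<in> boundary G" using b sources_boundary by blast+
    have False if zz: "z \<in> ray b l" "z \<in> ray b' l" for z
    proof -
      obtain t t' where t: "z = b + of_real t * l" "z = b' + of_real t' * l" using zz unfolding ray_def by blast
      then have "b' = b + of_real (t - t') * l" "b = b' + of_real (t' - t) * l" by (auto simp: algebra_simps)
      then show False using ray_boundary[OF bb] ray_boundary[OF bb(2,1)] b(3)
        unfolding ray_def by (cases t t' rule: linorder_cases) (auto simp del: of_real_diff)
    qed
    then show ?thesis by blast
  qed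
  have "closed_segment u v \<inter> (\<Union>i\<in>source_indices G. ray (bvert G i) l) = (\<Union>b\<in>sources. cseg e \<inter> ray b l)"
    by (auto simp: cseg_def uv)
  moreover have "card (\<Union>b\<in>sources. cseg e \<inter> ray b l) = (\<Sum>b\<in>sources. card (cseg e \<inter> ray b l))"
  proof (rule card_UN_disjoint)
    show "\<forall>b\<in>sources. finite (cseg e \<inter> ray b l)"
    proof
      fix b assume "b \<in> sources"
      then have "b \<in> boundary G" using sources_boundary by blast
      then show "finite (cseg e \<inter> ray b l)"
        using oseg_ray_subset[OF assms, of b] by (simp add: ray_cseg[OF _ assms] finite_subset)
    qed
  qed (use finite_sources dis in auto)
  moreover have "(\<Sum>b\<in>sources. card (cseg e \<inter> ray b l)) = (\<Sum>b\<in>sources. of_bool (e \<in> hits b))"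
    using card_cseg_ray[OF _ assms] sources_boundary by (intro sum.cong) auto
  ultimately have "int (card (closed_segment u v \<inter> (\<Union>i\<in>source_indices G. ray (bvert G i) l))) =
      (\<Sum>b\<in>sources. of_bool (e \<in> hits b))" by (simp only: of_nat_sum of_nat_of_bool)
  moreover have "[x * orient l (v - u) = x] (mod 2)" for x
  proof -
    have "det2 l (v - u) \<noteq> 0" using gauge_det[of u v] assms uv det2_commute[of l "v - u"] by simp
    then have "orient l (v - u) = 1 \<or> orient l (v - u) = - 1" by (auto simp: orient_def)
    then show ?thesis by (auto simp: cong_iff_dvd_diff)
  qed
  ultimately show ?thesis by (simp add: intersection_number_def uv)
qed

text \<open>After exchanging the sums, each source contributes the telescoping sum along its ray,
  whose signs vanish mod 2.\<close>

lemma intersection_sum: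
  assumes C: "C \<in> components M"
  shows "[(\<Sum>e\<in>E. (A C e + B C e) * intersection_number G l e) =
     (\<Sum>b\<in>sources. of_bool (outer = C) + L C b)] (mod 2)"
proof -
  have "[(\<Sum>e\<in>E. (A C e + B C e) * intersection_number G l e) =
     (\<Sum>e\<in>E. (A C e + B C e) * (\<Sum>b\<in>sources. of_bool (e \<in> hits b)))] (mod 2)"
    by (intro cong_sum cong_mult cong_refl intersection_number_parity)
  also have "(\<Sum>e\<in>E. (A C e + B C e) * (\<Sum>b\<in>sources. of_bool (e \<in> hits b))) =
     (\<Sum>b\<in>sources. \<Sum>e\<in>E. (A C e + B C e) * of_bool (e \<in> hits b))"
    unfolding sum_distrib_left by (rule sum.swap)
  also have "\<dots> = (\<Sum>b\<in>sources. \<Sum>e\<in>hits b. A C e + B C e)"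
  proof (rule sum.cong[OF refl])
    fix b
    have "E \<inter> {e. e \<in> hits b} = hits b" by (auto simp: hits_def)
    then show "(\<Sum>e\<in>E. (A C e + B C e) * of_bool (e \<in> hits b)) = (\<Sum>e\<in>hits b. A C e + B C e)"
      using finite_edges by simp
  qed
  also have "[\<dots> = (\<Sum>b\<in>sources. of_bool (outer = C) + L C b)] (mod 2)"
  proof (rule cong_sum)
    fix b assume "b \<in> sources"
    then have b: "b \<in> boundary G" using sources_boundary by blast
    have "(\<Sum>e\<in>hits b. A C e + B C e) = of_bool (outer = C) + L C b + 2 * ((\<Sum>e\<in>hits b. A C e) - L C b)"
      using ray_sum[OF b, of C] by (simp add: sum.distrib sum_subtractf)
    then show "[(\<Sum>e\<in>hits b. A C e + B C e) = of_bool (outer = C) + L C b] (mod 2)"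
      by (simp add: cong_iff_dvd_diff)
  qed
  finally show ?thesis .
qed

text \<open>A boundary vertex has degree one, so its edge is the lowest on its side, and the ray of
  a source starts in the face below its edge.\<close>

lemma boundary_edge_face:
  assumes "e \<in> E" "fst e \<in> boundary G"
  shows "L C (fst e) = B C e" "\<And>e'. e' \<in> E \<Longrightarrow> fst e' = fst e \<Longrightarrow> e' = e"
proof -
  have "card (inc (fst e)) = 1" using boundary_degree[OF assms(2)] card_inc by simp
  moreover have "e \<in> inc (fst e)" using assms by (simp add: inc_def)
  ultimately have inc: "inc (fst e) = {e}" by (metis card_1_singletonE singletonD)
  have "eface (- 1) e = vface (- 1) (fst e)"
    by (rule outermost_edge_face) (use assms inc in auto)
  then show "L C (fst e) = B C e" by (simp add: L_def B_def)
  show "e' = e" if "e' \<in> E" "fst e' = fst e" for e'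
  proof -
    have "e' \<in> inc (fst e)" using that by (simp add: inc_def)
    then show ?thesis using inc by blast
  qed
qed

lemma sum_sources: "(\<Sum>b\<in>sources. L C b) = (\<Sum>e\<in>{e \<in> E. fst e \<in> boundary G}. B C e)"
proof -
  let ?S = "{e \<in> E. fst e \<in> boundary G}"
  have img: "sources = fst ` ?S"
  proof (intro equalityI subsetI)
    fix b assume "b \<in> sources"
    then show "b \<in> fst ` ?S" by (force simp: source_indices_def boundary_def)
  next
    fix b assume "b \<in> fst ` ?S"
    then obtain w where "(b, w) \<in> E" "b \<in> boundary G" by force
    then show "b \<in> sources" by (auto simp: source_indices_def boundary_def)
  qed
  have "inj_on fst ?S" using boundary_edge_face(2) by (auto intro!: inj_onI)
  then have "(\<Sum>b\<in>sources. L C b) = (\<Sum>e\<in>?S. L C (fst e))" unfolding img by (simp add: sum.reindex)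
  also have "\<dots> = (\<Sum>e\<in>?S. B C e)" using boundary_edge_face(1) by (intro sum.cong) auto
  finally show ?thesis .
qed

text \<open>The cases of the definition decouple into a term for a tail on the boundary, one for a
  white tail and one for a black head. This makes the signature sum local at the vertices.\<close>

lemma basic_signature_eq:
  assumes "e \<in> E"
  shows "basic_signature G l e = intersection_number G l e + of_bool (fst e \<in> boundary G) +
    of_bool (fst e \<in> white G) * (1 + wind l (incoming G (fst e)) (snd e - fst e)) +
    of_bool (snd e \<in> internal G - white G) * wind l (snd e - fst e) (outgoing G (snd e))"
proof -
  obtain u v where uv: "e = (u, v)" by fastforce
  have "u \<in> vertices G" "v \<in> vertices G" "u \<in> internal G \<or> v \<in> internal G"
    using edge_vertices[of u v] edge_not_boundary[of u v] assms uv by auto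
  then show ?thesis
    using boundary_internal white_internal
    by (cases "u \<in> boundary G"; cases "v \<in> boundary G")
      (auto simp: basic_signature_def uv Let_def vertices_def)
qed

lemma sum_by_endpoint:
  fixes f :: "complex \<times> complex \<Rightarrow> int"
  assumes "finite S"
  shows "(\<Sum>e\<in>E. f e * of_bool (g e \<in> S)) = (\<Sum>v\<in>S. \<Sum>e\<in>{e \<in> E. g e = v}. f e)"
proof -
  let ?T = "{e \<in> E. g e \<in> S}"
  have "(\<Sum>e\<in>E. f e * of_bool (g e \<in> S)) = sum f (E \<inter> {e. g e \<in> S})"
    using finite_edges by simp
  also have "E \<inter> {e. g e \<in> S} = ?T" by blast
  also have "sum f ?T = (\<Sum>v\<in>S. \<Sum>e\<in>{e \<in> ?T. g e = v}. f e)"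
    by (rule sum.group[symmetric]) (use finite_edges assms in auto)
  also have "\<dots> = (\<Sum>v\<in>S. \<Sum>e\<in>{e \<in> E. g e = v}. f e)" by (intro sum.cong) auto
  finally show ?thesis .
qed

theorem basic_signature_parity:
  assumes C: "C \<in> components M"
  shows "[(\<Sum>e\<in>E. (A C e + B C e) * basic_signature G l e) + (\<Sum>v\<in>white G. of_bool (v \<in> closure C)) =
    (if C = outer then int (card (source_indices G)) else 1)] (mod 2)"
proof -
  let ?W = "white G" and ?K = "internal G - white G"
  have fin: "finite ?W" "finite ?K" using finite_internal white_internal finite_subset by auto
  let ?f = "\<lambda>e. A C e + B C e"
  let ?wU = "\<lambda>e. wind l (incoming G (fst e)) (snd e - fst e)"
  let ?wV = "\<lambda>e. wind l (snd e - fst e) (outgoing G (snd e))"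
  let ?S = "{e \<in> E. fst e \<in> boundary G}"
  let ?k = "int (card (source_indices G))" and ?o = "of_bool (outer = C) :: int"
  let ?c = "\<Sum>v\<in>?W. of_bool (v \<in> closure C) :: int"
  have W: "(\<Sum>e\<in>E. (?f e * (1 + ?wU e)) * of_bool (fst e \<in> ?W)) =
      (\<Sum>v\<in>?W. \<Sum>e\<in>out_edges v. ?f e * (1 + wind l (incoming G v) (snd e - v)))"
    unfolding sum_by_endpoint[OF fin(1)] by (intro sum.cong) auto
  have K: "(\<Sum>e\<in>E. (?f e * ?wV e) * of_bool (snd e \<in> ?K)) =
      (\<Sum>v\<in>?K. \<Sum>e\<in>in_edges v. ?f e * wind l (v - fst e) (outgoing G v))"
    unfolding sum_by_endpoint[OF fin(2)] by (intro sum.cong) auto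
  have I: "(\<Sum>v\<in>?W. U C v + sum (A C) (out_edges v)) + (\<Sum>v\<in>?K. U C v + sum (A C) (out_edges v))
      = (\<Sum>v\<in>internal G. U C v) + (\<Sum>e\<in>E. A C e * of_bool (fst e \<in> internal G))"
  proof -
    have "(\<Sum>v\<in>?W. U C v + sum (A C) (out_edges v)) + (\<Sum>v\<in>?K. U C v + sum (A C) (out_edges v))
      = (\<Sum>v\<in>internal G. U C v + sum (A C) (out_edges v))"
      by (subst sum.subset_diff[OF white_internal finite_internal]) (rule add.commute)
    then show ?thesis unfolding sum_by_endpoint[OF finite_internal] by (simp add: sum.distrib)
  qed
  have S: "(\<Sum>e\<in>E. g e * of_bool (fst e \<in> boundary G)) = (\<Sum>e\<in>?S. g e)" for g :: "complex \<times> complex \<Rightarrow> int"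
  proof -
    have "E \<inter> {e. fst e \<in> boundary G} = ?S" by blast
    then show ?thesis using finite_edges by simp
  qed
  have AE: "(\<Sum>e\<in>?S. A C e) + (\<Sum>e\<in>E. A C e * of_bool (fst e \<in> internal G)) = (\<Sum>e\<in>E. A C e)"
  proof -
    have "A C e = A C e * of_bool (fst e \<in> boundary G) + A C e * of_bool (fst e \<in> internal G)" if "e \<in> E" for e
      using edge_vertices[of "fst e" "snd e"] boundary_internal that by (auto simp: vertices_def)
    then have "(\<Sum>e\<in>E. A C e) = (\<Sum>e\<in>E. A C e * of_bool (fst e \<in> boundary G) + A C e * of_bool (fst e \<in> internal G))"
      by (rule sum.cong[OF refl])
    then show ?thesis unfolding sum.distrib S by simp
  qed
  have euler: "(\<Sum>e\<in>E. A C e) + ?o = (\<Sum>v\<in>internal G. U C v) + 1"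
  proof -
    have "(\<Sum>e\<in>E. A C e) = int (card {e \<in> E. above e = C})"
      using finite_edges by (simp add: A_def Int_def)
    moreover have "(\<Sum>v\<in>internal G. U C v) = int (card {v \<in> internal G. vface 1 v = C})"
      using finite_internal by (simp add: U_def Int_def)
    ultimately show ?thesis using face_euler[OF C] by (auto simp: of_bool_def split: if_splits)
  qed
  have "(\<Sum>e\<in>E. ?f e * basic_signature G l e) =
     (\<Sum>e\<in>E. ?f e * intersection_number G l e + ?f e * of_bool (fst e \<in> boundary G) +
       (?f e * (1 + ?wU e)) * of_bool (fst e \<in> ?W) + (?f e * ?wV e) * of_bool (snd e \<in> ?K))"
    by (intro sum.cong refl) (simp only: basic_signature_eq, simp only: algebra_simps)
  also have "\<dots> = (\<Sum>e\<in>E. ?f e * intersection_number G l e) + (\<Sum>e\<in>?S. ?f e) +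
      (\<Sum>v\<in>?W. \<Sum>e\<in>out_edges v. ?f e * (1 + wind l (incoming G v) (snd e - v))) +
      (\<Sum>v\<in>?K. \<Sum>e\<in>in_edges v. ?f e * wind l (v - fst e) (outgoing G v))"
    unfolding sum.distrib[of _ _ E] W K S by (simp only:)
  finally have expand: "(\<Sum>e\<in>E. ?f e * basic_signature G l e) + ?c =
      (\<Sum>e\<in>E. ?f e * intersection_number G l e) + (\<Sum>e\<in>?S. ?f e) +
      (\<Sum>v\<in>?W. (\<Sum>e\<in>out_edges v. ?f e * (1 + wind l (incoming G v) (snd e - v))) + of_bool (v \<in> closure C)) +
      (\<Sum>v\<in>?K. \<Sum>e\<in>in_edges v. ?f e * wind l (v - fst e) (outgoing G v))"
    by (simp only: sum.distrib ac_simps)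
  have parity: "[(\<Sum>e\<in>E. ?f e * basic_signature G l e) + ?c =
      (\<Sum>b\<in>sources. ?o + L C b) + (\<Sum>e\<in>?S. ?f e) +
      (\<Sum>v\<in>?W. U C v + sum (A C) (out_edges v)) +
      (\<Sum>v\<in>?K. U C v + sum (A C) (out_edges v))] (mod 2)"
    unfolding expand
    by (rule cong_add[OF cong_add[OF cong_add[OF intersection_sum[OF C] cong_refl]
          cong_sum[OF white_vertex_parity[OF _ C]]] cong_sum[OF black_vertex_parity[OF _ _ C]]]) auto
  have src: "(\<Sum>b\<in>sources. ?o + L C b) = ?k * ?o + (\<Sum>e\<in>?S. B C e)"
    unfolding sum.distrib sum_sources using card_sources by simp
  \<comment> \<open>The final bookkeeping over the integers: \<open>sa\<close>, \<open>sb\<close>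
    are the sums of \<open>A\<close>, \<open>B\<close> over the source edges, \<open>ai\<close> that
    of \<open>A\<close> over the edges with internal tail, \<open>ta\<close> that of
    \<open>A\<close> over all edges, \<open>su\<close> the sum of \<open>U\<close>, and
    \<open>p\<close> the indicator of the outer face.\<close>
  have combine: "x1 + x2 + x3 + x4 = k + 1 + p + 2 * (sb + su - p)"
    if "x1 = k + sb" "x2 = sa + sb" "x3 + x4 = su + ai" "sa + ai = ta" "ta + p = su + 1"
    for x1 x2 x3 x4 k sa sb su ai ta p :: int
  proof -
    have "x1 + x2 + x3 + x4 = (k + sb) + (sa + sb) + (su + ai)" using that(1,2,3) by simp
    also have "\<dots> = k + 2 * sb + su + (sa + ai)" by simp
    also have "\<dots> = k + 2 * sb + su + (su + 1 - p)" using that(4,5) by simp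
    finally show ?thesis by simp
  qed
  have total: "(\<Sum>b\<in>sources. ?o + L C b) + (\<Sum>e\<in>?S. ?f e) +
      (\<Sum>v\<in>?W. U C v + sum (A C) (out_edges v)) +
      (\<Sum>v\<in>?K. U C v + sum (A C) (out_edges v)) =
      ?k * ?o + 1 + ?o + 2 * ((\<Sum>e\<in>?S. B C e) + (\<Sum>v\<in>internal G. U C v) - ?o)"
    by (rule combine[OF src sum.distrib I AE euler])
  \<comment> \<open>For the outer face the two ones cancel mod 2 and leave \<open>?k\<close>;
    otherwise only the \<open>1\<close> remains.\<close>
  have "[?k * ?o + 1 + ?o + 2 * x = (if C = outer then ?k else 1)] (mod 2)" for x
    by (auto simp: cong_iff_dvd_diff)
  then show ?thesis using cong_trans[OF parity[unfolded total]] by blast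
qed

subsection \<open>Faces of the disc\<close>

lemma signature_parity:
  assumes C: "C \<in> components M" and eq: "equivalent_signatures G (basic_signature G l) \<epsilon>"
  shows "[(\<Sum>e\<in>E. (A C e + B C e) * \<epsilon> e) + (\<Sum>v\<in>white G. of_bool (v \<in> closure C)) =
    (if C = outer then int (card (source_indices G)) else 1)] (mod 2)"
proof -
  obtain \<eta> :: "complex \<Rightarrow> int" where "\<forall>(u, v)\<in>E.
           (u \<in> internal G \<and> v \<in> internal G \<longrightarrow> [\<epsilon> (u, v) = basic_signature G l (u, v) + \<eta> u + \<eta> v] (mod 2)) \<and>
           (u \<in> internal G \<and> v \<in> boundary G \<longrightarrow> [\<epsilon> (u, v) = basic_signature G l (u, v) + \<eta> u] (mod 2)) \<and>
           (u \<in> boundary G \<and> v \<in> internal G \<longrightarrow> [\<epsilon> (u, v) = basic_signature G l (u, v) + \<eta> v] (mod 2))"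
    using eq unfolding equivalent_signatures_def by (elim exE conjE)
  note \<eta> = bspec[OF this, unfolded case_prod_conv]
  let ?f = "\<lambda>e. A C e + B C e"
  let ?I = "internal G"
  \<comment> \<open>The factors \<open>of_bool\<close> drop \<open>\<eta>\<close> at a boundary end,
    which merges the three clauses of the equivalence.\<close>
  have eps: "[\<epsilon> e = basic_signature G l e + (\<eta> (fst e) * of_bool (fst e \<in> ?I) + \<eta> (snd e) * of_bool (snd e \<in> ?I))] (mod 2)"
    if e: "e \<in> E" for e
  proof -
    have "(fst e, snd e) \<in> E" using e by simp
    with edge_vertices[OF this] edge_not_boundary[OF this] \<eta>[OF this] boundary_internal show ?thesis
      unfolding vertices_def by (cases "fst e \<in> ?I"; cases "snd e \<in> ?I") (auto simp: add.assoc)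
  qed
  have "[(\<Sum>e\<in>E. ?f e * \<epsilon> e) = (\<Sum>e\<in>E. ?f e *
     (basic_signature G l e + (\<eta> (fst e) * of_bool (fst e \<in> ?I) + \<eta> (snd e) * of_bool (snd e \<in> ?I))))] (mod 2)"
    by (intro cong_sum cong_mult cong_refl eps)
  also have "(\<Sum>e\<in>E. ?f e * (basic_signature G l e + (\<eta> (fst e) * of_bool (fst e \<in> ?I) + \<eta> (snd e) * of_bool (snd e \<in> ?I)))) =
     (\<Sum>e\<in>E. ?f e * basic_signature G l e) +
     ((\<Sum>e\<in>E. (?f e * \<eta> (fst e)) * of_bool (fst e \<in> ?I)) + (\<Sum>e\<in>E. (?f e * \<eta> (snd e)) * of_bool (snd e \<in> ?I)))"
    by (simp only: sum.distrib[symmetric] distrib_left mult.assoc)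
  also have "(\<Sum>e\<in>E. (?f e * \<eta> (fst e)) * of_bool (fst e \<in> ?I)) + (\<Sum>e\<in>E. (?f e * \<eta> (snd e)) * of_bool (snd e \<in> ?I)) =
     2 * (\<Sum>v\<in>?I. of_bool (v \<in> closure C) * \<eta> v)"
  proof -
    have "(\<Sum>e\<in>out_edges v. ?f e * \<eta> (fst e)) + (\<Sum>e\<in>in_edges v. ?f e * \<eta> (snd e)) =
       2 * (of_bool (v \<in> closure C) * \<eta> v)" if v: "v \<in> ?I" for v
    proof -
      have "(\<Sum>e\<in>out_edges v. ?f e * \<eta> (fst e)) + (\<Sum>e\<in>in_edges v. ?f e * \<eta> (snd e)) =
        (\<Sum>e\<in>out_edges v. ?f e * \<eta> v) + (\<Sum>e\<in>in_edges v. ?f e * \<eta> v)"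
        by (intro arg_cong2[where f = "(+)"] sum.cong) auto
      also have "\<dots> = (\<Sum>e\<in>inc v. ?f e * \<eta> v)"
        unfolding inc_split(1)[of v] using finite_edges inc_split(2)[of v]
        by (subst sum.union_disjoint) (auto simp: add.commute)
      also have "\<dots> = (\<Sum>e\<in>inc v. ?f e) * \<eta> v" by (simp only: sum_distrib_right)
      finally show ?thesis unfolding corner_count(2)[OF v C] by simp
    qed
    then show ?thesis
      unfolding sum_by_endpoint[OF finite_internal] sum.distrib[symmetric] sum_distrib_left
      by (intro sum.cong) auto
  qed
  finally have "[(\<Sum>e\<in>E. ?f e * \<epsilon> e) = (\<Sum>e\<in>E. ?f e * basic_signature G l e) +
     2 * (\<Sum>v\<in>?I. of_bool (v \<in> closure C) * \<eta> v)] (mod 2)" .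
  then have "[(\<Sum>e\<in>E. ?f e * \<epsilon> e) = (\<Sum>e\<in>E. ?f e * basic_signature G l e)] (mod 2)"
    by (rule cong_trans) (simp add: cong_iff_dvd_diff)
  from cong_trans[OF cong_add[OF this cong_refl] basic_signature_parity[OF C]] show ?thesis .
qed

text \<open>A point of the closed disc off the drawing has a small ball that meets the closed and
  the open disc in convex sets free of the drawing. Hence adding the points of the circle neither
  joins faces nor enlarges closures.\<close>

lemma disc_face:
  assumes "\<Omega> \<in> faces G"
  shows disc_face_component: "\<Omega> \<inter> ball c r \<in> components M"
    and disc_face_closure: "closure \<Omega> = closure (\<Omega> \<inter> ball c r)"
proof -
  let ?S = "cball c r - D"
  have O: "\<Omega> \<in> components ?S" using assms by (simp add: faces_def)
  then have O': "\<Omega> \<noteq> {}" "\<Omega> \<subseteq> ?S" "connected \<Omega>" by (auto simp: in_components_maximal)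
  have near: "\<exists>\<delta>>0. ball x \<delta> \<inter> D = {}" if "x \<in> ?S" for x
  proof -
    have "open (- D)" using compact_drawing compact_imp_closed open_Compl by blast
    moreover have "x \<in> - D" using that by blast
    ultimately obtain \<delta> where "\<delta> > 0" "ball x \<delta> \<subseteq> - D" by (meson open_contains_ball)
    then show ?thesis by blast
  qed
  have meets: "ball x \<delta> \<inter> ball c r \<noteq> {}" if "x \<in> cball c r" "\<delta> > 0" for x \<delta>
  proof -
    have "x \<in> closure (ball c r)" using that r_pos by simp
    then have "ball x \<delta> \<inter> closure (ball c r) \<noteq> {}" using that(2) by (metis IntI centre_in_ball empty_iff)
    then show ?thesis using open_Int_closure_eq_empty[of "ball x \<delta>" "ball c r"] by simp
  qed
  have subball: "X \<subseteq> \<Omega>" if "connected X" "X \<subseteq> ?S" "X \<inter> \<Omega> \<noteq> {}" for X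
    using components_maximal[OF O that(1,2)] that(3) by blast
  have half: "ball x \<delta> \<inter> cball c r \<subseteq> \<Omega>" if "x \<in> \<Omega>" "\<delta> > 0" "ball x \<delta> \<inter> D = {}" for x \<delta>
  proof (rule subball)
    show "connected (ball x \<delta> \<inter> cball c r)" by (intro convex_connected convex_Int) auto
    have "x \<in> ball x \<delta> \<inter> cball c r \<inter> \<Omega>" using that O' by auto
    then show "ball x \<delta> \<inter> cball c r \<inter> \<Omega> \<noteq> {}" by blast
  qed (use that in blast)
  obtain x where x: "x \<in> \<Omega>" using O' by blast
  obtain \<delta> where d: "\<delta> > 0" "ball x \<delta> \<inter> D = {}" using near x O' by blast
  obtain p where "p \<in> ball x \<delta> \<inter> ball c r" using meets[of x \<delta>] x O' d by blast
  then have p: "p \<in> \<Omega>" "p \<in> M" using half[OF x d] d by (auto simp: M_def)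
  obtain C where C: "C \<in> components M" "p \<in> C" using p(2) by (metis Union_components UnionE)
  have C': "C \<subseteq> M" "connected C" using C in_components_subset in_components_connected by blast+
  have CO: "C \<subseteq> \<Omega>" using C' C p by (intro subball) (auto simp: M_def)
  have oC: "open C" using C open_M open_components by blast
  have step: "ball x \<delta> \<inter> ball c r \<subseteq> C" if "x \<in> closure C" "\<delta> > 0" "ball x \<delta> \<inter> D = {}" for x \<delta>
  proof (rule components_maximal[OF C(1)])
    show "connected (ball x \<delta> \<inter> ball c r)" by (intro convex_connected convex_Int) auto
    show "ball x \<delta> \<inter> ball c r \<subseteq> M" using that by (auto simp: M_def)
    have "ball x \<delta> \<inter> C \<noteq> {}" using that open_Int_closure_eq_empty[of "ball x \<delta>" C] by (metis IntI centre_in_ball emptyE open_ball)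
    then show "C \<inter> (ball x \<delta> \<inter> ball c r) \<noteq> {}" using C' M_ball by blast
  qed
  have "\<Omega> \<subseteq> closure C"
  proof -
    \<comment> \<open>\<open>\<Omega> \<inter> closure C\<close> is shown to be open and closed in
      the connected set \<open>\<Omega>\<close>.\<close>
    have "openin (top_of_set \<Omega>) (\<Omega> \<inter> closure C)"
      unfolding openin_contains_ball
    proof (intro conjI ballI)
      fix x assume x: "x \<in> \<Omega> \<inter> closure C"
      obtain \<delta> where d: "\<delta> > 0" "ball x \<delta> \<inter> D = {}" using near x O' by blast
      have sub: "ball x \<delta> \<inter> ball c r \<subseteq> C" using step x d by blast
      have "y \<in> closure C" if y: "y \<in> ball x \<delta>" "y \<in> \<Omega>" for y
      proof -
        have "y \<in> closure (ball c r)" using y O' r_pos by auto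
        then have "y \<in> closure (ball x \<delta> \<inter> ball c r)"
          using y(1) open_Int_closure_subset[of "ball x \<delta>" "ball c r"] by blast
        then show ?thesis using closure_mono[OF sub] by blast
      qed
      then show "\<exists>e>0. ball x e \<inter> \<Omega> \<subseteq> \<Omega> \<inter> closure C" using d(1) by blast
    qed blast
    moreover have "closedin (top_of_set \<Omega>) (\<Omega> \<inter> closure C)" by (simp add: closedin_closed_Int)
    moreover have "\<Omega> \<inter> closure C \<noteq> {}" using C(2) p(1) closure_subset by blast
    ultimately show ?thesis using O'(3) by (metis Int_absorb1 connected_clopen inf.cobounded2 inf_commute)
  qed
  moreover have "\<Omega> \<inter> ball c r = C"
  proof
    show "C \<subseteq> \<Omega> \<inter> ball c r" using CO C' M_ball by blast
    show "\<Omega> \<inter> ball c r \<subseteq> C"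
    proof
      fix x assume x: "x \<in> \<Omega> \<inter> ball c r"
      obtain \<delta> where d: "\<delta> > 0" "ball x \<delta> \<inter> D = {}" using near x O' by blast
      have "x \<in> closure C" using x \<open>\<Omega> \<subseteq> closure C\<close> by blast
      then have "ball x \<delta> \<inter> ball c r \<subseteq> C" using d by (rule step)
      moreover have "x \<in> ball x \<delta> \<inter> ball c r" using x d(1) by simp
      ultimately show "x \<in> C" by blast
    qed
  qed
  ultimately show "\<Omega> \<inter> ball c r \<in> components M" "closure \<Omega> = closure (\<Omega> \<inter> ball c r)"
    using C(1) CO closure_minimal[of \<Omega> "closure C"] closure_mono[of C \<Omega>] by auto
qed

text \<open>Points of the drawing are not in \<open>\<Omega>\<close>, so for them frontier and
  closure agree.\<close>

lemma disc_face_frontier: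
  assumes "\<Omega> \<in> faces G" "x \<in> D"
  shows "x \<in> frontier \<Omega> \<longleftrightarrow> x \<in> closure (\<Omega> \<inter> ball c r)"
proof -
  have "\<Omega> \<subseteq> cball c r - D" using assms(1) in_components_subset unfolding faces_def by blast
  then have "x \<notin> interior \<Omega>" using assms(2) interior_subset by blast
  then show ?thesis using disc_face_closure[OF assms(1)] by (simp add: frontier_def)
qed

lemma face_edges_eq:
  assumes O: "\<Omega> \<in> faces G" and C: "C = \<Omega> \<inter> ball c r"
  shows "face_edges G \<Omega> = {e \<in> E. above e = C \<or> below e = C}"
proof -
  note Cc = disc_face_component[OF O, folded C]
  have "cseg e \<subseteq> frontier \<Omega> \<longleftrightarrow> above e = C \<or> below e = C" if e: "e \<in> E" for e
  proof -
    have "cseg e \<subseteq> D" using e drawing_eq_cseg by blast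
    then have fr: "cseg e \<subseteq> frontier \<Omega> \<longleftrightarrow> cseg e \<subseteq> closure C"
      using disc_face_frontier[OF O, folded C] by blast
    obtain w where w: "w \<in> oseg e" using oseg_nonempty[OF e] by blast
    show ?thesis unfolding fr
    proof
      assume "cseg e \<subseteq> closure C"
      then have "w \<in> closure C" using w by (auto simp: cseg_eq)
      then show "above e = C \<or> below e = C" using face_at_edge[OF e w Cc] by blast
    next
      assume "above e = C \<or> below e = C"
      then show "cseg e \<subseteq> closure C" using edge_in_closure[OF e] by blast
    qed
  qed
  moreover have "face_edges G \<Omega> = {e \<in> E. cseg e \<subseteq> frontier \<Omega>}" by (auto simp: face_edges_def cseg_def)
  ultimately show ?thesis by blast
qed

lemma face_signature_eq:
  assumes "\<Omega> \<in> faces G" "C = \<Omega> \<inter> ball c r"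
  shows "face_signature G \<epsilon> \<Omega> = (\<Sum>e\<in>E. (A C e + B C e) * \<epsilon> e)"
proof -
  have "A C e + B C e = of_bool (above e = C \<or> below e = C)" if "e \<in> E" for e
    using above_neq_below[OF that] by (auto simp: A_def B_def)
  then have "(\<Sum>e\<in>E. (A C e + B C e) * \<epsilon> e) = (\<Sum>e\<in>E. of_bool (above e = C \<or> below e = C) * \<epsilon> e)"
    by (intro sum.cong) auto
  also have "\<dots> = sum \<epsilon> (E \<inter> {e. above e = C \<or> below e = C})"
    by (rule sum_of_bool_mult_eq[OF finite_edges])
  also have "E \<inter> {e. above e = C \<or> below e = C} = face_edges G \<Omega>" using face_edges_eq[OF assms] by blast
  finally show ?thesis by (simp add: face_signature_def)
qed

lemma n_white_eq:
  assumes "\<Omega> \<in> faces G" "C = \<Omega> \<inter> ball c r"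
  shows "int (n_white G \<Omega>) = (\<Sum>v\<in>white G. of_bool (v \<in> closure C))"
proof -
  have fin: "finite (white G)" using finite_subset[OF white_internal finite_internal] .
  have "white G \<subseteq> D" using white_internal drawing_eq by (auto simp: vertices_def)
  then have "white G \<inter> frontier \<Omega> = white G \<inter> {v. v \<in> closure C}"
    using disc_face_frontier[OF assms(1), folded assms(2)] by blast
  then show ?thesis using fin by (simp add: n_white_def)
qed

text \<open>Both properties are tested at a single point \<open>w\<close> of the circle, antipodal
  to the first boundary vertex.\<close>

lemma infinite_face_iff:
  assumes O: "\<Omega> \<in> faces G"
  shows "infinite_face G \<Omega> \<longleftrightarrow> \<Omega> \<inter> ball c r = outer"
proof -
  let ?n = "bnum G" and ?circ = "\<lambda>t. c + of_real r * cis t"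
  obtain \<theta> :: "nat \<Rightarrow> real" where
    b: "\<And>i. i \<in> {1..?n} \<Longrightarrow> bvert G i = ?circ (\<theta> i)" and
    dec: "\<And>i j. i \<in> {1..?n} \<Longrightarrow> j \<in> {1..?n} \<Longrightarrow> i < j \<Longrightarrow> \<theta> j < \<theta> i" and
    short: "\<theta> 1 - \<theta> ?n < pi" using common_arc by metis
  have n: "1 \<in> {1..?n}" "?n \<in> {1..?n}" using bnum_pos by auto
  have bd: "\<theta> ?n \<le> \<theta> i \<and> \<theta> i \<le> \<theta> 1" if "i \<in> {1..?n}" for i
    using dec[of 1 i] dec[of i ?n] that by (cases "i = 1"; cases "i = ?n") (auto simp: less_imp_le)
  have circ_eq: "?circ s = ?circ t \<longleftrightarrow> (\<exists>m::int. s = t + 2 * pi * m)" for s t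
    by (rule circle_point_eq_iff[OF r_pos])
  define I where "I = ?circ ` {\<theta> 1<..<\<theta> ?n + 2 * pi}"
  have arc_I: "clockwise_arc c r (bvert G ?n) (bvert G 1) \<subseteq> I"
  proof
    fix z assume "z \<in> clockwise_arc c r (bvert G ?n) (bvert G 1)"
    then obtain t \<alpha> \<beta> where t: "z = ?circ t" "bvert G ?n = ?circ \<alpha>" "bvert G 1 = ?circ \<beta>"
      "\<beta> < t" "t < \<alpha>" "\<alpha> \<le> \<beta> + 2 * pi" unfolding clockwise_arc_def by blast
    obtain p :: int where p: "\<alpha> = \<theta> ?n + 2 * pi * p" using t(2) b[OF n(2)] circ_eq by metis
    obtain q :: int where q: "\<beta> = \<theta> 1 + 2 * pi * q" using t(3) b[OF n(1)] circ_eq by metis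
    \<comment> \<open>\<open>p\<close> and \<open>q\<close> count full turns. The order of the
      angles and the length bound \<open>2 * pi\<close> leave only \<open>p = q + 1\<close>, so
      every admissible choice of angles gives the same arc.\<close>
    have m1: "2 * pi * (real_of_int p - real_of_int q) < 2 * pi * 2"
      using p q t(6) short pi_gt_zero unfolding right_diff_distrib by linarith
    have m0: "2 * pi * 0 < 2 * pi * (real_of_int p - real_of_int q)"
      using p q t(4,5) bd[OF n(2)] unfolding right_diff_distrib by linarith
    have "real_of_int p - real_of_int q < 2" "0 < real_of_int p - real_of_int q"
      using m0 m1 pi_gt_zero by (simp_all only: mult_less_cancel_left_pos mult_pos_pos zero_less_numeral)
    then have pq: "p = q + 1" by linarith
    have "z = ?circ (t - 2 * pi * q)" unfolding t(1) circ_eq by (intro exI[of _ q]) simp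
    moreover have "t - 2 * pi * q \<in> {\<theta> 1<..<\<theta> ?n + 2 * pi}"
      using t(4,5) p q unfolding pq by (simp add: distrib_left)
    ultimately show "z \<in> I" unfolding I_def by blast
  qed
  have I_sphere: "I \<subseteq> sphere c r" using r_pos by (auto simp: I_def dist_norm norm_mult)
  have "I \<inter> boundary G = {}"
  proof -
    have False if z: "z \<in> I" "z \<in> boundary G" for z
    proof -
      obtain t where "z = ?circ t" "t \<in> {\<theta> 1<..<\<theta> ?n + 2 * pi}" using z(1) unfolding I_def by (elim imageE)
      then have t: "z = ?circ t" "\<theta> 1 < t" "t < \<theta> ?n + 2 * pi" by auto
      obtain i where i: "i \<in> {1..?n}" "z = bvert G i" using z(2) by (auto simp: boundary_def)
      then obtain m :: int where m: "t = \<theta> i + 2 * pi * m" using t(1) b circ_eq by metis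
      have "2 * pi * 0 < 2 * pi * real_of_int m" "2 * pi * real_of_int m < 2 * pi * 1"
        using m t bd[OF i(1)] by linarith+
      then have "0 < real_of_int m" "real_of_int m < 1"
        using pi_gt_zero by (simp_all only: mult_less_cancel_left_pos mult_pos_pos zero_less_numeral)
      then have "0 < m" "m < 1" by simp_all
      then show False by simp
    qed
    then show ?thesis by blast
  qed
  then have I_disc: "I \<subseteq> cball c r - D" using I_sphere drawing_sphere by fastforce
  have I_conn: "connected I"
    unfolding I_def by (intro connected_continuous_image continuous_intros) (simp add: convex_connected)
  \<comment> \<open>As the boundary vertices occupy less than a half circle, the antipode of
    \<open>bvert G 1\<close> is on the complementary arc; it is on the lower half circle because
    \<open>bvert G 1\<close> is on the upper one.\<close>
  define w where "w = ?circ (\<theta> 1 + pi)"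
  have w_arc: "w \<in> clockwise_arc c r (bvert G ?n) (bvert G 1)"
    unfolding clockwise_arc_def w_def
  proof (intro CollectI exI conjI refl)
    show "bvert G ?n = ?circ (\<theta> ?n + 2 * pi)" unfolding b[OF n(2)] circ_eq by (intro exI[of _ "- 1"]) simp
    show "bvert G 1 = ?circ (\<theta> 1)" by (rule b[OF n(1)])
  qed (use short pi_gt_zero bd[OF n(2)] in auto)
  have O': "\<Omega> \<in> components (cball c r - D)" using O by (simp add: faces_def)
  have inf_w: "infinite_face G \<Omega> \<longleftrightarrow> w \<in> \<Omega>"
  proof
    assume "infinite_face G \<Omega>"
    then show "w \<in> \<Omega>" using w_arc by (auto simp: infinite_face_def)
  next
    assume "w \<in> \<Omega>"
    then have "I \<subseteq> \<Omega>" using components_maximal[OF O' I_conn I_disc] w_arc arc_I by blast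
    then show "infinite_face G \<Omega>" using O arc_I by (auto simp: infinite_face_def)
  qed
  have "w - c = - (bvert G 1 - c)"
    unfolding w_def b[OF n(1)] by (simp add: complex_eq_iff)
  moreover have "Y (bvert G 1 - c) > 0" using boundary_Y n(1) by (auto simp: boundary_def simp del: XY_linear)
  ultimately have "Y (w - c) < 0" by (metis XY_linear(10) neg_less_0_iff_less)
  moreover have ws: "w \<in> sphere c r" using w_arc arc_I I_sphere by blast
  ultimately obtain x where x: "\<bar>x\<bar> < r / norm l" "w = lower_arc x" using lower_arc_surj by blast
  obtain \<delta> where \<delta>: "\<delta> > 0" "ball w \<delta> \<inter> ball c r \<subseteq> exit_region"
    using lower_arc_Up(3)[OF x(1) open_UNIV] x(2) by auto
  let ?H = "ball w \<delta> \<inter> ball c r"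
  note Cc = disc_face_component[OF O]
  have "w \<in> \<Omega> \<longleftrightarrow> \<Omega> \<inter> ball c r = outer"
  proof
    assume "w \<in> \<Omega>"
    then have "w \<in> closure (\<Omega> \<inter> ball c r)" using disc_face_closure[OF O] closure_subset by blast
    then have "ball w \<delta> \<inter> (\<Omega> \<inter> ball c r) \<noteq> {}"
      using \<delta>(1) open_Int_closure_eq_empty[of "ball w \<delta>" "\<Omega> \<inter> ball c r"] by (metis IntI centre_in_ball emptyE open_ball)
    then obtain z where "z \<in> \<Omega> \<inter> ball c r" "z \<in> ?H" by blast
    then show "\<Omega> \<inter> ball c r = outer"
      using face_eqI[OF Cc outer_face] \<delta>(2) exit_region_outer by blast
  next
    assume eq: "\<Omega> \<inter> ball c r = outer"
    \<comment> \<open>\<open>w\<close> is on the circle, hence not in \<open>outer\<close>; as a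
      limit point of the connected set \<open>?H\<close> it can be added to it, which ties it to
      \<open>\<Omega>\<close>.\<close>
    have "w \<in> closure ?H"
    proof (unfold closure_approachable, intro allI impI)
      fix e :: real assume "0 < e"
      then have "Up w \<inter> ball w (min e \<delta>) \<noteq> {}"
        using lower_arc_Up(1)[OF x(1) open_ball, of w "min e \<delta>"] x(2) \<delta>(1) by simp
      then obtain z where z: "z \<in> Up w" "dist w z < e" "dist w z < \<delta>" by auto
      then have "z \<in> ball c r" using Up_M M_ball by blast
      then have "z \<in> ?H" using z(3) by simp
      then show "\<exists>y\<in>?H. dist y w < e" using z(2) by (auto simp: dist_commute)
    qed
    then have "insert w ?H \<subseteq> closure ?H" "?H \<noteq> {}" using closure_subset[of ?H] by (blast, force)
    moreover have "connected ?H" by (intro convex_connected convex_Int) auto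
    ultimately have "connected (insert w ?H)"
      using connected_intermediate_closure[of ?H "insert w ?H"] by blast
    moreover have "insert w ?H \<subseteq> cball c r - D"
      using \<delta>(2) exit_region_M M_ball w_arc arc_I I_disc by (fastforce simp: M_def)
    moreover have "\<Omega> \<inter> insert w ?H \<noteq> {}" using \<open>?H \<noteq> {}\<close> \<delta>(2) exit_region_outer eq by blast
    ultimately show "w \<in> \<Omega>" using components_maximal[OF O', of "insert w ?H"] by blast
  qed
  then show ?thesis using inf_w by simp
qed

end

theorem mainTheorem8:
  fixes G :: plabic and \<epsilon> :: "complex \<times> complex \<Rightarrow> int" and k :: nat
  assumes "plabic_graph G" and "PBDTP G"
    and "k = card (source_indices G)"
    and "geometric_signature G \<epsilon>"
  shows "(\<forall>\<Omega>. finite_face G \<Omega> \<longrightarrow>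
            [face_signature G \<epsilon> \<Omega> = int (n_white G \<Omega>) + 1] (mod 2)) \<and>
         (\<forall>\<Omega>. infinite_face G \<Omega> \<longrightarrow>
            [face_signature G \<epsilon> \<Omega> = int (n_white G \<Omega>) + int k] (mod 2))"
proof -
  obtain l where l: "gauge_direction G l" "equivalent_signatures G (basic_signature G l) \<epsilon>"
    using assms(4) unfolding geometric_signature_def by blast
  interpret gauged_graph G l by unfold_locales (fact assms(1) assms(2) l(1))+
  have parity: "[face_signature G \<epsilon> \<Omega> = int (n_white G \<Omega>) + (if infinite_face G \<Omega> then int k else 1)] (mod 2)"
    if O: "\<Omega> \<in> faces G" for \<Omega>
  proof -
    have "[face_signature G \<epsilon> \<Omega> + int (n_white G \<Omega>) = (if infinite_face G \<Omega> then int k else 1)] (mod 2)"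
      using signature_parity[OF disc_face_component[OF O] l(2)]
      unfolding face_signature_eq[OF O refl] n_white_eq[OF O refl] infinite_face_iff[OF O] assms(3) .
    \<comment> \<open>Adding \<open>n_white\<close> twice is neutral mod 2; this moves it to the
      right-hand side.\<close>
    then have "[face_signature G \<epsilon> \<Omega> + int (n_white G \<Omega>) + int (n_white G \<Omega>) =
        (if infinite_face G \<Omega> then int k else 1) + int (n_white G \<Omega>)] (mod 2)" by (intro cong_add cong_refl)
    moreover have "[face_signature G \<epsilon> \<Omega> = face_signature G \<epsilon> \<Omega> + int (n_white G \<Omega>) + int (n_white G \<Omega>)] (mod 2)"
      by (simp add: cong_iff_dvd_diff)
    ultimately show ?thesis by (simp only: add.commute[of "int (n_white G \<Omega>)"]) (rule cong_trans)
  qed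
  show ?thesis
  proof (intro conjI allI impI)
    fix \<Omega> assume "finite_face G \<Omega>"
    then have "\<Omega> \<in> faces G" "\<not> infinite_face G \<Omega>" by (simp_all add: finite_face_def)
    then show "[face_signature G \<epsilon> \<Omega> = int (n_white G \<Omega>) + 1] (mod 2)" using parity[of \<Omega>] by simp
  next
    fix \<Omega> assume inf: "infinite_face G \<Omega>"
    then have "\<Omega> \<in> faces G" by (simp add: infinite_face_def)
    then show "[face_signature G \<epsilon> \<Omega> = int (n_white G \<Omega>) + int k] (mod 2)" using parity[of \<Omega>] inf by simp
  qed
qed

end
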